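(* Let $d\ge1$ be an integer, $0<s<d$, and $N\ge1$. Assume $$\Lambda_N>\max_{1\le k<N}\Lambda_k ,$$ where for $N=1$ the maximum over the empty set is omitted (so that the assumption is vacuous). Then $\Lambda_N$ is attained, i.e. there exists $\rho\in\mathcal A_N$ with $\mathcal G_N(\rho)/\mathcal L(\rho)=\Lambda_N$.
   Context: Set $p:=1+s/d$. For an integer $N\ge1$, let $\mathcal A_N:=\{\rho\in L^1(\mathbb R^d)\cap L^p(\mathbb R^d):\rho\ge0,\ \int_{\mathbb R^d}\rho=N\}$. For a symmetric probability measure $P$ on $(\mathbb R^d)^N$ let $\rho_P:=\sum_{i=1}^N(\pi_i)_\#P$, where $\pi_i$ is the $i$-th coordinate projection; it is identified with its density when absolutely continuous. For $\rho\in\mathcal A_N$ let $$\mathcal W_N(\rho):=\min\Big\{\int_{(\mathbb R^d)^N}\sum_{1\le i<j\le N}\frac1{|x_i-x_j|^s}\,\mathrm dP:\ P\text{ a symmetric probability measure on }(\mathbb R^d)^N,\ \rho_P=\rho\Big\},$$ $$D(\rho):=\iint_{\mathbb R^d\times\mathbb R^d}\frac{\rho(x)\rho(y)}{|x-y|^s}\,\mathrm dx\,\mathrm dy,\quad \mathcal G_N(\rho):=\tfrac12D(\rho)-\mathcal W_N(\rho),\quad \mathcal L(\rho):=\int_{\mathbb R^d}\rho^p,$$ $$\Lambda_N:=\Lambda_N(s,d):=\sup_{\rho\in\mathcal A_N}\frac{\mathcal G_N(\rho)}{\mathcal L(\rho)}.$$ *)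

theory Defs
  imports "HOL-Probability.Probability"
begin

text \<open>
  The space \<open>\<real>\<^sup>d\<close> is a type \<open>'a :: euclidean_space\<close> with \<open>d = DIM('a)\<close>. Since the particle number
  varies inside the statement, \<open>(\<real>\<^sup>d)\<^sup>N\<close> is the product space over the index set \<open>{..<N}\<close>, so particles
  are numbered from 0.
\<close>

abbreviation config_space :: "nat \<Rightarrow> (nat \<Rightarrow> 'a::euclidean_space) measure" where
  "config_space N \<equiv> Pi\<^sub>M {..<N} (\<lambda>_. borel)"

text \<open>
  The kernel is \<open>ennreal\<close>-valued so that it is infinite on the diagonal; over the reals \<open>1 / 0\<close> would be 0.
\<close>

definition riesz_kernel :: "real \<Rightarrow> 'a::euclidean_space \<Rightarrow> 'a \<Rightarrow> ennreal" where
  "riesz_kernel s x y = 1 / ennreal (norm (x - y) powr s)"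

lemma riesz_kernel_diag: "riesz_kernel s x x = \<infinity>"
  by (simp add: riesz_kernel_def ennreal_divide_zero)

text \<open>
  Elements of \<open>L\<^sup>1 \<inter> L\<^sup>p\<close> are represented by Borel functions; nonnegativity is therefore required
  almost everywhere.
\<close>

definition admissible :: "real \<Rightarrow> nat \<Rightarrow> ('a::euclidean_space \<Rightarrow> real) set" where
  "admissible s N = {\<rho>.
     integrable lborel \<rho> \<and>
     integrable lborel (\<lambda>x. \<bar>\<rho> x\<bar> powr (1 + s / real DIM('a))) \<and>
     (AE x in lborel. 0 \<le> \<rho> x) \<and>
     (LINT x|lborel. \<rho> x) = real N}"

definition sym_prob :: "nat \<Rightarrow> (nat \<Rightarrow> 'a::euclidean_space) measure \<Rightarrow> bool" where
  "sym_prob N P \<longleftrightarrow>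
     prob_space P \<and> sets P = sets (config_space N) \<and>
     (\<forall>\<sigma>. \<sigma> permutes {..<N} \<longrightarrow>
        distr P (config_space N) (\<lambda>x. \<lambda>i\<in>{..<N}. x (\<sigma> i)) = P)"

definition one_body :: "nat \<Rightarrow> (nat \<Rightarrow> 'a::euclidean_space) measure \<Rightarrow> 'a measure" where
  "one_body N P =
     measure_of UNIV (sets borel) (\<lambda>A. \<Sum>i<N. emeasure (distr P borel (\<lambda>x. x i)) A)"

lemma sets_one_body: "sets (one_body N P) = sets borel"
  unfolding one_body_def by (metis sets.sets_measure_of_eq space_borel)

lemma emeasure_one_body:
  assumes "A \<in> sets borel"
  shows "emeasure (one_body N P) A = (\<Sum>i<N. emeasure (distr P borel (\<lambda>x. x i)) A)"
proof (rule emeasure_measure_of[OF one_body_def])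
  show "countably_additive (sets (one_body N P))
      (\<lambda>A. \<Sum>i<N. emeasure (distr P borel (\<lambda>x. x i)) A)"
    unfolding countably_additive_def sets_one_body
  proof (intro allI impI)
    fix B :: "nat \<Rightarrow> 'a set"
    assume B: "range B \<subseteq> sets borel" "disjoint_family B"
    have "(\<Sum>k. \<Sum>i<N. emeasure (distr P borel (\<lambda>x. x i)) (B k)) =
        (\<Sum>i<N. \<Sum>k. emeasure (distr P borel (\<lambda>x. x i)) (B k))"
      by (rule suminf_sum) simp
    also have "\<dots> = (\<Sum>i<N. emeasure (distr P borel (\<lambda>x. x i)) (\<Union>k. B k))"
      using B by (intro sum.cong refl suminf_emeasure) auto
    finally show "(\<Sum>k. \<Sum>i<N. emeasure (distr P borel (\<lambda>x. x i)) (B k)) =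
        (\<Sum>i<N. emeasure (distr P borel (\<lambda>x. x i)) (\<Union>k. B k))" .
  qed
qed (use assms in \<open>auto simp: positive_def sets_one_body\<close>)

definition plans :: "nat \<Rightarrow> ('a::euclidean_space \<Rightarrow> real) \<Rightarrow> (nat \<Rightarrow> 'a) measure set" where
  "plans N \<rho> = {P. sym_prob N P \<and> one_body N P = density lborel (\<lambda>x. ennreal (\<rho> x))}"

text \<open>
  The minimum over plans is written as an infimum in \<open>ennreal\<close>; the two agree whenever the minimum exists.
\<close>

definition W :: "real \<Rightarrow> nat \<Rightarrow> ('a::euclidean_space \<Rightarrow> real) \<Rightarrow> ennreal" where
  "W s N \<rho> = (INF P\<in>plans N \<rho>.
     \<integral>\<^sup>+x. (\<Sum>j<N. \<Sum>i<j. riesz_kernel s (x i) (x j)) \<partial>P)"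

definition D :: "real \<Rightarrow> ('a::euclidean_space \<Rightarrow> real) \<Rightarrow> ennreal" where
  "D s \<rho> = (\<integral>\<^sup>+x. \<integral>\<^sup>+y.
     ennreal (\<rho> x) * ennreal (\<rho> y) * riesz_kernel s x y \<partial>lborel \<partial>lborel)"

text \<open>
  Working in \<open>ereal\<close> avoids default values for \<open>D\<close>, \<open>W\<close> and the supremum. On admissible densities
  \<open>D\<close> is finite (Hardy--Littlewood--Sobolev), so the difference below is never \<open>\<infinity> - \<infinity>\<close>.
\<close>

definition G :: "real \<Rightarrow> nat \<Rightarrow> ('a::euclidean_space \<Rightarrow> real) \<Rightarrow> ereal" where
  "G s N \<rho> = ereal (1/2) * enn2ereal (D s \<rho>) - enn2ereal (W s N \<rho>)"

definition L :: "real \<Rightarrow> ('a::euclidean_space \<Rightarrow> real) \<Rightarrow> real" where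
  "L s \<rho> = (LINT x|lborel. \<rho> x powr (1 + s / real DIM('a)))"

definition Lambda :: "'a::euclidean_space itself \<Rightarrow> real \<Rightarrow> nat \<Rightarrow> ereal" where
  "Lambda _ s N = (SUP \<rho>\<in>(admissible s N :: ('a \<Rightarrow> real) set). G s N \<rho> / ereal (L s \<rho>))"

end

theory Submission
  imports Defs
begin

text \<open>
  Consider states of \<open>N\<close> random points each of which may be absent. Absent particles can be added far
  away, spread over a large volume, at no cost; so these states obey the same bound as states with
  exactly \<open>N\<close> particles. Along a maximizing sequence, scaled so that \<open>L = 1\<close> and translated so as not to
  vanish, all particles can be realized on one probability space such that each of them almost surely
  converges or escapes to infinity. The escaping particles decouple from the others and obey the bound
  themselves, hence the limit of the others is an optimal state. Its number of particles is constant: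
  if a configuration with fewer particles than the average occurred with positive probability, one
  would gain by adding a small density far away to this configuration only, because to first order
  \<open>D / 2\<close> grows with the average number of particles and the cost with the actual one. So the limit
  is an optimal state with exactly \<open>k\<close> particles for some \<open>1 \<le> k \<le> N\<close>, and \<open>k < N\<close> is excluded by
  \<open>Lambda k < Lambda N\<close>.
\<close>

subsection \<open>The Riesz kernel\<close>

text \<open>The obstacle is loss of mass in the limit. The cost is linear in the law of the
  particles, but \<open>D\<close> is quadratic in the averaged density, so a mixture of particle
  numbers cannot be split into its sectors and estimated sector by sector. The bound by
  \<open>Lambda\<close> has to hold for mixtures as a whole, and constancy of the particle number
  has to be drawn from optimality.

  The normalization \<open>L = 1\<close> is possible because \<open>D\<close>, \<open>W\<close> and
  \<open>L\<close> scale by the same power of the length, which is what the exponent 1 + s/d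
  achieves. A bound on \<open>L\<close> also tames the singularity of the kernel: small balls carry
  uniformly little mass, so pairs at short distance carry uniformly little energy, and what remains
  is a bounded continuous kernel.

  Realizing all states on one probability space replaces weak limits by pointwise ones. Fatou's
  lemma then handles the cost and \<open>L\<close>, dominated convergence handles the truncated
  energy, and the event that a given particle stays is the same along the whole sequence.\<close>

lemma riesz_kernel_measurable [measurable (raw)]:
  assumes [measurable]: "f \<in> borel_measurable M" "g \<in> borel_measurable M"
  shows "(\<lambda>x. riesz_kernel s (f x :: 'a::euclidean_space) (g x)) \<in> borel_measurable M"
  unfolding riesz_kernel_def divide_ennreal_def by measurable

lemma riesz_kernel_commute: "riesz_kernel s x y = riesz_kernel s y x"
  by (simp add: riesz_kernel_def norm_minus_commute)

lemma riesz_kernel_offdiag: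
  assumes "x \<noteq> y"
  shows "riesz_kernel s x y = ennreal (norm (x - y) powr - s)"
  using assms by (simp add: riesz_kernel_def powr_minus divide_ennreal_def inverse_ennreal)

lemma riesz_kernel_translate: "riesz_kernel s (x + a) (y + a) = riesz_kernel s x y"
  by (simp add: riesz_kernel_def)

lemma riesz_kernel_affine:
  assumes "0 < c"
  shows "riesz_kernel s (c *\<^sub>R x + a) (c *\<^sub>R y + a) = ennreal (c powr - s) * riesz_kernel s x y"
proof (cases "x = y")
  case True
  then show ?thesis
    using assms by (simp add: riesz_kernel_diag ennreal_mult_top)
next
  case False
  have "norm (c *\<^sub>R x + a - (c *\<^sub>R y + a)) = c * norm (x - y)"
    using assms by (simp flip: scaleR_diff_right)
  then show ?thesis
    using assms False
    by (simp add: riesz_kernel_offdiag powr_mult ennreal_mult)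
qed

lemma riesz_kernel_le:
  assumes "0 < s" "0 < R" "R \<le> norm (x - y)"
  shows "riesz_kernel s x y \<le> ennreal (R powr - s)"
proof -
  have "x \<noteq> y" using assms by auto
  then show ?thesis
    using assms by (simp add: riesz_kernel_offdiag powr_mono2')
qed

lemma tendsto_riesz_kernel:
  assumes "0 < s" and X: "X \<longlonglongrightarrow> x" and Y: "Y \<longlonglongrightarrow> y"
  shows "(\<lambda>n. riesz_kernel s (X n) (Y n)) \<longlonglongrightarrow> riesz_kernel s x y"
proof -
  have "(\<lambda>n. norm (X n - Y n) powr s) \<longlonglongrightarrow> norm (x - y) powr s"
    using assms by (intro tendsto_powr' tendsto_intros) auto
  then have "(\<lambda>n. inverse (ennreal (norm (X n - Y n) powr s))) \<longlonglongrightarrow> inverse (ennreal (norm (x - y) powr s))"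
    by (intro continuous_on_tendsto_compose[OF continuous_on_inverse_ennreal[OF continuous_on_id[of UNIV]]] tendsto_ennrealI)
      auto
  then show ?thesis
    by (simp add: riesz_kernel_def divide_ennreal_def)
qed

lemma emeasure_lborel_ball:
  assumes "0 \<le> r"
  shows "emeasure lborel (ball (c::'a::euclidean_space) r) = ennreal (unit_ball_vol (real DIM('a)) * r ^ DIM('a))"
  using emeasure_ball[OF assms, of c] by simp

definition riesz_const :: "'a::euclidean_space itself \<Rightarrow> real \<Rightarrow> real" where
  "riesz_const _ s = unit_ball_vol (real DIM('a)) * 2 powr s / (1 - 2 powr (s - real DIM('a)))"

lemma riesz_const_pos:
  assumes "s < real DIM('a::euclidean_space)"
  shows "0 < riesz_const TYPE('a) s"
  using assms by (simp add: riesz_const_def powr_less_one)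

text \<open>The constant comes from a dyadic decomposition of the ball around the singularity.\<close>

lemma nn_integral_riesz_kernel_ball:
  fixes x :: "'a::euclidean_space"
  assumes s: "0 < s" "s < real DIM('a)" and R: "0 < R"
  shows "(\<integral>\<^sup>+y\<in>ball x R. riesz_kernel s x y \<partial>lborel)
           \<le> ennreal (riesz_const TYPE('a) s * R powr (real DIM('a) - s))"
proof -
  define d where "d = real DIM('a)"
  define v where "v = unit_ball_vol d"
  \<comment> \<open>Ratio of the contributions of consecutive dyadic balls: halving the radius
    multiplies the kernel bound by 2^s and the volume by 2^-d. It is below 1 because s < d.\<close>
  define q where "q = 2 powr (s - d)"
  have q: "0 < q" "q < 1"
    using s by (auto simp: q_def d_def powr_less_one)
  have v: "0 < v" by (simp add: v_def d_def)
    have summand: "(R / 2 ^ Suc k) powr - s * (v * (R / 2 ^ k) ^ DIM('a)) = v * 2 powr s * R powr (d - s) * q ^ k" for k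
    proof -
      have "(R / 2 ^ Suc k) powr - s = R powr - s * 2 powr (s * Suc k)"
      proof -
        have "(2::real) ^ Suc k = 2 powr Suc k" by (subst powr_realpow) auto
        then show ?thesis
          using R by (simp add: powr_divide powr_powr powr_minus divide_simps mult.commute)
      qed
      moreover have "(R / 2 ^ k) ^ DIM('a) = R powr d * 2 powr (- d * k)"
        using R by (simp add: d_def powr_divide powr_minus powr_powr divide_simps flip: powr_realpow)
          (simp add: algebra_simps)
      moreover have "q ^ k = 2 powr (s * k) * 2 powr (- d * k)"
        by (simp add: q_def powr_powr algebra_simps flip: powr_realpow powr_add)
      moreover have "2 powr (s * Suc k) = 2 powr s * 2 powr (s * k)"
        by (simp add: algebra_simps flip: powr_add)
      moreover have "R powr (d - s) = R powr d * R powr - s"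
        by (simp flip: powr_add)
      ultimately show ?thesis by simp
    qed
    have "(\<integral>\<^sup>+y\<in>ball x R. riesz_kernel s x y \<partial>lborel) \<le>
        (\<integral>\<^sup>+y. (\<Sum>k. ennreal ((R / 2 ^ Suc k) powr - s) * indicator (ball x (R / 2 ^ k)) y) \<partial>lborel)"
    proof (intro nn_integral_mono_AE, use AE_lborel_singleton[of x] in eventually_elim)
      fix y assume "y \<noteq> x"
      show "riesz_kernel s x y * indicator (ball x R) y \<le>
        (\<Sum>k. ennreal ((R / 2 ^ Suc k) powr - s) * indicator (ball x (R / 2 ^ k)) y)"
      proof (cases "y \<in> ball x R")
        case True
        \<comment> \<open>Index of the dyadic shell that contains \<open>y\<close>: the defining
          property bounds the distance from below, minimality bounds it from above, and for n = 0
          the upper bound is membership in the ball.\<close>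
        define n where "n = (LEAST n. R / 2 ^ Suc n \<le> norm (x - y))"
        have "\<exists>n. R / norm (x - y) < 2 ^ n"
          using real_arch_pow[of 2 "R / norm (x - y)"] by simp
        then obtain n0 where "R / norm (x - y) < 2 ^ n0" by blast
        moreover have "(2::real) ^ n0 \<le> 2 ^ Suc n0" by simp
        ultimately have "R / norm (x - y) < 2 ^ Suc n0" by linarith
        then have ex: "R / 2 ^ Suc n0 \<le> norm (x - y)"
          using \<open>y \<noteq> x\<close> R by (simp add: field_simps)
        have n: "R / 2 ^ Suc n \<le> norm (x - y)"
          unfolding n_def by (rule LeastI[of "\<lambda>n. R / 2 ^ Suc n \<le> norm (x - y)"]) (rule ex)
        have "norm (x - y) < R / 2 ^ n"
        proof (cases n)
          case 0
          then show ?thesis using True by (simp add: dist_norm)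
        next
          case (Suc m)
          then have "m < n" by simp
          then have "\<not> R / 2 ^ Suc m \<le> norm (x - y)"
            unfolding n_def by (rule not_less_Least)
          then show ?thesis using Suc by simp
        qed
        then have "riesz_kernel s x y \<le> ennreal ((R / 2 ^ Suc n) powr - s) * indicator (ball x (R / 2 ^ n)) y"
          using riesz_kernel_le[OF s(1) _ n] R by (simp add: dist_norm)
        also have "\<dots> \<le> (\<Sum>k. ennreal ((R / 2 ^ Suc k) powr - s) * indicator (ball x (R / 2 ^ k)) y)"
          using sum_le_suminf[of "\<lambda>k. ennreal ((R / 2 ^ Suc k) powr - s) * indicator (ball x (R / 2 ^ k)) y" "{n}"]
          by (simp only: sum.insert finite.intros empty_iff sum.empty add_0_right summableI zero_le simp_thms)
        finally show ?thesis using True by simp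
      qed simp
    qed
    also have "\<dots> = (\<Sum>k. \<integral>\<^sup>+y. ennreal ((R / 2 ^ Suc k) powr - s) * indicator (ball x (R / 2 ^ k)) y \<partial>lborel)"
      by (intro nn_integral_suminf borel_measurable_times_ennreal borel_measurable_const borel_measurable_indicator)
        (simp only: sets_lborel borel_open open_ball)
    also have "\<dots> = (\<Sum>k. ennreal ((R / 2 ^ Suc k) powr - s) * emeasure lborel (ball x (R / 2 ^ k)))"
      by (intro suminf_cong nn_integral_cmult_indicator) (simp only: sets_lborel borel_open open_ball)
    also have "\<dots> = (\<Sum>k. ennreal (v * 2 powr s * R powr (d - s) * q ^ k))"
    proof (intro suminf_cong)
      fix k :: nat
      have "emeasure lborel (ball x (R / 2 ^ k)) = ennreal (v * (R / 2 ^ k) ^ DIM('a))"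
        using R by (subst emeasure_lborel_ball) (simp_all add: v_def d_def)
      then show "ennreal ((R / 2 ^ Suc k) powr - s) * emeasure lborel (ball x (R / 2 ^ k)) =
          ennreal (v * 2 powr s * R powr (d - s) * q ^ k)"
        unfolding summand[symmetric] using R v by (simp only: ennreal_mult powr_ge_zero) (simp add: ennreal_mult)
    qed
    also have "\<dots> = ennreal (v * 2 powr s * R powr (d - s) * (1 / (1 - q)))"
    proof (rule suminf_ennreal_eq)
      show "0 \<le> v * 2 powr s * R powr (d - s) * q ^ i" for i
        using v q by simp
      show "(\<lambda>k. v * 2 powr s * R powr (d - s) * q ^ k) sums (v * 2 powr s * R powr (d - s) * (1 / (1 - q)))"
        using q by (intro sums_mult geometric_sums) auto
    qed
    finally show ?thesis by (simp add: riesz_const_def q_def v_def d_def mult_ac)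
qed

text \<open>The bathtub principle, up to the constant: split the integral at radius \<open>(m / t) powr (1 / d)\<close>.\<close>

lemma nn_integral_riesz_kernel_bounded:
  fixes x :: "'a::euclidean_space"
  assumes s: "0 < s" "s < real DIM('a)"
    and g[measurable]: "g \<in> borel_measurable borel" and t: "0 < t" and m: "0 < m"
    and gt: "\<And>y. g y \<le> ennreal t" and gm: "(\<integral>\<^sup>+y. g y \<partial>lborel) \<le> ennreal m"
  shows "(\<integral>\<^sup>+y. g y * riesz_kernel s x y \<partial>lborel)
    \<le> ennreal ((riesz_const TYPE('a) s + 1) * t powr (s / real DIM('a)) * m powr (1 - s / real DIM('a)))"
proof -
  define d where "d = real DIM('a)"
  have d: "d > 0" by (simp add: d_def)
  define C where "C = riesz_const TYPE('a) s"
  have C: "C > 0" using riesz_const_pos[OF s(2)] by (simp add: C_def)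
    \<comment> \<open>At this radius the bounds t R^(d-s) and m R^-s for the inner and the outer
      part coincide; both equal t^(s/d) m^(1-s/d).\<close>
    define R where "R = (m / t) powr (1 / d)"
    have R: "R > 0" using t m by (simp add: R_def)
    have [measurable]: "ball x R \<in> sets borel" by simp
    have "(\<integral>\<^sup>+y. g y * riesz_kernel s x y \<partial>lborel) \<le>
      (\<integral>\<^sup>+y. ennreal t * (riesz_kernel s x y * indicator (ball x R) y) + ennreal (R powr - s) * g y \<partial>lborel)"
    proof (intro nn_integral_mono)
      fix y
      show "g y * riesz_kernel s x y \<le>
         ennreal t * (riesz_kernel s x y * indicator (ball x R) y) + ennreal (R powr - s) * g y"
      proof (cases "y \<in> ball x R")
        case True
        then show ?thesis by (auto intro!: add_increasing2 mult_right_mono gt)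
      next
        case False
        then have "riesz_kernel s x y \<le> ennreal (R powr - s)"
          using riesz_kernel_le[OF s(1) R, of x y] by (simp add: dist_norm)
        then show ?thesis using False by (simp add: mult.commute mult_left_mono)
      qed
    qed
    also have "\<dots> = ennreal t * (\<integral>\<^sup>+y\<in>ball x R. riesz_kernel s x y \<partial>lborel) + ennreal (R powr - s) * (\<integral>\<^sup>+y. g y \<partial>lborel)"
      by (subst nn_integral_add) (simp_all add: nn_integral_cmult pred_def)
    also have "\<dots> \<le> ennreal t * ennreal (C * R powr (d - s)) + ennreal (R powr - s) * ennreal m"
      unfolding C_def d_def
      by (intro add_mono mult_left_mono nn_integral_riesz_kernel_ball s R gm) auto
    also have "\<dots> = ennreal (t * (C * R powr (d - s)) + R powr - s * m)"
      using t m C by (simp flip: ennreal_mult ennreal_plus)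
    also have "t * (C * R powr (d - s)) + R powr - s * m = (C + 1) * t powr (s / d) * m powr (1 - s / d)"
    proof -
      have "t * R powr (d - s) = t powr (s / d) * m powr (1 - s / d)"
      proof -
        have "R powr (d - s) = (m / t) powr (1 - s / d)"
          using d by (simp add: R_def powr_powr diff_divide_distrib)
        also have "\<dots> = m powr (1 - s / d) * t powr (s / d - 1)"
          using t m by (simp add: powr_divide powr_diff)
        finally show ?thesis using t by (simp add: powr_diff)
      qed
      moreover have "R powr - s * m = t powr (s / d) * m powr (1 - s / d)"
        using t m by (simp add: R_def powr_powr powr_divide powr_diff powr_minus)
      ultimately show ?thesis
        by (metis (no_types, lifting) distrib_right mult.assoc mult.left_commute mult_1)
    qed
    finally show ?thesis unfolding C_def d_def .
qed

text \<open>By symmetry it suffices to integrate over \<open>\<rho> y \<le> \<rho> x\<close>, where the inner density is bounded by \<open>\<rho> x\<close>.\<close>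

lemma riesz_energy_le:
  fixes \<rho> :: "'a::euclidean_space \<Rightarrow> real"
  assumes s: "0 < s" "s < real DIM('a)"
    and Qm: "Measurable.pred (borel \<Otimes>\<^sub>M borel) (\<lambda>(x, y). Q x y)" and Qs: "\<And>x y. Q x y \<Longrightarrow> Q y x"
    and \<rho>[measurable]: "\<rho> \<in> borel_measurable borel" and nn: "\<And>x. 0 \<le> \<rho> x"
    and m: "0 < m" and mass: "\<And>x. (\<integral>\<^sup>+y\<in>{y. Q x y}. ennreal (\<rho> y) \<partial>lborel) \<le> ennreal m"
  shows "(\<integral>\<^sup>+x. \<integral>\<^sup>+y. ennreal (\<rho> x) * ennreal (\<rho> y) * riesz_kernel s x y * indicator {y. Q x y} y \<partial>lborel \<partial>lborel)
    \<le> ennreal (2 * (riesz_const TYPE('a) s + 1) * m powr (1 - s / real DIM('a)))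
        * (\<integral>\<^sup>+x. ennreal (\<rho> x powr (1 + s / real DIM('a))) \<partial>lborel)"
proof -
  \<comment> \<open>The relation \<open>Q\<close> selects the pairs that are counted. It is used in
    two cases: all pairs, where \<open>m\<close> is the total mass, and pairs at distance below r,
    where the bound is small as soon as no ball of radius r carries much mass.\<close>
  define d where "d = real DIM('a)"
  have d: "d > 0" by (simp add: d_def)
  define C where "C = riesz_const TYPE('a) s + 1"
  have C: "C > 0" using riesz_const_pos[OF s(2)] by (simp add: C_def)
    have Qm'[measurable]: "(\<lambda>(x,y). indicator {y. Q x y} y :: ennreal) \<in> borel_measurable (borel \<Otimes>\<^sub>M borel)"
      using Qm unfolding split_beta' by (simp add: indicator_def[abs_def] split_beta')
    have Qx[measurable]: "Measurable.pred borel (\<lambda>y. Q x y)" for x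
      using measurable_Pair1'[of x borel borel] measurable_compose[OF _ Qm, of "\<lambda>y. (x, y)" borel] by simp
    define F where "F x y = ennreal (\<rho> x) * ennreal (\<rho> y) * riesz_kernel s x y * indicator {y. Q x y} y" for x y
    have Fm[measurable]: "(\<lambda>(x,y). F x y) \<in> borel_measurable (borel \<Otimes>\<^sub>M borel)"
      unfolding F_def split_beta' using Qm' unfolding split_beta' by measurable
    have Fs: "F x y = F y x" for x y
      using Qs by (auto simp: F_def riesz_kernel_commute[of s x y] mult_ac indicator_def)
    define H where "H x y = F x y * indicator {y. \<rho> y \<le> \<rho> x} y" for x y
    have Hm[measurable]: "(\<lambda>(x,y). H x y) \<in> borel_measurable (borel \<Otimes>\<^sub>M borel)"
    proof -
      have "(\<lambda>z. F (fst z) (snd z) * indicator {y. \<rho> y \<le> \<rho> (fst z)} (snd z)) \<in> borel_measurable (borel \<Otimes>\<^sub>M borel)"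
        using Fm unfolding split_beta' by measurable
      then show ?thesis unfolding H_def split_beta' .
    qed
    have "(\<integral>\<^sup>+x. \<integral>\<^sup>+y. F x y \<partial>lborel \<partial>lborel) \<le> (\<integral>\<^sup>+x. \<integral>\<^sup>+y. H x y + H y x \<partial>lborel \<partial>lborel)"
      by (intro nn_integral_mono) (auto simp: H_def Fs indicator_def)
    also have "\<dots> = (\<integral>\<^sup>+x. (\<integral>\<^sup>+y. H x y \<partial>lborel) + (\<integral>\<^sup>+y. H y x \<partial>lborel) \<partial>lborel)"
      by (intro nn_integral_cong nn_integral_add) measurable
    also have "\<dots> = (\<integral>\<^sup>+x. \<integral>\<^sup>+y. H x y \<partial>lborel \<partial>lborel) + (\<integral>\<^sup>+x. \<integral>\<^sup>+y. H y x \<partial>lborel \<partial>lborel)"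
      by (intro nn_integral_add) measurable
    also have "(\<integral>\<^sup>+x. \<integral>\<^sup>+y. H y x \<partial>lborel \<partial>lborel) = (\<integral>\<^sup>+x. \<integral>\<^sup>+y. H x y \<partial>lborel \<partial>lborel)"
      by (rule lborel_pair.Fubini') measurable
    also have "(\<integral>\<^sup>+x. \<integral>\<^sup>+y. H x y \<partial>lborel \<partial>lborel) \<le>
        (\<integral>\<^sup>+x. ennreal (C * m powr (1 - s / d)) * ennreal (\<rho> x powr (1 + s / d)) \<partial>lborel)"
    proof (intro nn_integral_mono)
      fix x :: 'a
      show "(\<integral>\<^sup>+y. H x y \<partial>lborel) \<le> ennreal (C * m powr (1 - s / d)) * ennreal (\<rho> x powr (1 + s / d))"
      proof (cases "\<rho> x = 0")
        case True
        then show ?thesis by (simp add: H_def F_def)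
      next
        case False
        then have pos: "\<rho> x > 0" using nn[of x] by simp
        define g where "g y = ennreal (\<rho> y) * indicator {y. Q x y \<and> \<rho> y \<le> \<rho> x} y" for y
        have [measurable]: "g \<in> borel_measurable borel" unfolding g_def by measurable
        have "(\<integral>\<^sup>+y. H x y \<partial>lborel) = (\<integral>\<^sup>+y. ennreal (\<rho> x) * (g y * riesz_kernel s x y) \<partial>lborel)"
          by (intro nn_integral_cong) (auto simp: H_def F_def g_def indicator_def mult_ac)
        also have "\<dots> = ennreal (\<rho> x) * (\<integral>\<^sup>+y. g y * riesz_kernel s x y \<partial>lborel)"
          by (intro nn_integral_cmult) measurable
        also have "\<dots> \<le> ennreal (\<rho> x) * ennreal (C * \<rho> x powr (s / d) * m powr (1 - s / d))"
        unfolding C_def d_def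
        proof (intro mult_left_mono nn_integral_riesz_kernel_bounded s pos m)
          show "g y \<le> ennreal (\<rho> x)" for y
            by (auto simp: g_def indicator_def intro!: ennreal_leI)
          have "(\<integral>\<^sup>+y. g y \<partial>lborel) \<le> (\<integral>\<^sup>+y\<in>{y. Q x y}. ennreal (\<rho> y) \<partial>lborel)"
            by (intro nn_integral_mono) (auto simp: g_def indicator_def)
          then show "(\<integral>\<^sup>+y. g y \<partial>lborel) \<le> ennreal m"
            using mass[of x] by simp
        qed auto
        also have "\<dots> = ennreal (C * m powr (1 - s / d)) * ennreal (\<rho> x powr (1 + s / d))"
          using pos C by (simp add: powr_add mult_ac flip: ennreal_mult)
        finally show ?thesis .
      qed
    qed
    also have "\<dots> = ennreal (C * m powr (1 - s / d)) * (\<integral>\<^sup>+x. ennreal (\<rho> x powr (1 + s / d)) \<partial>lborel)"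
      by (intro nn_integral_cmult) measurable
    finally have "(\<integral>\<^sup>+x. \<integral>\<^sup>+y. F x y \<partial>lborel \<partial>lborel) \<le>
        ennreal (C * m powr (1 - s / d)) * (\<integral>\<^sup>+x. ennreal (\<rho> x powr (1 + s / d)) \<partial>lborel) +
        ennreal (C * m powr (1 - s / d)) * (\<integral>\<^sup>+x. ennreal (\<rho> x powr (1 + s / d)) \<partial>lborel)"
      using add_mono by blast
    also have "\<dots> = ennreal (2 * C * m powr (1 - s / d)) * (\<integral>\<^sup>+x. ennreal (\<rho> x powr (1 + s / d)) \<partial>lborel)"
      using C by (simp add: ennreal_mult mult_2[symmetric] mult.assoc)
    finally show ?thesis unfolding F_def C_def d_def .
qed

section \<open>Inequalities for powers of sums\<close>

lemma powr_add_le: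
  fixes a b q :: real
  assumes "0 \<le> a" "0 \<le> b" "0 \<le> q" "q \<le> 1"
  shows "(a + b) powr q \<le> a powr q + b powr q"
proof (cases "a = 0 \<or> b = 0")
  case True
  then show ?thesis by auto
next
  case False
  then have ab: "a > 0" "b > 0" using assms by auto
  have *: "x / (a + b) \<le> (x / (a + b)) powr q" if "0 < x" "x \<le> a + b" for x
  proof -
    have "(x / (a + b)) powr 1 \<le> (x / (a + b)) powr q"
      using that ab assms by (intro powr_mono') auto
    then show ?thesis using that ab by simp
  qed
  have "1 = a / (a + b) + b / (a + b)" using ab by (simp flip: add_divide_distrib)
  also have "\<dots> \<le> (a / (a + b)) powr q + (b / (a + b)) powr q"
    using ab by (intro add_mono *) auto
  also have "\<dots> = (a powr q + b powr q) / (a + b) powr q"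
    using ab by (simp add: powr_divide add_divide_distrib)
  finally show ?thesis using ab by (simp add: field_simps)
qed

text \<open>Write x^p as x times x^(p-1) and enlarge the base of the second factor. It ensures that
  the two parts of a split density together have at most the power mass of the whole.\<close>

lemma powr_superadditive:
  fixes a b p :: real
  assumes "0 \<le> a" "0 \<le> b" "1 \<le> p"
  shows "a powr p + b powr p \<le> (a + b) powr p"
proof -
  have eq: "x powr p = x * x powr (p - 1)" if "x \<ge> 0" for x :: real
    using that by (cases "x = 0") (auto simp: powr_diff)
  have "a * a powr (p - 1) \<le> a * (a + b) powr (p - 1)" "b * b powr (p - 1) \<le> b * (a + b) powr (p - 1)"
    using assms by (auto intro!: mult_left_mono powr_mono2)
  then have "a powr p + b powr p \<le> (a + b) * (a + b) powr (p - 1)"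
    using assms by (simp add: eq distrib_right)
  also have "\<dots> = (a + b) powr p" using assms by (simp add: eq[of "a + b"])
  finally show ?thesis .
qed

text \<open>The difference of the two sides vanishes at a = 0, and its derivative in a is p times
  the defect of subadditivity of the power p - 1, which is nonnegative since p - 1 lies between 0
  and 1. The cross term is linear in a and carries the factor b^(p-1), which is small for a thinly
  spread b.\<close>

lemma powr_add_le_cross:
  fixes a b p :: real
  assumes a: "0 \<le> a" and b: "0 \<le> b" and p: "1 < p" "p \<le> 2"
  shows "(a + b) powr p \<le> a powr p + b powr p + p * (a * b powr (p - 1))"
proof (cases "a = 0")
  case True
  then show ?thesis by simp
next
  case False
  with a have a: "a > 0" by simp
  define f where "f x = x powr p + b powr p + p * (x * b powr (p - 1)) - (x + b) powr p" for x
  have "f 0 \<le> f a"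
  proof (rule DERIV_nonneg_imp_increasing_open[of 0 a f])
    fix x assume x: "0 < x" "x < a"
    have "(f has_real_derivative (p * x powr (p - 1) + p * b powr (p - 1) - p * (x + b) powr (p - 1))) (at x)"
      unfolding f_def using x b by (auto intro!: derivative_eq_intros)
    moreover have "p * x powr (p - 1) + p * b powr (p - 1) - p * (x + b) powr (p - 1) \<ge> 0"
    proof -
      have "p * (x + b) powr (p - 1) \<le> p * (x powr (p - 1) + b powr (p - 1))"
        using x b p by (intro mult_left_mono powr_add_le) auto
      then show ?thesis by (simp add: algebra_simps)
    qed
    ultimately show "\<exists>y. (f has_real_derivative y) (at x) \<and> 0 \<le> y" by blast
  next
    show "continuous_on {0..a} f"
      unfolding f_def using b p by (auto intro!: continuous_intros continuous_on_powr')
  qed (use a in auto)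
  then show ?thesis by (simp add: f_def)
qed

subsection \<open>States with a random number of particles\<close>

text \<open>
  Particle \<open>i\<close> is present on the event \<open>S i\<close>, and \<open>\<rho>\<close> is the density of the expected number of
  present particles; \<open>S i = space M\<close> for all \<open>i\<close> gives a state with exactly \<open>N\<close> particles.
\<close>

definition gc_state ::
  "nat \<Rightarrow> 'b measure \<Rightarrow> (nat \<Rightarrow> 'b \<Rightarrow> 'a::euclidean_space) \<Rightarrow> (nat \<Rightarrow> 'b set) \<Rightarrow> ('a \<Rightarrow> real) \<Rightarrow> bool" where
  "gc_state N M X S \<rho> \<longleftrightarrow> prob_space M \<and> (\<forall>i<N. X i \<in> borel_measurable M) \<and> (\<forall>i<N. S i \<in> sets M) \<and>
     \<rho> \<in> borel_measurable borel \<and> (\<forall>x. 0 \<le> \<rho> x) \<and>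
     (\<forall>f\<in>borel_measurable borel.
        (\<integral>\<^sup>+x. ennreal (\<rho> x) * f x \<partial>lborel) = (\<Sum>i<N. \<integral>\<^sup>+\<omega>\<in>S i. f (X i \<omega>) \<partial>M))"

text \<open>Ordered pairs are counted, so this is twice the cost in \<open>W\<close> and is to be compared with \<open>D\<close>.\<close>

definition pair_cost ::
  "real \<Rightarrow> nat \<Rightarrow> 'b measure \<Rightarrow> (nat \<Rightarrow> 'b \<Rightarrow> 'a::euclidean_space) \<Rightarrow> (nat \<Rightarrow> 'b set) \<Rightarrow> ennreal" where
  "pair_cost s N M X S = (\<integral>\<^sup>+\<omega>. (\<Sum>i<N. \<Sum>j<N. if i \<noteq> j
     then indicator (S i) \<omega> * indicator (S j) \<omega> * riesz_kernel s (X i \<omega>) (X j \<omega>) else 0) \<partial>M)"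

text \<open>The \<open>ennreal\<close> counterpart of \<open>L\<close>, so that no integrability has
  to be carried along.\<close>

definition power_mass :: "real \<Rightarrow> ('a::euclidean_space \<Rightarrow> real) \<Rightarrow> ennreal" where
  "power_mass s \<rho> = (\<integral>\<^sup>+x. ennreal (\<rho> x powr (1 + s / real DIM('a))) \<partial>lborel)"

text \<open>The kernel is a parameter because the same calculus serves the Riesz kernel, its
  rescaled version and its near and far parts.\<close>

definition interaction ::
  "('a::euclidean_space \<Rightarrow> 'a \<Rightarrow> ennreal) \<Rightarrow> ('a \<Rightarrow> real) \<Rightarrow> ('a \<Rightarrow> real) \<Rightarrow> ennreal" where
  "interaction k f g = (\<integral>\<^sup>+x. \<integral>\<^sup>+y. ennreal (f x) * ennreal (g y) * k x y \<partial>lborel \<partial>lborel)"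

lemma D_eq_interaction: "D s \<rho> = interaction (riesz_kernel s) \<rho> \<rho>"
  by (simp add: D_def interaction_def)

lemma gc_stateD:
  assumes "gc_state N M X S \<rho>"
  shows "prob_space M" "\<And>i. i < N \<Longrightarrow> X i \<in> borel_measurable M" "\<And>i. i < N \<Longrightarrow> S i \<in> sets M"
    "\<rho> \<in> borel_measurable borel" "\<And>x. 0 \<le> \<rho> x"
    "\<And>f. f \<in> borel_measurable borel \<Longrightarrow>
       (\<integral>\<^sup>+x. ennreal (\<rho> x) * f x \<partial>lborel) = (\<Sum>i<N. \<integral>\<^sup>+\<omega>\<in>S i. f (X i \<omega>) \<partial>M)"
  using assms unfolding gc_state_def by auto

lemma gc_state_mass:
  assumes "gc_state N M X S \<rho>"
  shows "(\<integral>\<^sup>+x. ennreal (\<rho> x) \<partial>lborel) = (\<Sum>i<N. emeasure M (S i))"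
  using gc_stateD(6)[OF assms, of "\<lambda>_. 1"] gc_stateD(3)[OF assms] by simp

lemma gc_state_mass_le:
  assumes "gc_state N M X S \<rho>"
  shows "(\<integral>\<^sup>+x. ennreal (\<rho> x) \<partial>lborel) \<le> ennreal (real N)"
proof -
  interpret prob_space M using gc_stateD(1)[OF assms] .
  have "(\<Sum>i<N. emeasure M (S i)) \<le> (\<Sum>i<N. 1)"
    by (intro sum_mono emeasure_le_1)
  then show ?thesis
    using gc_state_mass[OF assms] by (simp add: ennreal_of_nat_eq_real_of_nat)
qed

lemma pair_cost_eq_sum:
  assumes "\<And>i. i < N \<Longrightarrow> X i \<in> borel_measurable M" "\<And>i. i < N \<Longrightarrow> S i \<in> sets M"
  shows "pair_cost s N M X S = (\<Sum>i<N. \<Sum>j<N. if i \<noteq> j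
     then \<integral>\<^sup>+\<omega>. indicator (S i) \<omega> * indicator (S j) \<omega> * riesz_kernel s (X i \<omega>) (X j \<omega>) \<partial>M else 0)"
proof -
  have [measurable]: "(\<lambda>\<omega>. if i \<noteq> j then indicator (S i) \<omega> * indicator (S j) \<omega> * riesz_kernel s (X i \<omega>) (X j \<omega>) else 0)
      \<in> borel_measurable M" if "i < N" "j < N" for i j
  proof -
    have [measurable]: "X i \<in> borel_measurable M" "X j \<in> borel_measurable M" "S i \<in> sets M" "S j \<in> sets M"
      using that assms by auto
    show ?thesis by measurable
  qed
  show ?thesis
    unfolding pair_cost_def
    by (subst nn_integral_sum, force, intro sum.cong refl, subst nn_integral_sum)
      (auto intro!: sum.cong)
qed

lemma sum_pairs_eq_twice:
  fixes a :: "nat \<Rightarrow> nat \<Rightarrow> ennreal"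
  assumes "\<And>i j. a i j = a j i"
  shows "(\<Sum>i<N. \<Sum>j<N. if i \<noteq> j then a i j else 0) = 2 * (\<Sum>j<N. \<Sum>i<j. a i j)"
proof (induction N)
  case (Suc N)
  have "(\<Sum>i<Suc N. \<Sum>j<Suc N. if i \<noteq> j then a i j else 0) =
      (\<Sum>i<N. (\<Sum>j<N. if i \<noteq> j then a i j else 0) + a i N) + (\<Sum>j<N. a N j)"
    by (auto intro!: arg_cong2[where f="(+)"] sum.cong)
  also have "\<dots> = 2 * (\<Sum>j<N. \<Sum>i<j. a i j) + (\<Sum>i<N. a i N) + (\<Sum>i<N. a i N)"
    using assms by (simp add: sum.distrib Suc)
  finally show ?case by (simp add: distrib_left mult_2 add_ac)
qed simp

lemma sum_pairs_permute:
  fixes a :: "nat \<Rightarrow> nat \<Rightarrow> ennreal"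
  assumes \<sigma>: "\<sigma> permutes {..<N}"
  shows "(\<Sum>i<N. \<Sum>j<N. if i \<noteq> j then a (\<sigma> i) (\<sigma> j) else 0) = (\<Sum>i<N. \<Sum>j<N. if i \<noteq> j then a i j else 0)"
proof -
  have "(\<Sum>i<N. \<Sum>j<N. if i \<noteq> j then a (\<sigma> i) (\<sigma> j) else 0) =
      (\<Sum>i<N. \<Sum>j<N. if \<sigma> i \<noteq> \<sigma> j then a (\<sigma> i) (\<sigma> j) else 0)"
    using permutes_inj[OF \<sigma>] by (intro sum.cong) (auto dest: injD)
  also have "\<dots> = (\<Sum>i<N. \<Sum>j<N. if \<sigma> i \<noteq> j then a (\<sigma> i) j else 0)"
    using sum.permute[OF \<sigma>, of "\<lambda>j. if \<sigma> i \<noteq> j then a (\<sigma> i) j else 0" for i]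
    by (simp add: comp_def)
  also have "\<dots> = (\<Sum>i<N. \<Sum>j<N. if i \<noteq> j then a i j else 0)"
    using sum.permute[OF \<sigma>, of "\<lambda>i. \<Sum>j<N. if i \<noteq> j then a i j else 0"]
    by (simp add: comp_def)
  finally show ?thesis .
qed

text \<open>
  Averaging over all relabelings turns an arbitrary state with \<open>N\<close> particles into a symmetric plan
  with the same density and the same cost.
\<close>

lemma W_le_pair_cost:
  fixes X :: "nat \<Rightarrow> 'b \<Rightarrow> 'a::euclidean_space"
  assumes gc: "gc_state N M X (\<lambda>_. space M) \<rho>"
  shows "2 * W s N \<rho> \<le> pair_cost s N M X (\<lambda>_. space M)"
proof -
  interpret M: prob_space M using gc_stateD(1)[OF gc] .
  have X[measurable]: "X i \<in> borel_measurable M" if "i < N" for i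
    using gc_stateD(2)[OF gc that] .
  define PS where "PS = {\<sigma>. \<sigma> permutes {..<N}}"
  have PS: "finite PS" "PS \<noteq> {}"
    unfolding PS_def using permutes_id[of "{..<N}"] by (blast intro: finite_permutations)+
  define c where "c = ennreal (1 / real (card PS))"
  have card: "card PS > 0" using PS by (simp add: card_gt_0_iff)
  have c1: "(\<Sum>\<sigma>\<in>PS. c * a) = a" for a
  proof -
    have "of_nat (card PS) * c = 1"
      using card by (simp add: c_def ennreal_of_nat_eq_real_of_nat flip: ennreal_mult)
    then show ?thesis by (simp add: mult.assoc[symmetric])
  qed
  \<comment> \<open>A relabelling drawn uniformly and independently of the state; \<open>P\<close>
    will be the law of the relabelled configuration.\<close>
  define U where "U = uniform_count_measure PS"
  interpret U: prob_space U
    unfolding U_def using PS by (rule prob_space_uniform_count_measure)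
  interpret UM: pair_prob_space U M ..
  define Y where "Y = (\<lambda>(\<sigma>, \<omega>). \<lambda>i\<in>{..<N}. X (\<sigma> i) \<omega>)"
  have Y\<sigma>: "(\<lambda>\<omega>. \<lambda>i\<in>{..<N}. X (\<sigma> i) \<omega>) \<in> measurable M (config_space N)" if "\<sigma> \<in> PS" for \<sigma>
  proof (rule measurable_restrict)
    fix i assume "i \<in> {..<N}"
    then have "\<sigma> i < N" using that permutes_in_image[of \<sigma> "{..<N}" i] by (auto simp: PS_def)
    then show "X (\<sigma> i) \<in> borel_measurable M" by simp
  qed
  have Y[measurable]: "Y \<in> measurable (U \<Otimes>\<^sub>M M) (config_space N)"
  proof -
    have "Y \<in> measurable (count_space PS \<Otimes>\<^sub>M M) (config_space N)"
      unfolding Y_def using PS Y\<sigma> by (intro measurable_pair_measure_countable1) (auto simp: countable_finite)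
    moreover have "sets (U \<Otimes>\<^sub>M M) = sets (count_space PS \<Otimes>\<^sub>M M)"
      unfolding U_def by (intro sets_pair_measure_cong) (auto simp: sets_uniform_count_measure_count_space)
    ultimately show ?thesis
      by (simp cong: measurable_cong_sets)
  qed
  define P where "P = distr (U \<Otimes>\<^sub>M M) (config_space N) Y"
  have setsP[measurable_cong]: "sets P = sets (config_space N)" by (simp add: P_def)
  have int: "(\<integral>\<^sup>+x. f x \<partial>P) = (\<Sum>\<sigma>\<in>PS. c * (\<integral>\<^sup>+\<omega>. f (\<lambda>i\<in>{..<N}. X (\<sigma> i) \<omega>) \<partial>M))"
    if [measurable]: "f \<in> borel_measurable (config_space N)" for f
  proof -
    have "(\<integral>\<^sup>+x. f x \<partial>P) = (\<integral>\<^sup>+z. f (Y z) \<partial>(U \<Otimes>\<^sub>M M))"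
      unfolding P_def by (intro nn_integral_distr) measurable
    also have "\<dots> = (\<integral>\<^sup>+\<sigma>. \<integral>\<^sup>+\<omega>. f (Y (\<sigma>, \<omega>)) \<partial>M \<partial>U)"
      by (intro M.nn_integral_fst[symmetric]) measurable
    also have "\<dots> = (\<Sum>\<sigma>\<in>PS. c * (\<integral>\<^sup>+\<omega>. f (Y (\<sigma>, \<omega>)) \<partial>M))"
      unfolding U_def uniform_count_measure_def c_def by (rule nn_integral_point_measure_finite[OF PS(1)])
    finally show ?thesis by (simp add: Y_def)
  qed
  have "prob_space P"
    unfolding P_def by (intro UM.prob_space_distr) measurable
  have em: "emeasure P A = (\<Sum>\<sigma>\<in>PS. c * (\<integral>\<^sup>+\<omega>. indicator A (\<lambda>i\<in>{..<N}. X (\<sigma> i) \<omega>) \<partial>M))"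
    if "A \<in> sets (config_space N)" for A
    using int[of "indicator A"] that setsP by simp
  \<comment> \<open>Applying \<tau> to the configuration composes the random relabelling with
    \<tau>, which only reindexes the average over all permutations.\<close>
  have "distr P (config_space N) (\<lambda>x. \<lambda>i\<in>{..<N}. x (\<tau> i)) = P" if \<tau>: "\<tau> permutes {..<N}" for \<tau>
  proof (rule measure_eqI)
    fix A assume "A \<in> sets (distr P (config_space N) (\<lambda>x. \<lambda>i\<in>{..<N}. x (\<tau> i)))"
    then have A[measurable]: "A \<in> sets (config_space N)" by simp
    have \<tau>N: "\<tau> i < N \<longleftrightarrow> i < N" for i
      using permutes_in_image[OF \<tau>, of i] by simp
    have T[measurable]: "(\<lambda>x. \<lambda>i\<in>{..<N}. x (\<tau> i)) \<in> measurable (config_space N) (config_space N)"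
      by (rule measurable_restrict) (auto simp: \<tau>N intro!: measurable_component_singleton)
    have "emeasure (distr P (config_space N) (\<lambda>x. \<lambda>i\<in>{..<N}. x (\<tau> i))) A
        = (\<integral>\<^sup>+x. indicator A x \<partial>distr P (config_space N) (\<lambda>x. \<lambda>i\<in>{..<N}. x (\<tau> i)))"
      by simp
    also have "\<dots> = (\<integral>\<^sup>+x. indicator A (\<lambda>i\<in>{..<N}. x (\<tau> i)) \<partial>P)"
      by (intro nn_integral_distr) measurable
    also have "\<dots> = (\<Sum>\<sigma>\<in>PS. c * (\<integral>\<^sup>+\<omega>. indicator A (\<lambda>i\<in>{..<N}. (\<lambda>i\<in>{..<N}. X (\<sigma> i) \<omega>) (\<tau> i)) \<partial>M))"
      by (intro int) measurable
    also have "\<dots> = (\<Sum>\<sigma>\<in>PS. c * (\<integral>\<^sup>+\<omega>. indicator A (\<lambda>i\<in>{..<N}. X ((\<sigma> \<circ> \<tau>) i) \<omega>) \<partial>M))"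
      by (intro sum.cong refl arg_cong2[where f="(*)"] nn_integral_cong arg_cong2[where f=indicator] restrict_ext)
        (simp add: \<tau>N)
    also have "\<dots> = emeasure P A"
      unfolding em[OF A] PS_def by (rule sum_permutations_compose_right[OF \<tau>, symmetric])
    finally show "emeasure (distr P (config_space N) (\<lambda>x. \<lambda>i\<in>{..<N}. x (\<tau> i))) A = emeasure P A" .
  qed (simp add: setsP)
  then have sym: "sym_prob N P"
    using \<open>prob_space P\<close> setsP unfolding sym_prob_def by blast
  have ob: "one_body N P = density lborel (\<lambda>x. ennreal (\<rho> x))"
  proof (rule measure_eqI)
    fix A assume "A \<in> sets (one_body N P)"
    then have A[measurable]: "A \<in> sets borel" by (simp add: sets_one_body)
    have "emeasure (one_body N P) A = (\<Sum>i<N. \<integral>\<^sup>+x. indicator A (x i) \<partial>P)"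
      unfolding emeasure_one_body[OF A]
    proof (intro sum.cong refl)
      fix i assume "i \<in> {..<N}"
      then have xi: "(\<lambda>x. x i) \<in> borel_measurable P"
        by (simp add: measurable_cong_sets[OF setsP refl] measurable_component_singleton)
      have "emeasure (distr P borel (\<lambda>x. x i)) A = (\<integral>\<^sup>+y. indicator A y \<partial>distr P borel (\<lambda>x. x i))"
        by simp
      also have "\<dots> = (\<integral>\<^sup>+x. indicator A (x i) \<partial>P)"
        by (rule nn_integral_distr[OF xi]) simp
      finally show "emeasure (distr P borel (\<lambda>x. x i)) A = (\<integral>\<^sup>+x. indicator A (x i) \<partial>P)" .
    qed
    also have "\<dots> = (\<Sum>i<N. \<Sum>\<sigma>\<in>PS. c * (\<integral>\<^sup>+\<omega>. indicator A (X (\<sigma> i) \<omega>) \<partial>M))"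
    proof (intro sum.cong refl)
      fix i assume i: "i \<in> {..<N}"
      then have [measurable]: "(\<lambda>x. x i) \<in> borel_measurable (config_space N)"
        by (rule measurable_component_singleton)
      have "(\<integral>\<^sup>+x. indicator A (x i) \<partial>P) =
          (\<Sum>\<sigma>\<in>PS. c * (\<integral>\<^sup>+\<omega>. indicator A ((\<lambda>i\<in>{..<N}. X (\<sigma> i) \<omega>) i) \<partial>M))"
        by (rule int) measurable
      then show "(\<integral>\<^sup>+x. indicator A (x i) \<partial>P) = (\<Sum>\<sigma>\<in>PS. c * (\<integral>\<^sup>+\<omega>. indicator A (X (\<sigma> i) \<omega>) \<partial>M))"
        using i by simp
    qed
    also have "\<dots> = (\<Sum>\<sigma>\<in>PS. c * (\<Sum>i<N. \<integral>\<^sup>+\<omega>. indicator A (X (\<sigma> i) \<omega>) \<partial>M))"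
      by (subst sum.swap) (simp add: sum_distrib_left)
    also have "\<dots> = (\<Sum>\<sigma>\<in>PS. c * (\<Sum>i<N. \<integral>\<^sup>+\<omega>. indicator A (X i \<omega>) \<partial>M))"
    proof (rule sum.cong[OF refl])
      fix \<sigma> assume "\<sigma> \<in> PS"
      then show "c * (\<Sum>i<N. \<integral>\<^sup>+\<omega>. indicator A (X (\<sigma> i) \<omega>) \<partial>M) = c * (\<Sum>i<N. \<integral>\<^sup>+\<omega>. indicator A (X i \<omega>) \<partial>M)"
        using sum.permute[of \<sigma> "{..<N}" "\<lambda>i. \<integral>\<^sup>+\<omega>. indicator A (X i \<omega>) \<partial>M"]
        by (simp add: PS_def comp_def)
    qed
    also have "\<dots> = (\<Sum>i<N. \<integral>\<^sup>+\<omega>. indicator A (X i \<omega>) \<partial>M)"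
      by (rule c1)
    also have "\<dots> = (\<Sum>i<N. \<integral>\<^sup>+\<omega>\<in>space M. indicator A (X i \<omega>) \<partial>M)"
      by (intro sum.cong refl nn_integral_cong) simp
    also have "\<dots> = (\<integral>\<^sup>+x. ennreal (\<rho> x) * indicator A x \<partial>lborel)"
      by (rule gc_stateD(6)[OF gc, symmetric]) simp
    also have "\<dots> = emeasure (density lborel (\<lambda>x. ennreal (\<rho> x))) A"
      using gc_stateD(4)[OF gc] by (simp add: emeasure_density)
    finally show "emeasure (one_body N P) A = emeasure (density lborel (\<lambda>x. ennreal (\<rho> x))) A" .
  qed (simp add: sets_one_body)
  have "2 * W s N \<rho> \<le> 2 * (\<integral>\<^sup>+x. (\<Sum>j<N. \<Sum>i<j. riesz_kernel s (x i) (x j)) \<partial>P)"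
    unfolding W_def using sym ob by (intro mult_left_mono INF_lower) (auto simp: plans_def)
  also have "\<dots> = (\<integral>\<^sup>+x. (\<Sum>i<N. \<Sum>j<N. if i \<noteq> j then riesz_kernel s (x i) (x j) else 0) \<partial>P)"
  proof (subst nn_integral_cmult[symmetric])
    show "(\<lambda>x. \<Sum>j<N. \<Sum>i<j. riesz_kernel s (x i) (x j)) \<in> borel_measurable P"
      unfolding measurable_cong_sets[OF setsP refl]
      by (intro borel_measurable_sum riesz_kernel_measurable measurable_component_singleton) auto
  qed (intro nn_integral_cong sum_pairs_eq_twice[symmetric] riesz_kernel_commute)
  also have "\<dots> = (\<Sum>\<sigma>\<in>PS. c * (\<integral>\<^sup>+\<omega>. (\<Sum>i<N. \<Sum>j<N. if i \<noteq> j then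
      riesz_kernel s ((\<lambda>i\<in>{..<N}. X (\<sigma> i) \<omega>) i) ((\<lambda>i\<in>{..<N}. X (\<sigma> i) \<omega>) j) else 0) \<partial>M))"
    by (intro int borel_measurable_sum measurable_If riesz_kernel_measurable measurable_component_singleton) auto
  also have "\<dots> = (\<Sum>\<sigma>\<in>PS. c * (\<integral>\<^sup>+\<omega>. (\<Sum>i<N. \<Sum>j<N. if i \<noteq> j then
      riesz_kernel s (X (\<sigma> i) \<omega>) (X (\<sigma> j) \<omega>) else 0) \<partial>M))"
    by (intro sum.cong refl arg_cong2[where f="(*)"] nn_integral_cong) (simp cong: if_cong)
  also have "\<dots> = (\<Sum>\<sigma>\<in>PS. c * pair_cost s N M X (\<lambda>_. space M))"
  proof (intro sum.cong refl arg_cong2[where f="(*)"])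
    fix \<sigma> assume "\<sigma> \<in> PS"
    then have \<sigma>: "\<sigma> permutes {..<N}" by (simp add: PS_def)
    show "(\<integral>\<^sup>+\<omega>. (\<Sum>i<N. \<Sum>j<N. if i \<noteq> j then riesz_kernel s (X (\<sigma> i) \<omega>) (X (\<sigma> j) \<omega>) else 0) \<partial>M)
        = pair_cost s N M X (\<lambda>_. space M)"
      unfolding pair_cost_def sum_pairs_permute[OF \<sigma>, of "\<lambda>i j. riesz_kernel s (X i \<omega>) (X j \<omega>)" for \<omega>]
      by (intro nn_integral_cong sum.cong refl) auto
  qed
  also have "\<dots> = pair_cost s N M X (\<lambda>_. space M)" by (rule c1)
  finally show ?thesis .
qed

lemma gc_state_admissible:
  fixes \<rho> :: "'a::euclidean_space \<Rightarrow> real"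
  assumes gc: "gc_state N M X (\<lambda>_. space M) \<rho>" and fin: "power_mass s \<rho> < \<infinity>"
  shows "\<rho> \<in> admissible s N" and "L s \<rho> = enn2real (power_mass s \<rho>)"
proof -
  interpret M: prob_space M using gc_stateD(1)[OF gc] .
  have [measurable]: "\<rho> \<in> borel_measurable borel" and nn: "\<And>x. 0 \<le> \<rho> x"
    using gc_stateD(4,5)[OF gc] by auto
  have mass: "(\<integral>\<^sup>+x. ennreal (\<rho> x) \<partial>lborel) = ennreal (real N)"
    using gc_state_mass[OF gc] by (simp add: M.emeasure_space_1 ennreal_of_nat_eq_real_of_nat)
  have "integrable lborel \<rho>"
    by (intro integrableI_nonneg) (auto simp: nn mass)
  moreover have "(LINT x|lborel. \<rho> x) = real N"
    by (subst integral_eq_nn_integral) (auto simp: nn mass)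
  moreover have "integrable lborel (\<lambda>x. \<bar>\<rho> x\<bar> powr (1 + s / real DIM('a)))"
    using fin by (intro integrableI_nonneg) (auto simp: nn power_mass_def)
  ultimately show "\<rho> \<in> admissible s N"
    by (simp add: admissible_def nn)
  show "L s \<rho> = enn2real (power_mass s \<rho>)"
    unfolding L_def power_mass_def by (subst integral_eq_nn_integral) auto
qed

lemma power_mass_pos:
  fixes \<rho> :: "'a::euclidean_space \<Rightarrow> real"
  assumes [measurable]: "\<rho> \<in> borel_measurable borel" and nn: "\<And>x. 0 \<le> \<rho> x"
    and "0 < (\<integral>\<^sup>+x. ennreal (\<rho> x) \<partial>lborel)"
  shows "0 < power_mass s \<rho>"
proof (rule ccontr)
  assume "\<not> 0 < power_mass s \<rho>"
  then have "power_mass s \<rho> = 0" by simp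
  then have "AE x in lborel. ennreal (\<rho> x powr (1 + s / real DIM('a))) = 0"
    unfolding power_mass_def by (subst (asm) nn_integral_0_iff_AE) auto
  then have "AE x in lborel. ennreal (\<rho> x) = 0"
    by eventually_elim (use nn in \<open>auto simp: ennreal_eq_0_iff powr_def split: if_splits\<close>)
  then have "(\<integral>\<^sup>+x. ennreal (\<rho> x) \<partial>lborel) = 0"
    by (subst nn_integral_0_iff_AE) auto
  with assms(3) show False by simp
qed

text \<open>The ratio in \<open>Lambda\<close> is tested with \<rho> and cleared of its denominator,
  which is positive since N \<ge> 1; the cost of an arbitrary realization stands in for
  \<open>W\<close>. The factor 2 appears because ordered pairs are counted, and the cost is moved to
  the right so that nothing is subtracted in \<open>ennreal\<close>.\<close>

lemma canonical_bound:
  fixes X :: "nat \<Rightarrow> 'b \<Rightarrow> 'a::euclidean_space"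
  assumes N: "1 \<le> N" and gc: "gc_state N M X (\<lambda>_. space M) \<rho>" and fin: "power_mass s \<rho> < \<infinity>"
    and \<Lambda>: "Lambda TYPE('a) s N \<le> ereal l" and l: "0 \<le> l"
  shows "D s \<rho> \<le> pair_cost s N M X (\<lambda>_. space M) + ennreal (2 * l) * power_mass s \<rho>"
proof (cases "pair_cost s N M X (\<lambda>_. space M) = \<infinity>")
  case False
  interpret M: prob_space M using gc_stateD(1)[OF gc] .
  obtain c where c: "pair_cost s N M X (\<lambda>_. space M) = ennreal c" "0 \<le> c"
    using False by (cases "pair_cost s N M X (\<lambda>_. space M)") auto
  obtain m where m: "power_mass s \<rho> = ennreal m" "0 \<le> m"
    using fin by (cases "power_mass s \<rho>") auto
  have W2: "2 * W s N \<rho> \<le> ennreal c"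
    using W_le_pair_cost[OF gc, of s] c by simp
  then have "W s N \<rho> \<noteq> \<infinity>" by (auto simp: ennreal_mult_top top_unique)
  then obtain w where w: "W s N \<rho> = ennreal w" "0 \<le> w"
    by (cases "W s N \<rho>") auto
  have wc: "2 * w \<le> c"
    using W2 w c by (simp add: ennreal_mult[symmetric] flip: ennreal_numeral)
  have "0 < (\<integral>\<^sup>+x. ennreal (\<rho> x) \<partial>lborel)"
    using gc_state_mass[OF gc] N by (simp add: M.emeasure_space_1)
  then have "0 < power_mass s \<rho>"
    by (rule power_mass_pos[rotated 2]) (use gc_stateD(4,5)[OF gc] in auto)
  then have Lm: "L s \<rho> = m" "0 < m"
    using gc_state_admissible(2)[OF gc fin] m by auto
  have "G s N \<rho> / ereal (L s \<rho>) \<le> ereal l"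
    using SUP_upper[OF gc_state_admissible(1)[OF gc fin], of "\<lambda>\<rho>. G s N \<rho> / ereal (L s \<rho>)"] \<Lambda>
    unfolding Lambda_def by (rule order_trans)
  then have GL: "G s N \<rho> \<le> ereal (m * l)"
    using Lm by (simp add: ereal_divide_le_pos)
  show ?thesis
  proof (cases "D s \<rho>")
    case (real d)
    then have "d / 2 - w \<le> m * l"
      using GL w by (simp add: G_def enn2ereal_ennreal)
    then have "d \<le> c + 2 * l * m" using wc by (simp add: algebra_simps)
    then show ?thesis
      using real c m l by (simp flip: ennreal_mult ennreal_plus)
  next
    case top
    then show ?thesis using GL w by (simp add: G_def enn2ereal_ennreal)
  qed
qed simp

section \<open>Interaction as a symmetric bilinear form\<close>

lemma riesz_kernel_measurable_pair [measurable]: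
  "(\<lambda>(x, y). riesz_kernel s x (y :: 'a::euclidean_space)) \<in> borel_measurable (borel \<Otimes>\<^sub>M borel)"
  by (simp add: split_beta')

lemma interaction_inner:
  fixes k :: "'a::euclidean_space \<Rightarrow> 'a \<Rightarrow> ennreal"
  assumes k[measurable]: "(\<lambda>(x, y). k x y) \<in> borel_measurable (borel \<Otimes>\<^sub>M borel)"
    and [measurable]: "g \<in> borel_measurable borel"
  shows "interaction k f g = (\<integral>\<^sup>+x. ennreal (f x) * (\<integral>\<^sup>+y. ennreal (g y) * k x y \<partial>lborel) \<partial>lborel)"
    and "(\<lambda>x. \<integral>\<^sup>+y. ennreal (g y) * k x y \<partial>lborel) \<in> borel_measurable borel"
proof -
  have [measurable]: "k x \<in> borel_measurable borel" for x
    using measurable_compose[OF measurable_Pair1'[of x borel borel] k] by simp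
  show "interaction k f g = (\<integral>\<^sup>+x. ennreal (f x) * (\<integral>\<^sup>+y. ennreal (g y) * k x y \<partial>lborel) \<partial>lborel)"
    unfolding interaction_def
    by (intro nn_integral_cong, subst nn_integral_cmult[symmetric]) (auto simp: mult_ac)
  show "(\<lambda>x. \<integral>\<^sup>+y. ennreal (g y) * k x y \<partial>lborel) \<in> borel_measurable borel"
    by measurable
qed

lemma interaction_add_left:
  fixes k :: "'a::euclidean_space \<Rightarrow> 'a \<Rightarrow> ennreal"
  assumes [measurable]: "(\<lambda>(x, y). k x y) \<in> borel_measurable (borel \<Otimes>\<^sub>M borel)"
    and [measurable]: "f \<in> borel_measurable borel" "f' \<in> borel_measurable borel" "g \<in> borel_measurable borel"
    and "\<And>x. 0 \<le> f x" "\<And>x. 0 \<le> f' x"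
  shows "interaction k (\<lambda>x. f x + f' x) g = interaction k f g + interaction k f' g"
proof -
  note [measurable] = interaction_inner(2)[of k g]
  show ?thesis
    using assms(5,6) by (simp add: interaction_inner nn_integral_add distrib_right)
qed

lemma interaction_commute:
  fixes k :: "'a::euclidean_space \<Rightarrow> 'a \<Rightarrow> ennreal"
  assumes [measurable]: "(\<lambda>(x, y). k x y) \<in> borel_measurable (borel \<Otimes>\<^sub>M borel)"
    and [measurable]: "f \<in> borel_measurable borel" "g \<in> borel_measurable borel"
    and "\<And>x y. k x y = k y x"
  shows "interaction k f g = interaction k g f"
proof -
  have "interaction k f g = (\<integral>\<^sup>+y. \<integral>\<^sup>+x. ennreal (f x) * ennreal (g y) * k x y \<partial>lborel \<partial>lborel)"
    unfolding interaction_def by (rule lborel_pair.Fubini'[symmetric]) measurable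
  then show ?thesis
    unfolding interaction_def using assms(4) by (simp add: mult_ac)
qed

lemma interaction_add_square:
  fixes k :: "'a::euclidean_space \<Rightarrow> 'a \<Rightarrow> ennreal"
  assumes k: "(\<lambda>(x, y). k x y) \<in> borel_measurable (borel \<Otimes>\<^sub>M borel)"
    and f: "f \<in> borel_measurable borel" and g: "g \<in> borel_measurable borel"
    and nn: "\<And>x. 0 \<le> f x" "\<And>x. 0 \<le> g x" and sym: "\<And>x y. k x y = k y x"
  shows "interaction k (\<lambda>x. f x + g x) (\<lambda>x. f x + g x) =
    interaction k f f + 2 * interaction k f g + interaction k g g"
proof -
  have fg: "(\<lambda>x. f x + g x) \<in> borel_measurable borel" using f g by measurable
  have "interaction k f (\<lambda>x. f x + g x) = interaction k f f + interaction k f g"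
    using interaction_add_left[OF k f g f nn] interaction_commute[OF k f fg sym] interaction_commute[OF k g f sym]
    by simp
  moreover have "interaction k g (\<lambda>x. f x + g x) = interaction k f g + interaction k g g"
    using interaction_add_left[OF k f g g nn] interaction_commute[OF k g fg sym]
    by simp
  ultimately show ?thesis
    unfolding interaction_add_left[OF k f g fg nn] by (simp add: mult_2 add_ac)
qed

text \<open>The interaction of two densities is an expectation over independent copies of the two
  states. Limits and dilations can therefore be carried out on the particles, where they are
  pointwise, instead of on the densities.\<close>

lemma gc_state_interaction:
  fixes k :: "'a::euclidean_space \<Rightarrow> 'a \<Rightarrow> ennreal"
  assumes k[measurable]: "(\<lambda>(x, y). k x y) \<in> borel_measurable (borel \<Otimes>\<^sub>M borel)"
    and gc: "gc_state N M X S \<rho>" and gc': "gc_state N' M' X' S' \<rho>'"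
  shows "interaction k \<rho> \<rho>' =
    (\<Sum>i<N. \<Sum>j<N'. \<integral>\<^sup>+\<omega>\<in>S i. (\<integral>\<^sup>+\<omega>'\<in>S' j. k (X i \<omega>) (X' j \<omega>') \<partial>M') \<partial>M)"
proof -
  interpret M: prob_space M using gc_stateD(1)[OF gc] .
  interpret M': prob_space M' using gc_stateD(1)[OF gc'] .
  have [measurable]: "\<rho> \<in> borel_measurable borel" "\<rho>' \<in> borel_measurable borel"
    using gc_stateD(4)[OF gc] gc_stateD(4)[OF gc'] by auto
  have kx: "k x \<in> borel_measurable borel" for x
    using measurable_compose[OF measurable_Pair1'[of x borel borel] k] by simp
  have "interaction k \<rho> \<rho>' = (\<integral>\<^sup>+x. ennreal (\<rho> x) * (\<integral>\<^sup>+y. ennreal (\<rho>' y) * k x y \<partial>lborel) \<partial>lborel)"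
    by (rule interaction_inner(1)) measurable
  also have "\<dots> = (\<Sum>i<N. \<integral>\<^sup>+\<omega>\<in>S i. (\<integral>\<^sup>+y. ennreal (\<rho>' y) * k (X i \<omega>) y \<partial>lborel) \<partial>M)"
    by (rule gc_stateD(6)[OF gc], rule interaction_inner(2)) measurable
  also have "\<dots> = (\<Sum>i<N. \<integral>\<^sup>+\<omega>\<in>S i. (\<Sum>j<N'. \<integral>\<^sup>+\<omega>'\<in>S' j. k (X i \<omega>) (X' j \<omega>') \<partial>M') \<partial>M)"
    by (simp add: gc_stateD(6)[OF gc' kx])
  also have "\<dots> = (\<Sum>i<N. \<Sum>j<N'. \<integral>\<^sup>+\<omega>\<in>S i. (\<integral>\<^sup>+\<omega>'\<in>S' j. k (X i \<omega>) (X' j \<omega>') \<partial>M') \<partial>M)"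
  proof (rule sum.cong[OF refl])
    fix i assume "i \<in> {..<N}"
    then have [measurable]: "X i \<in> borel_measurable M" "S i \<in> sets M"
      using gc_stateD(2,3)[OF gc] by auto
    have m: "(\<lambda>\<omega>. (\<integral>\<^sup>+\<omega>'\<in>S' j. k (X i \<omega>) (X' j \<omega>') \<partial>M') * indicator (S i) \<omega>) \<in> borel_measurable M"
      if "j \<in> {..<N'}" for j
    proof -
      have [measurable]: "X' j \<in> borel_measurable M'" "S' j \<in> sets M'"
        using that gc_stateD(2,3)[OF gc'] by auto
      show ?thesis by measurable
    qed
    show "(\<integral>\<^sup>+\<omega>\<in>S i. (\<Sum>j<N'. \<integral>\<^sup>+\<omega>'\<in>S' j. k (X i \<omega>) (X' j \<omega>') \<partial>M') \<partial>M) =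
      (\<Sum>j<N'. \<integral>\<^sup>+\<omega>\<in>S i. (\<integral>\<^sup>+\<omega>'\<in>S' j. k (X i \<omega>) (X' j \<omega>') \<partial>M') \<partial>M)"
      using nn_integral_sum[of "{..<N'}", OF m] by (simp add: sum_distrib_right)
  qed
  finally show ?thesis .
qed

text \<open>Asymmetric on purpose: \<open>f\<close> is the given density and \<open>g\<close> the
  thin one that is added, so that the cross term contains the small factor \<open>g\<close> to the
  power s/d. The constant 2 bounds p = 1 + s/d.\<close>

lemma power_mass_add_le:
  fixes f g :: "'a::euclidean_space \<Rightarrow> real"
  assumes s: "0 < s" "s < real DIM('a)"
    and [measurable]: "f \<in> borel_measurable borel" "g \<in> borel_measurable borel"
    and nn: "\<And>x. 0 \<le> f x" "\<And>x. 0 \<le> g x"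
  shows "power_mass s (\<lambda>x. f x + g x) \<le> power_mass s f + power_mass s g
     + 2 * (\<integral>\<^sup>+x. ennreal (f x) * ennreal (g x powr (s / real DIM('a))) \<partial>lborel)"
proof -
  define p where "p = 1 + s / real DIM('a)"
  have p: "1 < p" "p \<le> 2" "p - 1 = s / real DIM('a)" using s by (auto simp: p_def)
  have "power_mass s (\<lambda>x. f x + g x) \<le> (\<integral>\<^sup>+x. ennreal (f x powr p) + ennreal (g x powr p)
      + 2 * (ennreal (f x) * ennreal (g x powr (p - 1))) \<partial>lborel)"
    unfolding power_mass_def p_def[symmetric]
  proof (intro nn_integral_mono)
    fix x
    have "p * (f x * g x powr (p - 1)) \<le> 2 * (f x * g x powr (p - 1))"
      using p nn[of x] by (intro mult_right_mono) auto
    then have "ennreal ((f x + g x) powr p) \<le> ennreal (f x powr p + g x powr p + 2 * (f x * g x powr (p - 1)))"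
      using powr_add_le_cross[OF nn p(1,2), of x x] by (intro ennreal_leI) linarith
    also have "\<dots> = ennreal (f x powr p) + ennreal (g x powr p) + 2 * (ennreal (f x) * ennreal (g x powr (p - 1)))"
      using nn[of x] by (simp add: ennreal_mult)
    finally show "ennreal ((f x + g x) powr p) \<le> \<dots>" .
  qed
  also have "\<dots> = power_mass s f + power_mass s g
     + 2 * (\<integral>\<^sup>+x. ennreal (f x) * ennreal (g x powr (s / real DIM('a))) \<partial>lborel)"
    unfolding power_mass_def p_def[symmetric] p(3)
    by (simp add: nn_integral_add nn_integral_cmult)
  finally show ?thesis .
qed

lemma nn_integral_lborel_shift:
  fixes f :: "'a::euclidean_space \<Rightarrow> ennreal"
  assumes [measurable]: "f \<in> borel_measurable borel"
  shows "(\<integral>\<^sup>+x. f (x + c) \<partial>lborel) = (\<integral>\<^sup>+x. f x \<partial>lborel)"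
proof -
  have "(\<integral>\<^sup>+x. f x \<partial>lborel) = (\<integral>\<^sup>+x. f x \<partial>distr lborel borel ((+) c))"
    by (simp add: lborel_distr_plus)
  also have "\<dots> = (\<integral>\<^sup>+x. f (x + c) \<partial>lborel)"
    by (subst nn_integral_distr) (auto simp: add.commute)
  finally show ?thesis by simp
qed

subsection \<open>Adding particles\<close>

lemma nn_integral_add4:
  assumes "f1 \<in> borel_measurable M" "f2 \<in> borel_measurable M" "f3 \<in> borel_measurable M" "f4 \<in> borel_measurable M"
  shows "(\<integral>\<^sup>+x. f1 x + f2 x + f3 x + f4 x \<partial>M) =
    (\<integral>\<^sup>+x. f1 x \<partial>M) + (\<integral>\<^sup>+x. f2 x \<partial>M) + (\<integral>\<^sup>+x. f3 x \<partial>M) + (\<integral>\<^sup>+x. f4 x \<partial>M)"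
  using assms by (simp add: nn_integral_add)

text \<open>
  Absent particles are added on the events \<open>E i\<close>, all at translates of one auxiliary point that is
  uniform in a large ball and is used only if it falls into \<open>A\<close>.
\<close>

lemma gc_state_add:
  fixes X :: "nat \<Rightarrow> 'b \<Rightarrow> 'a::euclidean_space" and c :: "nat \<Rightarrow> 'a"
  assumes gc: "gc_state N M X S \<rho>"
    and E: "\<And>i. i < N \<Longrightarrow> E i \<in> sets M" "\<And>i. i < N \<Longrightarrow> E i \<inter> S i = {}"
    and A: "A \<in> sets borel" "A \<subseteq> ball 0 R" and R: "0 < R"
    and \<eta>_def: "\<eta> = 1 / (unit_ball_vol (real DIM('a)) * R ^ DIM('a))"
  defines "M' \<equiv> M \<Otimes>\<^sub>M density lborel (\<lambda>y. ennreal \<eta> * indicator (ball 0 R) y)"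
    and "X' \<equiv> \<lambda>i (\<omega>, y). if \<omega> \<in> S i then X i \<omega> else y + c i"
    and "S' \<equiv> \<lambda>i. {(\<omega>, y). \<omega> \<in> S i \<or> \<omega> \<in> E i \<and> y \<in> A}"
  shows "gc_state N M' X' S' (\<lambda>x. \<rho> x + (\<Sum>i<N. measure M (E i) * \<eta> * indicator A (x - c i)))"
    and "pair_cost s N M' X' S' \<le> pair_cost s N M X S
       + 2 * (\<Sum>i<N. \<Sum>j<N. if i \<noteq> j then \<integral>\<^sup>+\<omega>. indicator (S i) \<omega> * indicator (E j) \<omega> *
            (\<integral>\<^sup>+y. ennreal \<eta> * indicator A y * riesz_kernel s (X i \<omega>) (y + c j) \<partial>lborel) \<partial>M else 0)
       + (\<Sum>i<N. \<Sum>j<N. if i \<noteq> j then emeasure M (E i \<inter> E j) * riesz_kernel s (c i) (c j) else 0)"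
proof -
  interpret M: prob_space M using gc_stateD(1)[OF gc] .
  define U where "U = density lborel (\<lambda>y::'a. ennreal \<eta> * indicator (ball 0 R) y)"
  have \<eta>: "\<eta> > 0" using R by (simp add: \<eta>_def)
  have ball[measurable]: "ball (0::'a) R \<in> sets borel" by simp
  have setsU[measurable_cong]: "sets U = sets borel" by (simp add: U_def)
  have intU: "(\<integral>\<^sup>+y. f y \<partial>U) = ennreal \<eta> * (\<integral>\<^sup>+y\<in>ball 0 R. f y \<partial>lborel)"
    if [measurable]: "f \<in> borel_measurable borel" for f
    unfolding U_def by (subst nn_integral_density) (auto simp: nn_integral_cmult[symmetric] mult_ac)
  have intUA: "(\<integral>\<^sup>+y. indicator A y * f y \<partial>U) = (\<integral>\<^sup>+y. ennreal \<eta> * indicator A y * f y \<partial>lborel)"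
    if [measurable]: "f \<in> borel_measurable borel" for f
  proof -
    have "(\<integral>\<^sup>+y. indicator A y * f y \<partial>U) = (\<integral>\<^sup>+y. ennreal \<eta> * (indicator A y * f y * indicator (ball 0 R) y) \<partial>lborel)"
      using A by (subst intU) (auto simp: nn_integral_cmult)
    also have "\<dots> = (\<integral>\<^sup>+y. ennreal \<eta> * indicator A y * f y \<partial>lborel)"
      using A(2) by (intro nn_integral_cong) (auto simp: indicator_def)
    finally show ?thesis .
  qed
  interpret U: prob_space U
  proof
    have "emeasure U (space U) = (\<integral>\<^sup>+y. 1 \<partial>U)" by simp
    also have "\<dots> = ennreal \<eta> * emeasure lborel (ball (0::'a) R)"
      by (subst intU) auto
    also have "\<dots> = 1"
      using R \<eta> unit_ball_vol_pos[of "real DIM('a)"]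
      by (subst emeasure_lborel_ball) (simp_all add: \<eta>_def less_imp_neq[symmetric] flip: ennreal_mult)
    finally show "emeasure U (space U) = 1" .
  qed
  interpret MU: pair_prob_space M U ..
  have M': "M' = M \<Otimes>\<^sub>M U" by (simp add: M'_def U_def)
  have [measurable]: "A \<in> sets borel" by fact
  have meas: "X i \<in> borel_measurable M" "S i \<in> sets M" "E i \<in> sets M" if "i < N" for i
    using gc_stateD(2,3)[OF gc] E(1) that by auto
  have spU: "space U = UNIV" using sets_eq_imp_space_eq[OF setsU] by simp
  have X'm: "X' i \<in> borel_measurable M'" if "i < N" for i
  proof -
    note [measurable] = meas[OF that]
    show ?thesis unfolding X'_def M' split_beta' by measurable
  qed
  have S'eq: "S' i = {z \<in> space (M \<Otimes>\<^sub>M U). fst z \<in> S i \<or> fst z \<in> E i \<and> snd z \<in> A}" if "i < N" for i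
    using sets.sets_into_space[OF meas(2)[OF that]] sets.sets_into_space[OF meas(3)[OF that]]
    by (auto simp: S'_def space_pair_measure spU)
  have S'm: "S' i \<in> sets M'" if "i < N" for i
  proof -
    note [measurable] = meas[OF that]
    show ?thesis unfolding M' S'eq[OF that] by measurable
  qed
  show "gc_state N M' X' S' (\<lambda>x. \<rho> x + (\<Sum>i<N. measure M (E i) * \<eta> * indicator A (x - c i)))"
    unfolding gc_state_def
  proof (intro conjI ballI)
    show "prob_space M'" unfolding M' by unfold_locales
    have [measurable]: "\<rho> \<in> borel_measurable borel" using gc_stateD(4)[OF gc] .
    show "(\<lambda>x. \<rho> x + (\<Sum>i<N. measure M (E i) * \<eta> * indicator A (x - c i))) \<in> borel_measurable borel"
      by measurable
    show "\<forall>x. 0 \<le> \<rho> x + (\<Sum>i<N. measure M (E i) * \<eta> * indicator A (x - c i))"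
      using gc_stateD(5)[OF gc] \<eta> by (intro allI add_nonneg_nonneg sum_nonneg) auto
    fix f :: "'a \<Rightarrow> ennreal" assume f[measurable]: "f \<in> borel_measurable borel"
    \<comment> \<open>Since \<open>E i\<close> and \<open>S i\<close> are disjoint, the law of
      particle i is its old law plus the uniform density on the translate of \<open>A\<close>,
      weighted with the probability of \<open>E i\<close>.\<close>
    have split: "(\<integral>\<^sup>+z\<in>S' i. f (X' i z) \<partial>M') =
      (\<integral>\<^sup>+\<omega>\<in>S i. f (X i \<omega>) \<partial>M) + (\<integral>\<^sup>+x. ennreal (measure M (E i) * \<eta> * indicator A (x - c i)) * f x \<partial>lborel)"
      if i: "i < N" for i
    proof -
      note [measurable] = meas[OF i] X'm[OF i] S'm[OF i]
      have m1[measurable]: "(\<lambda>z. f (X' i z) * indicator (S' i) z) \<in> borel_measurable (M \<Otimes>\<^sub>M U)"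
        unfolding M'[symmetric] by measurable
      have "(\<integral>\<^sup>+z\<in>S' i. f (X' i z) \<partial>M') = (\<integral>\<^sup>+\<omega>. \<integral>\<^sup>+y. f (X' i (\<omega>, y)) * indicator (S' i) (\<omega>, y) \<partial>U \<partial>M)"
        unfolding M' by (intro U.nn_integral_fst[symmetric]) measurable
      also have "\<dots> = (\<integral>\<^sup>+\<omega>. f (X i \<omega>) * indicator (S i) \<omega> + indicator (E i) \<omega> * (\<integral>\<^sup>+y. indicator A y * f (y + c i) \<partial>U) \<partial>M)"
      proof (intro nn_integral_cong)
        fix \<omega>
        have "(\<integral>\<^sup>+y. f (X' i (\<omega>, y)) * indicator (S' i) (\<omega>, y) \<partial>U)
            = (\<integral>\<^sup>+y. f (X i \<omega>) * indicator (S i) \<omega> + indicator (E i) \<omega> * (indicator A y * f (y + c i)) \<partial>U)"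
          using E(2)[OF i] by (intro nn_integral_cong) (auto simp: X'_def S'_def indicator_def)
        also have "\<dots> = f (X i \<omega>) * indicator (S i) \<omega> + indicator (E i) \<omega> * (\<integral>\<^sup>+y. indicator A y * f (y + c i) \<partial>U)"
          by (subst nn_integral_add) (auto simp: U.emeasure_space_1 nn_integral_cmult)
        finally show "(\<integral>\<^sup>+y. f (X' i (\<omega>, y)) * indicator (S' i) (\<omega>, y) \<partial>U) = \<dots>" .
      qed
      also have "\<dots> = (\<integral>\<^sup>+\<omega>\<in>S i. f (X i \<omega>) \<partial>M) + emeasure M (E i) * (\<integral>\<^sup>+y. indicator A y * f (y + c i) \<partial>U)"
        by (subst nn_integral_add) (auto simp: nn_integral_multc)
      also have "(\<integral>\<^sup>+y. indicator A y * f (y + c i) \<partial>U) = (\<integral>\<^sup>+y. ennreal \<eta> * indicator A (y + c i - c i) * f (y + c i) \<partial>lborel)"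
        by (subst intUA) auto
      also have "\<dots> = (\<integral>\<^sup>+x. ennreal \<eta> * indicator A (x - c i) * f x \<partial>lborel)"
        by (rule nn_integral_lborel_shift) measurable
      also have "emeasure M (E i) * (\<integral>\<^sup>+x. ennreal \<eta> * indicator A (x - c i) * f x \<partial>lborel) =
          (\<integral>\<^sup>+x. ennreal (measure M (E i) * \<eta> * indicator A (x - c i)) * f x \<partial>lborel)"
        using \<eta> by (subst nn_integral_cmult[symmetric])
          (auto simp: M.emeasure_eq_measure ennreal_mult mult.assoc intro!: nn_integral_cong split: split_indicator)
      finally show ?thesis .
    qed
    have "(\<integral>\<^sup>+x. ennreal (\<rho> x + (\<Sum>i<N. measure M (E i) * \<eta> * indicator A (x - c i))) * f x \<partial>lborel)
      = (\<integral>\<^sup>+x. ennreal (\<rho> x) * f x + (\<Sum>i<N. ennreal (measure M (E i) * \<eta> * indicator A (x - c i)) * f x) \<partial>lborel)"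
    proof (intro nn_integral_cong)
      fix x
      define e where "e i = measure M (E i) * \<eta> * indicator A (x - c i)" for i
      have "0 \<le> e i" for i using \<eta> by (simp add: e_def)
      then show "ennreal (\<rho> x + (\<Sum>i<N. measure M (E i) * \<eta> * indicator A (x - c i))) * f x =
          ennreal (\<rho> x) * f x + (\<Sum>i<N. ennreal (measure M (E i) * \<eta> * indicator A (x - c i)) * f x)"
        using gc_stateD(5)[OF gc, of x] unfolding e_def[symmetric]
        by (simp add: sum_nonneg distrib_right sum_distrib_right flip: sum_ennreal)
    qed
    also have "\<dots> = (\<Sum>i<N. \<integral>\<^sup>+\<omega>\<in>S i. f (X i \<omega>) \<partial>M)
        + (\<Sum>i<N. \<integral>\<^sup>+x. ennreal (measure M (E i) * \<eta> * indicator A (x - c i)) * f x \<partial>lborel)"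
      by (subst nn_integral_add) (simp_all add: nn_integral_sum gc_stateD(6)[OF gc f])
    finally show "(\<integral>\<^sup>+x. ennreal (\<rho> x + (\<Sum>i<N. measure M (E i) * \<eta> * indicator A (x - c i))) * f x \<partial>lborel)
      = (\<Sum>i<N. \<integral>\<^sup>+z\<in>S' i. f (X' i z) \<partial>M')"
      by (simp add: split sum.distrib)
  qed (use X'm S'm in auto)

  define T where "T i j = (\<integral>\<^sup>+\<omega>. indicator (S i) \<omega> * indicator (E j) \<omega> *
            (\<integral>\<^sup>+y. ennreal \<eta> * indicator A y * riesz_kernel s (X i \<omega>) (y + c j) \<partial>lborel) \<partial>M)" for i j
  define V where "V i j = emeasure M (E i \<inter> E j) * riesz_kernel s (c i) (c j)" for i j
  define P where "P i j = (\<integral>\<^sup>+\<omega>. indicator (S i) \<omega> * indicator (S j) \<omega> * riesz_kernel s (X i \<omega>) (X j \<omega>) \<partial>M)" for i j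
  have T: "(\<integral>\<^sup>+z. indicator (S i) (fst z) * indicator (E j) (fst z) * (indicator A (snd z) *
      riesz_kernel s (X i (fst z)) (snd z + c j)) \<partial>M') = T i j" if ij: "i < N" "j < N" for i j
  proof -
    note [measurable] = meas[OF ij(1)] meas[OF ij(2)]
    have "(\<integral>\<^sup>+z. indicator (S i) (fst z) * indicator (E j) (fst z) * (indicator A (snd z) *
      riesz_kernel s (X i (fst z)) (snd z + c j)) \<partial>M') =
      (\<integral>\<^sup>+\<omega>. \<integral>\<^sup>+y. indicator (S i) \<omega> * indicator (E j) \<omega> * (indicator A y *
        riesz_kernel s (X i \<omega>) (y + c j)) \<partial>U \<partial>M)"
      unfolding M' by (subst U.nn_integral_fst[symmetric]) simp_all
    also have "\<dots> = T i j"
      unfolding T_def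
      by (intro nn_integral_cong, subst nn_integral_cmult, measurable) (simp add: intUA)
    finally show ?thesis .
  qed
  have pair: "(\<integral>\<^sup>+z. indicator (S' i) z * indicator (S' j) z * riesz_kernel s (X' i z) (X' j z) \<partial>M')
      \<le> P i j + T i j + T j i + V i j" if ij: "i < N" "j < N" for i j
  proof -
    note [measurable] = meas[OF ij(1)] meas[OF ij(2)]
    have "(\<integral>\<^sup>+z. indicator (S' i) z * indicator (S' j) z * riesz_kernel s (X' i z) (X' j z) \<partial>M') \<le>
      (\<integral>\<^sup>+z. indicator (S i) (fst z) * indicator (S j) (fst z) * riesz_kernel s (X i (fst z)) (X j (fst z)) +
         indicator (S i) (fst z) * indicator (E j) (fst z) * (indicator A (snd z) * riesz_kernel s (X i (fst z)) (snd z + c j)) +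
         indicator (S j) (fst z) * indicator (E i) (fst z) * (indicator A (snd z) * riesz_kernel s (X j (fst z)) (snd z + c i)) +
         indicator (E i \<inter> E j) (fst z) * riesz_kernel s (c i) (c j) \<partial>M')"
    proof (intro nn_integral_mono)
      fix z :: "'b \<times> 'a"
      obtain \<omega> y where z: "z = (\<omega>, y)" by (cases z)
      \<comment> \<open>Two added particles are translates of the same random point, so their
        distance is deterministic. This is why a single auxiliary point suffices for all of
        them.\<close>
      have "riesz_kernel s (y + c i) (y + c j) = riesz_kernel s (c i) (c j)"
        using riesz_kernel_translate[of s "c i" y "c j"] by (simp add: add.commute)
      then show "indicator (S' i) z * indicator (S' j) z * riesz_kernel s (X' i z) (X' j z) \<le>
         indicator (S i) (fst z) * indicator (S j) (fst z) * riesz_kernel s (X i (fst z)) (X j (fst z)) +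
         indicator (S i) (fst z) * indicator (E j) (fst z) * (indicator A (snd z) * riesz_kernel s (X i (fst z)) (snd z + c j)) +
         indicator (S j) (fst z) * indicator (E i) (fst z) * (indicator A (snd z) * riesz_kernel s (X j (fst z)) (snd z + c i)) +
         indicator (E i \<inter> E j) (fst z) * riesz_kernel s (c i) (c j)"
        using E(2)[OF ij(1)] E(2)[OF ij(2)]
        by (auto simp: z X'_def S'_def indicator_def riesz_kernel_commute[of s _ "X j \<omega>"])
    qed
    also have "\<dots> = P i j + T i j + T j i + V i j"
    proof -
      have 1: "(\<integral>\<^sup>+z. indicator (S i) (fst z) * indicator (S j) (fst z) * riesz_kernel s (X i (fst z)) (X j (fst z)) \<partial>M') = P i j"
        unfolding M' P_def by (subst U.nn_integral_fst[symmetric]) (simp_all add: U.emeasure_space_1)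
      have 2: "(\<integral>\<^sup>+z. indicator (E i \<inter> E j) (fst z) * riesz_kernel s (c i) (c j) \<partial>M') = V i j"
        unfolding M' V_def by (subst U.nn_integral_fst[symmetric]) (simp_all add: U.emeasure_space_1 nn_integral_multc)
      show ?thesis
        unfolding 1[symmetric] 2[symmetric] T[OF ij, symmetric] T[OF ij(2,1), symmetric] M'
        by (intro nn_integral_add4) measurable
    qed
    finally show ?thesis .
  qed
  have "pair_cost s N M' X' S' = (\<Sum>i<N. \<Sum>j<N. if i \<noteq> j then
      \<integral>\<^sup>+z. indicator (S' i) z * indicator (S' j) z * riesz_kernel s (X' i z) (X' j z) \<partial>M' else 0)"
    using X'm S'm by (rule pair_cost_eq_sum)
  also have "\<dots> \<le> (\<Sum>i<N. \<Sum>j<N. if i \<noteq> j then P i j + T i j + T j i + V i j else 0)"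
    by (intro sum_mono) (auto intro!: pair)
  also have "\<dots> = (\<Sum>i<N. \<Sum>j<N. if i \<noteq> j then P i j else 0) + (\<Sum>i<N. \<Sum>j<N. if i \<noteq> j then T i j else 0)
      + (\<Sum>i<N. \<Sum>j<N. if i \<noteq> j then T j i else 0) + (\<Sum>i<N. \<Sum>j<N. if i \<noteq> j then V i j else 0)"
    unfolding sum.distrib[symmetric] by (intro sum.cong refl) auto
  also have "(\<Sum>i<N. \<Sum>j<N. if i \<noteq> j then T j i else 0) = (\<Sum>i<N. \<Sum>j<N. if i \<noteq> j then T i j else 0)"
    by (subst sum.swap) (intro sum.cong refl, auto)
  also have "(\<Sum>i<N. \<Sum>j<N. if i \<noteq> j then P i j else 0) = pair_cost s N M X S"
    unfolding P_def using meas by (intro pair_cost_eq_sum[symmetric]) auto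
  finally show "pair_cost s N M' X' S' \<le> pair_cost s N M X S
       + 2 * (\<Sum>i<N. \<Sum>j<N. if i \<noteq> j then \<integral>\<^sup>+\<omega>. indicator (S i) \<omega> * indicator (E j) \<omega> *
            (\<integral>\<^sup>+y. ennreal \<eta> * indicator A y * riesz_kernel s (X i \<omega>) (y + c j) \<partial>lborel) \<partial>M else 0)
       + (\<Sum>i<N. \<Sum>j<N. if i \<noteq> j then emeasure M (E i \<inter> E j) * riesz_kernel s (c i) (c j) else 0)"
    unfolding T_def V_def by (simp add: mult_2 add_ac)
qed

lemma gc_state_cong_AE:
  assumes "\<And>i. i < N \<Longrightarrow> S' i \<in> sets M" "\<And>i. i < N \<Longrightarrow> AE \<omega> in M. \<omega> \<in> S i \<longleftrightarrow> \<omega> \<in> S' i"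
    and gc: "gc_state N M X S \<rho>"
  shows "gc_state N M X S' \<rho>"
proof -
  have "(\<integral>\<^sup>+\<omega>\<in>S i. f (X i \<omega>) \<partial>M) = (\<integral>\<^sup>+\<omega>\<in>S' i. f (X i \<omega>) \<partial>M)" if "i < N" for i f
    using assms(2)[OF that] by (intro nn_integral_cong_AE) (auto simp: indicator_def)
  then show ?thesis
    using gc assms(1) by (simp add: gc_state_def)
qed

lemma pair_cost_cong_AE:
  assumes "\<And>i. i < N \<Longrightarrow> AE \<omega> in M. \<omega> \<in> S i \<longleftrightarrow> \<omega> \<in> S' i"
  shows "pair_cost s N M X S = pair_cost s N M X S'"
proof -
  have "AE \<omega> in M. \<forall>i\<in>{..<N}. \<omega> \<in> S i \<longleftrightarrow> \<omega> \<in> S' i"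
    using assms by (intro AE_finite_allI) auto
  then show ?thesis
    unfolding pair_cost_def
    by (intro nn_integral_cong_AE) (auto elim!: eventually_mono intro!: sum.cong simp: indicator_def)
qed

text \<open>Index 0 is excluded because the errors in the applications contain terms such as
  \<open>real n powr - s\<close> or \<open>1 / real n\<close>, whose default value at 0 is 0 and
  bounds nothing.\<close>

lemma ennreal_le_add_vanishing:
  fixes a b :: ennreal
  assumes "\<And>n::nat. 1 \<le> n \<Longrightarrow> a \<le> b + ennreal (e n)" "e \<longlonglongrightarrow> 0"
  shows "a \<le> b"
proof (rule LIMSEQ_le_const)
  show "(\<lambda>n. b + ennreal (e n)) \<longlonglongrightarrow> b"
    using tendsto_add[OF tendsto_const[of b] tendsto_ennrealI[OF assms(2)]] by simp
  show "\<exists>N. \<forall>n\<ge>N. a \<le> b + ennreal (e n)" using assms(1) by blast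
qed

text \<open>The bathtub bound with height \<eta> and mass 1. The result does not depend on the
  position of the test point, so no knowledge about the particles already present is
  required.\<close>

lemma potential_of_uniform_le:
  fixes x :: "'a::euclidean_space"
  assumes s: "0 < s" "s < real DIM('a)" and A[measurable]: "A \<in> sets borel" and \<eta>: "0 < \<eta>"
    and mass: "ennreal \<eta> * emeasure lborel A \<le> 1"
  shows "(\<integral>\<^sup>+y. ennreal \<eta> * indicator A y * riesz_kernel s x (y + c) \<partial>lborel)
      \<le> ennreal ((riesz_const TYPE('a) s + 1) * \<eta> powr (s / real DIM('a)))"
proof -
  have "(\<integral>\<^sup>+y. ennreal \<eta> * indicator A y * riesz_kernel s x (y + c) \<partial>lborel)
      = (\<integral>\<^sup>+y. (ennreal \<eta> * indicator A y) * riesz_kernel s (x - c) y \<partial>lborel)"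
    using riesz_kernel_translate[of s "x - c" c] by (intro nn_integral_cong) simp
  also have "\<dots> \<le> ennreal ((riesz_const TYPE('a) s + 1) * \<eta> powr (s / real DIM('a)) * 1 powr (1 - s / real DIM('a)))"
    by (intro nn_integral_riesz_kernel_bounded s \<eta>)
      (use mass in \<open>auto simp: nn_integral_cmult_indicator split: split_indicator\<close>)
  finally show ?thesis by simp
qed

text \<open>
  A state with at most \<open>N\<close> particles obeys the same bound as one with exactly \<open>N\<close>: put the missing
  particles far away, spread over a large volume, where they contribute nothing.
\<close>

lemma gc_bound:
  fixes X :: "nat \<Rightarrow> 'b \<Rightarrow> 'a::euclidean_space"
  assumes s: "0 < s" "s < real DIM('a)" and N: "1 \<le> N"
    and gc: "gc_state N M X S \<rho>" and fin: "power_mass s \<rho> < \<infinity>"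
    and \<Lambda>: "Lambda TYPE('a) s N \<le> ereal l" and l: "0 \<le> l"
  shows "D s \<rho> \<le> pair_cost s N M X S + ennreal (2 * l) * power_mass s \<rho>"
proof -
  interpret M: prob_space M using gc_stateD(1)[OF gc] .
  define d where "d = real DIM('a)"
  define v where "v = unit_ball_vol d"
  define C where "C = riesz_const TYPE('a) s + 1"
  have d: "d > 0" by (simp add: d_def)
  have v: "v > 0" by (simp add: v_def d_def)
  have C: "C > 0" using riesz_const_pos[OF s(2)] by (simp add: C_def)
  obtain e :: 'a where e: "e \<in> Basis" using nonempty_Basis by blast
  \<comment> \<open>The value of \<eta>^(s/d) when the auxiliary point is uniform in the ball of
    radius n; it decays like n^-s.\<close>
  define t where "t n = v powr - (s / d) * real n powr - s" for n :: nat
  \<comment> \<open>The three terms bound the interaction of added with old particles, that of added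
    particles among each other, and the increase of the power mass multiplied by 2 l.\<close>
  define err where "err n = 2 * real N ^ 2 * C * t n + real N ^ 2 * real n powr - s +
      2 * l * (2 * real N * (real N powr (s / d) * t n))" for n :: nat
  have "D s \<rho> \<le> pair_cost s N M X S + ennreal (2 * l) * power_mass s \<rho> + ennreal (err n)" if n: "1 \<le> n" for n
  proof -
    define R where "R = real n"
    have R: "R > 0" using n by (simp add: R_def)
    define \<eta> where "\<eta> = 1 / (unit_ball_vol (real DIM('a)) * R ^ DIM('a))"
    have \<eta>: "\<eta> > 0" using R by (simp add: \<eta>_def)
    have \<eta>t: "\<eta> powr (s / d) = t n"
    proof -
      have "R ^ DIM('a) = R powr d" using R by (simp add: d_def flip: powr_realpow)
      then show ?thesis
        using R v d
        by (simp add: \<eta>_def t_def R_def[symmetric] v_def[symmetric] d_def[symmetric] powr_divide powr_mult powr_powr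
            powr_minus field_simps)
    qed
    have [measurable]: "ball (0::'a) R \<in> sets borel" by simp
    have \<eta>ball: "ennreal \<eta> * emeasure lborel (ball (0::'a) R) = 1"
      using R v by (subst emeasure_lborel_ball)
        (simp_all add: \<eta>_def v_def[symmetric] d_def[symmetric] flip: ennreal_mult)
    define E where "E i = space M - S i" for i
    \<comment> \<open>Translations along one axis at mutual distance at least \<open>R\<close>, so
      that two added particles interact with energy at most R^-s.\<close>
    define c where "c i = (4 * R * real i) *\<^sub>R e" for i
    define h where "h x = (\<Sum>i<N. measure M (E i) * \<eta> * indicator (ball 0 R) (x - c i))" for x :: 'a
    define M' where "M' = M \<Otimes>\<^sub>M density lborel (\<lambda>y::'a. ennreal \<eta> * indicator (ball 0 R) y)"
    define X' where "X' = (\<lambda>i (\<omega>, y). if \<omega> \<in> S i then X i \<omega> else y + c i)"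
    define S' where "S' = (\<lambda>i. {(\<omega>, y). \<omega> \<in> S i \<or> \<omega> \<in> E i \<and> y \<in> ball (0::'a) R})"
    have Em: "E i \<in> sets M" if "i < N" for i
      using gc_stateD(3)[OF gc that] by (auto simp: E_def)
    have Ed: "E i \<inter> S i = {}" if "i < N" for i
      by (auto simp: E_def)
    have add: "gc_state N M' X' S' (\<lambda>x. \<rho> x + h x)"
      "pair_cost s N M' X' S' \<le> pair_cost s N M X S
       + 2 * (\<Sum>i<N. \<Sum>j<N. if i \<noteq> j then \<integral>\<^sup>+\<omega>. indicator (S i) \<omega> * indicator (E j) \<omega> *
            (\<integral>\<^sup>+y. ennreal \<eta> * indicator (ball 0 R) y * riesz_kernel s (X i \<omega>) (y + c j) \<partial>lborel) \<partial>M else 0)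
       + (\<Sum>i<N. \<Sum>j<N. if i \<noteq> j then emeasure M (E i \<inter> E j) * riesz_kernel s (c i) (c j) else 0)"
      unfolding M'_def X'_def S'_def h_def
      by (rule gc_state_add[OF gc Em Ed _ order_refl R \<eta>_def]; simp)+
    \<comment> \<open>The auxiliary point lies in the ball almost surely and \<open>E i\<close> is
      the whole complement of \<open>S i\<close>. Hence every particle is present up to a null set
      and the bound for exactly \<open>N\<close> particles applies.\<close>
    have AE_ball: "AE z in M'. snd z \<in> ball 0 R"
    proof (rule AE_I')
      define U where "U = density lborel (\<lambda>y::'a. ennreal \<eta> * indicator (ball 0 R) y)"
      have setsU: "sets U = sets borel" by (simp add: U_def)
      interpret U: prob_space U
      proof
        show "emeasure U (space U) = 1"
          using \<eta>ball by (simp add: U_def emeasure_density nn_integral_cmult_indicator)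
      qed
      have "emeasure U (- ball 0 R) = (\<integral>\<^sup>+y\<in>- ball (0::'a) R. (ennreal \<eta> * indicator (ball 0 R) y) \<partial>lborel)"
        unfolding U_def by (rule emeasure_density) auto
      also have "\<dots> = (\<integral>\<^sup>+y. 0 \<partial>(lborel :: 'a measure))"
        by (intro nn_integral_cong) (simp split: split_indicator)
      finally have "emeasure U (- ball 0 R) = 0" by simp
      then show "space M \<times> (- ball 0 R) \<in> null_sets M'"
        unfolding M'_def U_def[symmetric]
        by (auto simp: null_sets_def U.emeasure_pair_measure_Times setsU)
      show "{z \<in> space M'. \<not> snd z \<in> ball 0 R} \<subseteq> space M \<times> (- ball 0 R)"
        by (auto simp: M'_def space_pair_measure)
    qed
    have full: "AE z in M'. z \<in> S' i \<longleftrightarrow> z \<in> space M'" if "i < N" for i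
      using AE_ball AE_space
    proof eventually_elim
      case (elim z)
      then have "fst z \<in> space M" by (auto simp: M'_def space_pair_measure)
      with elim show ?case by (auto simp: S'_def E_def split_beta')
    qed
    have [measurable]: "\<rho> \<in> borel_measurable borel" using gc_stateD(4)[OF gc] .
    have [measurable]: "h \<in> borel_measurable borel" unfolding h_def by measurable
    have h0: "0 \<le> h x" for x using \<eta> by (auto simp: h_def intro!: sum_nonneg)
    have hN: "h x \<le> real N * \<eta>" for x
    proof -
      have "h x \<le> (\<Sum>i<N. \<eta>)"
        unfolding h_def using \<eta> by (intro sum_mono) (auto intro!: mult_left_le_one_le split: split_indicator)
      then show ?thesis by simp
    qed
    have mass_h: "(\<integral>\<^sup>+x. ennreal (\<rho> x) + ennreal (h x) \<partial>lborel) \<le> ennreal (real N)"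
      using gc_state_mass_le[OF add(1)] h0 gc_stateD(5)[OF gc] by simp
    have tn: "0 \<le> t n" by (simp add: t_def)
    have h_pow: "h x powr (s / d) \<le> real N powr (s / d) * t n" for x
    proof -
      have "h x powr (s / d) \<le> (real N * \<eta>) powr (s / d)"
        using hN h0 s d by (intro powr_mono2) auto
      then show ?thesis using \<eta> by (simp add: powr_mult \<eta>t)
    qed
    have "power_mass s (\<lambda>x. \<rho> x + h x) \<le> power_mass s \<rho> + power_mass s h
        + 2 * (\<integral>\<^sup>+x. ennreal (\<rho> x) * ennreal (h x powr (s / d)) \<partial>lborel)"
      unfolding d_def using gc_stateD(5)[OF gc] h0 by (intro power_mass_add_le s) auto
    also have "power_mass s h = (\<integral>\<^sup>+x. ennreal (h x) * ennreal (h x powr (s / d)) \<partial>lborel)"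
      unfolding power_mass_def
    proof (intro nn_integral_cong)
      fix x
      have "h x powr (1 + s / real DIM('a)) = h x * h x powr (s / d)"
        using h0[of x] by (cases "h x = 0") (auto simp: powr_add d_def)
      then show "ennreal (h x powr (1 + s / real DIM('a))) = ennreal (h x) * ennreal (h x powr (s / d))"
        using h0[of x] by (simp add: ennreal_mult)
    qed
    finally have "power_mass s (\<lambda>x. \<rho> x + h x) \<le> power_mass s \<rho>
        + (\<integral>\<^sup>+x. ennreal (h x) * ennreal (h x powr (s / d)) \<partial>lborel)
        + 2 * (\<integral>\<^sup>+x. ennreal (\<rho> x) * ennreal (h x powr (s / d)) \<partial>lborel)" .
    also have "\<dots> \<le> power_mass s \<rho> + 2 * (\<integral>\<^sup>+x. ennreal (h x) * ennreal (h x powr (s / d)) \<partial>lborel)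
        + 2 * (\<integral>\<^sup>+x. ennreal (\<rho> x) * ennreal (h x powr (s / d)) \<partial>lborel)"
      by (intro add_mono order_refl) (simp add: mult_2)
    also have "\<dots> = power_mass s \<rho> + 2 * (\<integral>\<^sup>+x. (ennreal (\<rho> x) + ennreal (h x)) * ennreal (h x powr (s / d)) \<partial>lborel)"
      by (simp add: distrib_right nn_integral_add distrib_left add_ac)
    also have "\<dots> \<le> power_mass s \<rho> + 2 * (\<integral>\<^sup>+x. (ennreal (\<rho> x) + ennreal (h x)) * ennreal (real N powr (s / d) * t n) \<partial>lborel)"
      by (intro add_mono mult_left_mono order_refl nn_integral_mono ennreal_leI h_pow) auto
    also have "(\<integral>\<^sup>+x. (ennreal (\<rho> x) + ennreal (h x)) * ennreal (real N powr (s / d) * t n) \<partial>lborel) =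
        (\<integral>\<^sup>+x. ennreal (\<rho> x) + ennreal (h x) \<partial>lborel) * ennreal (real N powr (s / d) * t n)"
      by (intro nn_integral_multc) measurable
    also have "power_mass s \<rho> + 2 * ((\<integral>\<^sup>+x. ennreal (\<rho> x) + ennreal (h x) \<partial>lborel) * ennreal (real N powr (s / d) * t n))
        \<le> power_mass s \<rho> + 2 * (ennreal (real N) * ennreal (real N powr (s / d) * t n))"
      by (intro add_mono mult_left_mono mult_right_mono order_refl mass_h) auto
    also have "\<dots> = power_mass s \<rho> + ennreal (2 * real N * (real N powr (s / d) * t n))"
      using tn by (simp add: ennreal_mult mult_ac)
    finally have pm: "power_mass s (\<lambda>x. \<rho> x + h x) \<le>
        power_mass s \<rho> + ennreal (2 * real N * (real N powr (s / d) * t n))" .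
    have T: "(\<integral>\<^sup>+\<omega>. indicator (S i) \<omega> * indicator (E j) \<omega> *
            (\<integral>\<^sup>+y. ennreal \<eta> * indicator (ball 0 R) y * riesz_kernel s (X i \<omega>) (y + c j) \<partial>lborel) \<partial>M) \<le> ennreal (C * t n)"
      for i j
    proof -
      have "(\<integral>\<^sup>+\<omega>. indicator (S i) \<omega> * indicator (E j) \<omega> *
            (\<integral>\<^sup>+y. ennreal \<eta> * indicator (ball 0 R) y * riesz_kernel s (X i \<omega>) (y + c j) \<partial>lborel) \<partial>M)
          \<le> (\<integral>\<^sup>+\<omega>. 1 * 1 * ennreal (C * t n) \<partial>M)"
        unfolding C_def \<eta>t[symmetric] d_def
        by (intro nn_integral_mono mult_mono potential_of_uniform_le s \<eta>) (auto simp: \<eta>ball indicator_def)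
      then show ?thesis by (simp add: M.emeasure_space_1)
    qed
    have V: "emeasure M (E i \<inter> E j) * riesz_kernel s (c i) (c j) \<le> ennreal (real n powr - s)" if "i \<noteq> j" for i j
    proof -
      have "norm (c i - c j) = 4 * R * \<bar>real i - real j\<bar>"
        using e R by (simp add: c_def abs_mult flip: scaleR_diff_left right_diff_distrib)
      moreover have "R * 1 \<le> 4 * R * \<bar>real i - real j\<bar>"
        using that R by (intro mult_mono) auto
      ultimately have "riesz_kernel s (c i) (c j) \<le> ennreal (R powr - s)"
        by (intro riesz_kernel_le s R) simp
      then have "emeasure M (E i \<inter> E j) * riesz_kernel s (c i) (c j) \<le> 1 * ennreal (R powr - s)"
        by (intro mult_mono M.emeasure_le_1) auto
      then show ?thesis by (simp add: R_def)
    qed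
    have NN: "(\<Sum>i<N. \<Sum>j<N. a) = ennreal (real N ^ 2) * a" for a :: ennreal
      by (simp add: power2_eq_square ennreal_mult ennreal_of_nat_eq_real_of_nat mult_ac)
    have "pair_cost s N M' X' S' \<le> pair_cost s N M X S
       + 2 * (\<Sum>i<N. \<Sum>j<N. ennreal (C * t n)) + (\<Sum>i<N. \<Sum>j<N. ennreal (real n powr - s))"
      by (rule order_trans[OF add(2)], intro add_mono mult_left_mono sum_mono order_refl) (auto intro: T V)
    also have "\<dots> = pair_cost s N M X S + ennreal (2 * real N ^ 2 * C * t n + real N ^ 2 * real n powr - s)"
      unfolding NN using C tn by (simp add: ennreal_mult mult_ac add_ac)
    finally have pc: "pair_cost s N M' X' S' \<le> \<dots>" .
    \<comment> \<open>Monotonicity of \<open>D\<close> suffices here: the energy gained from the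
      added density is discarded, and only the added cost and power mass have to vanish.\<close>
    have "D s \<rho> \<le> D s (\<lambda>x. \<rho> x + h x)"
      unfolding D_def using h0 by (intro nn_integral_mono mult_right_mono mult_mono ennreal_leI) auto
    also have "\<dots> \<le> pair_cost s N M' X' (\<lambda>_. space M') + ennreal (2 * l) * power_mass s (\<lambda>x. \<rho> x + h x)"
    proof (rule canonical_bound[OF N _ _ \<Lambda> l])
      show "gc_state N M' X' (\<lambda>_. space M') (\<lambda>x. \<rho> x + h x)"
        by (rule gc_state_cong_AE[OF _ full add(1)]) auto
      show "power_mass s (\<lambda>x. \<rho> x + h x) < \<infinity>"
        using pm fin by (auto simp: less_top[symmetric] top_unique)
    qed
    also have "pair_cost s N M' X' (\<lambda>_. space M') = pair_cost s N M' X' S'"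
      using full by (intro pair_cost_cong_AE) auto
    also have "\<dots> + ennreal (2 * l) * power_mass s (\<lambda>x. \<rho> x + h x) \<le>
      (pair_cost s N M X S + ennreal (2 * real N ^ 2 * C * t n + real N ^ 2 * real n powr - s)) +
      ennreal (2 * l) * (power_mass s \<rho> + ennreal (2 * real N * (real N powr (s / d) * t n)))"
      by (intro add_mono mult_left_mono pc pm) auto
    also have "\<dots> = pair_cost s N M X S + ennreal (2 * l) * power_mass s \<rho> + ennreal (err n)"
    proof -
      have "ennreal (err n) = ennreal (2 * real N ^ 2 * C * t n + real N ^ 2 * real n powr - s) +
          ennreal (2 * l * (2 * real N * (real N powr (s / d) * t n)))"
        unfolding err_def using C tn l by (intro ennreal_plus) auto
      also have "ennreal (2 * l * (2 * real N * (real N powr (s / d) * t n))) =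
          ennreal (2 * l) * ennreal (2 * real N * (real N powr (s / d) * t n))"
        using tn l by (intro ennreal_mult) auto
      finally show ?thesis by (simp only: distrib_left add_ac)
    qed
    finally show ?thesis .
  qed
  moreover have "err \<longlonglongrightarrow> 0"
  proof -
    have n0: "(\<lambda>n. real n powr - s) \<longlonglongrightarrow> 0"
      using s tendsto_neg_powr[OF _ filterlim_real_sequentially, of "- s"] by simp
    then have t0: "t \<longlonglongrightarrow> 0"
      unfolding t_def by (rule tendsto_mult_right_zero)
    have "err \<longlonglongrightarrow> 2 * real N ^ 2 * C * 0 + real N ^ 2 * 0 + 2 * l * (2 * real N * (real N powr (s / d) * 0))"
      unfolding err_def by (intro tendsto_add tendsto_mult_left n0 t0)
    then show ?thesis by simp
  qed
  ultimately show ?thesis by (rule ennreal_le_add_vanishing)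
qed

subsection \<open>The particle number of optimal states\<close>

definition shell :: "nat \<Rightarrow> 'a::euclidean_space set" where
  "shell n = ball 0 (2 * real n) - ball 0 (real n)"

text \<open>Only its shape matters: divided by its value at the origin it is bounded uniformly in n
  and tends to 1 at every fixed point. A distant shell thus acts on all particles alike and counts
  them.\<close>

definition shell_potential :: "real \<Rightarrow> nat \<Rightarrow> 'a::euclidean_space \<Rightarrow> ennreal" where
  "shell_potential s n x = (\<integral>\<^sup>+y\<in>shell n. riesz_kernel s x y \<partial>lborel)"

lemma shell_measurable [measurable]: "shell n \<in> sets borel"
  by (simp add: shell_def)

lemma in_shell: "y \<in> shell n \<longleftrightarrow> real n \<le> norm y \<and> norm y < 2 * real n"
  by (auto simp: shell_def)

lemma emeasure_shell:
  "emeasure lborel (shell n :: 'a::euclidean_space set) =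
     ennreal (unit_ball_vol (real DIM('a)) * (2 ^ DIM('a) - 1) * real n ^ DIM('a))"
proof -
  have "emeasure lborel (shell n :: 'a set) = emeasure lborel (ball (0::'a) (2 * real n)) - emeasure lborel (ball (0::'a) (real n))"
    unfolding shell_def by (intro emeasure_Diff) (auto simp: emeasure_lborel_ball)
  also have "\<dots> = ennreal (unit_ball_vol (real DIM('a)) * (2 * real n) ^ DIM('a) - unit_ball_vol (real DIM('a)) * real n ^ DIM('a))"
    by (subst (1 2) emeasure_lborel_ball) (auto intro!: ennreal_minus)
  also have "unit_ball_vol (real DIM('a)) * (2 * real n) ^ DIM('a) - unit_ball_vol (real DIM('a)) * real n ^ DIM('a)
      = unit_ball_vol (real DIM('a)) * (2 ^ DIM('a) - 1) * real n ^ DIM('a)"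
    by (simp add: power_mult_distrib algebra_simps)
  finally show ?thesis .
qed

lemma shell_potential_measurable [measurable]: "shell_potential s n \<in> borel_measurable borel"
  unfolding shell_potential_def[abs_def] by measurable

text \<open>With u = |x| / n, every y in the shell satisfies |x| \<le> u |y|, hence |x - y| lies
  between (1 - u) |y| and (1 + u) |y|. The pointwise comparison of kernels is then
  integrated.\<close>

lemma shell_potential_comparison:
  fixes x :: "'a::euclidean_space"
  assumes s: "0 < s" and n: "norm x < real n"
  shows "shell_potential s n x \<le> ennreal ((1 - norm x / real n) powr - s) * shell_potential s n (0::'a)"
    and "ennreal ((1 + norm x / real n) powr - s) * shell_potential s n (0::'a) \<le> shell_potential s n x"
proof -
  have n0: "0 < real n" using n norm_ge_zero[of x] by linarith
  define u where "u = norm x / real n"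
  have u: "0 \<le> u" "u < 1" using n n0 by (auto simp: u_def)
  have le: "riesz_kernel s x y \<le> ennreal ((1 - u) powr - s) * riesz_kernel s 0 y"
    and ge: "ennreal ((1 + u) powr - s) * riesz_kernel s 0 y \<le> riesz_kernel s x y"
    if y: "y \<in> shell n" for y
  proof -
    have y: "real n \<le> norm y" "y \<noteq> 0" "x \<noteq> y" using y n n0 by (auto simp: in_shell)
    have xu: "norm x \<le> u * norm y"
      using y n0 u mult_left_mono[of "real n" "norm y" u] by (simp add: u_def)
    have "(1 - u) * norm y \<le> norm (x - y)"
      using norm_triangle_ineq2[of y x] xu by (simp add: algebra_simps norm_minus_commute)
    then have "riesz_kernel s x y \<le> ennreal (((1 - u) * norm y) powr - s)"
      using u y by (intro riesz_kernel_le s) auto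
    then show "riesz_kernel s x y \<le> ennreal ((1 - u) powr - s) * riesz_kernel s 0 y"
      using u y by (simp add: riesz_kernel_offdiag powr_mult ennreal_mult)
    have "norm (x - y) \<le> (1 + u) * norm y"
      using norm_triangle_ineq4[of x y] xu by (simp add: algebra_simps)
    then have "((1 + u) * norm y) powr - s \<le> norm (x - y) powr - s"
      using y s by (intro powr_mono2') auto
    then show "ennreal ((1 + u) powr - s) * riesz_kernel s 0 y \<le> riesz_kernel s x y"
      using u y by (simp add: riesz_kernel_offdiag powr_mult flip: ennreal_mult)
  qed
  show "shell_potential s n x \<le> ennreal ((1 - norm x / real n) powr - s) * shell_potential s n (0::'a)"
    unfolding shell_potential_def u_def[symmetric]
    by (subst nn_integral_cmult[symmetric]) (auto intro!: nn_integral_mono le simp: indicator_def)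
  show "ennreal ((1 + norm x / real n) powr - s) * shell_potential s n (0::'a) \<le> shell_potential s n x"
    unfolding shell_potential_def u_def[symmetric]
    by (subst nn_integral_cmult[symmetric]) (auto intro!: nn_integral_mono ge simp: indicator_def)
qed

lemma shell_potential_0:
  fixes n :: nat
  assumes s: "0 < s" and n: "1 \<le> n"
  shows "ennreal ((2 * real n) powr - s) * emeasure lborel (shell n :: 'a::euclidean_space set)
      \<le> shell_potential s n (0::'a)"
    and "shell_potential s n (0::'a) < \<infinity>"
proof -
  have "ennreal ((2 * real n) powr - s) * emeasure lborel (shell n :: 'a set) =
      (\<integral>\<^sup>+y\<in>(shell n :: 'a set). ennreal ((2 * real n) powr - s) \<partial>lborel)"
    by (simp add: nn_integral_cmult_indicator)
  also have "\<dots> \<le> shell_potential s n (0::'a)"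
    unfolding shell_potential_def
  proof (intro nn_integral_mono)
    fix y :: 'a
    have "ennreal ((2 * real n) powr - s) \<le> riesz_kernel s 0 y" if "y \<in> shell n"
    proof -
      have "y \<noteq> 0" using that n by (auto simp: in_shell)
      moreover have "(2 * real n) powr - s \<le> norm y powr - s"
        using that n s by (intro powr_mono2') (auto simp: in_shell)
      ultimately show ?thesis by (simp add: riesz_kernel_offdiag ennreal_leI)
    qed
    then show "ennreal ((2 * real n) powr - s) * indicator (shell n) y \<le> riesz_kernel s 0 y * indicator (shell n) y"
      by (auto simp: indicator_def)
  qed
  finally show "ennreal ((2 * real n) powr - s) * emeasure lborel (shell n :: 'a set) \<le> shell_potential s n (0::'a)" .
  have "shell_potential s n (0::'a) \<le> (\<integral>\<^sup>+y\<in>(shell n :: 'a set). ennreal (real n powr - s) \<partial>lborel)"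
    unfolding shell_potential_def
    using n by (intro nn_integral_mono) (auto simp: indicator_def in_shell intro!: riesz_kernel_le s)
  also have "\<dots> < \<infinity>"
    by (simp add: nn_integral_cmult_indicator emeasure_shell ennreal_mult_less_top)
  finally show "shell_potential s n (0::'a) < \<infinity>" .
qed

lemma shell_potential_0_pos:
  assumes s: "0 < s" and n: "1 \<le> n"
  shows "0 < shell_potential s n (0::'a::euclidean_space)"
proof -
  have "0 < unit_ball_vol (real DIM('a)) * (2 ^ DIM('a) - 1) * real n ^ DIM('a)"
    using n by (intro mult_pos_pos) auto
  then have "0 < ennreal ((2 * real n) powr - s) * emeasure lborel (shell n :: 'a set)"
    using n by (simp add: emeasure_shell ennreal_zero_less_mult_iff)
  with shell_potential_0(1)[OF assms, where 'a='a] show ?thesis by simp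
qed

text \<open>The shell has volume of order n^d, so the bathtub bound with height 1 is of order
  n^(d-s), uniformly in x. The value at the origin has the same order from below. This is the
  domination for the limit n to infinity, as it also covers points inside or near the shell.\<close>

lemma shell_potential_le:
  assumes s: "0 < s" "s < real DIM('a::euclidean_space)"
  obtains C where "0 < C" "\<And>n x. 1 \<le> n \<Longrightarrow> shell_potential s n (x::'a) \<le> ennreal C * shell_potential s n (0::'a)"
proof -
  define d where "d = real DIM('a)"
  define w where "w = unit_ball_vol d * (2 ^ DIM('a) - 1)"
  have d: "d > 0" by (simp add: d_def)
  have w: "w > 0" unfolding w_def by (intro mult_pos_pos) (auto simp: d_def)
  define C where "C = (riesz_const TYPE('a) s + 1) * w powr - (s / d) * 2 powr s"
  have C: "C > 0" using riesz_const_pos[OF s(2)] w by (simp add: C_def)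
  have "shell_potential s n x \<le> ennreal C * shell_potential s n (0::'a)" if n: "1 \<le> n" for n and x :: 'a
  proof -
    define m where "m = w * real n powr d"
    have m: "m > 0" using w n by (simp add: m_def)
    have em: "emeasure lborel (shell n :: 'a set) = ennreal m"
      using n by (simp add: emeasure_shell m_def w_def d_def powr_realpow)
    have "shell_potential s n x = (\<integral>\<^sup>+y. indicator (shell n) y * riesz_kernel s x y \<partial>lborel)"
      by (simp add: shell_potential_def mult.commute)
    also have "\<dots> \<le> ennreal ((riesz_const TYPE('a) s + 1) * 1 powr (s / real DIM('a)) * m powr (1 - s / real DIM('a)))"
      by (intro nn_integral_riesz_kernel_bounded s m) (auto simp: em split: split_indicator)
    also have "(riesz_const TYPE('a) s + 1) * 1 powr (s / real DIM('a)) * m powr (1 - s / real DIM('a))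
       = C * ((2 * real n) powr - s * m)"
    proof -
      have "m powr (1 - s / d) = m * m powr - (s / d)"
        using m by (simp add: powr_diff powr_minus field_simps)
      also have "m powr - (s / d) = w powr - (s / d) * (2 powr s * (2 * real n) powr - s)"
        using w n d by (simp add: m_def powr_mult powr_powr powr_minus field_simps)
      finally show ?thesis by (simp add: C_def d_def mult_ac)
    qed
    also have "ennreal (C * ((2 * real n) powr - s * m)) = ennreal C * (ennreal ((2 * real n) powr - s) * emeasure lborel (shell n :: 'a set))"
      using C m by (simp add: em ennreal_mult)
    also have "\<dots> \<le> ennreal C * shell_potential s n (0::'a)"
      by (intro mult_left_mono shell_potential_0 s n) auto
    finally show ?thesis .
  qed
  with C show thesis by (rule that)
qed

text \<open>For fixed x both factors of the comparison tend to 1, because |x| / n tends to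
  0.\<close>

lemma tendsto_normalized_shell_potential:
  fixes x :: "'a::euclidean_space"
  assumes s: "0 < s"
  shows "(\<lambda>n. shell_potential s n x / shell_potential s n (0::'a)) \<longlonglongrightarrow> 1"
proof (rule tendsto_sandwich)
  have ev: "eventually (\<lambda>n. norm x < real n \<and> 1 \<le> n) sequentially"
    using filterlim_at_top_dense[THEN iffD1, OF filterlim_real_sequentially] eventually_ge_at_top[of 1]
    by (auto intro: eventually_conj)
  have div: "c * shell_potential s n (0::'a) / shell_potential s n (0::'a) = c" if "1 \<le> n" for n c
    using shell_potential_0_pos[OF s that, where 'a='a] shell_potential_0(2)[OF s that, where 'a='a] by (simp add: ennreal_mult_divide_eq)
  show "eventually (\<lambda>n. ennreal ((1 + norm x / real n) powr - s) \<le> shell_potential s n x / shell_potential s n (0::'a)) sequentially"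
    using ev
  proof eventually_elim
    case (elim n)
    with shell_potential_comparison(2)[OF s, of x n] div[of n "ennreal ((1 + norm x / real n) powr - s)"]
    show ?case by (metis divide_right_mono_ennreal)
  qed
  show "eventually (\<lambda>n. shell_potential s n x / shell_potential s n (0::'a) \<le> ennreal ((1 - norm x / real n) powr - s)) sequentially"
    using ev
  proof eventually_elim
    case (elim n)
    with shell_potential_comparison(1)[OF s, of x n] div[of n "ennreal ((1 - norm x / real n) powr - s)"]
    show ?case by (metis divide_right_mono_ennreal)
  qed
  have x0: "(\<lambda>n. norm x / real n) \<longlonglongrightarrow> 0"
    by (intro tendsto_divide_0[OF tendsto_const] filterlim_at_top_imp_at_infinity filterlim_real_sequentially)
  have "(\<lambda>n. (1 + norm x / real n) powr - s) \<longlonglongrightarrow> (1 + 0) powr - s"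
    by (intro tendsto_powr tendsto_add tendsto_const x0) simp
  then show "(\<lambda>n. ennreal ((1 + norm x / real n) powr - s)) \<longlonglongrightarrow> 1"
    using tendsto_ennrealI by fastforce
  have "(\<lambda>n. (1 - norm x / real n) powr - s) \<longlonglongrightarrow> (1 - 0) powr - s"
    by (intro tendsto_powr tendsto_diff tendsto_const x0) simp
  then show "(\<lambda>n. ennreal ((1 - norm x / real n) powr - s)) \<longlonglongrightarrow> 1"
    using tendsto_ennrealI by fastforce
qed


text \<open>
  In an optimal state every configuration with a free slot has at least the average number of
  particles: otherwise a small additional density at distance \<open>n\<close>, present only together with
  a configuration \<open>T\<close> below average, gains \<open>n powr - s\<close> times the deficit to first order, whereas
  its cost in \<open>power_mass\<close> is of higher order in the density.
\<close>

lemma optimal_gc_state_mass_le: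
  fixes X :: "nat \<Rightarrow> 'b \<Rightarrow> 'a::euclidean_space"
  assumes s: "0 < s" "s < real DIM('a)" and N: "1 \<le> N"
    and gc: "gc_state N M X S \<rho>" and fin: "power_mass s \<rho> < \<infinity>"
    and \<Lambda>: "Lambda TYPE('a) s N \<le> ereal l" and l: "0 \<le> l"
    and opt: "pair_cost s N M X S + ennreal (2 * l) * power_mass s \<rho> \<le> D s \<rho>"
    and Dfin: "D s \<rho> < \<infinity>"
    and T: "T \<subset> {..<N}" and pos: "0 < measure M {\<omega>\<in>space M. \<forall>i<N. \<omega> \<in> S i \<longleftrightarrow> i \<in> T}"
  shows "(\<integral>\<^sup>+x. ennreal (\<rho> x) \<partial>lborel) \<le> ennreal (real (card T))"
proof -
  interpret M: prob_space M using gc_stateD(1)[OF gc] .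
  define d where "d = real DIM('a)"
  define v where "v = unit_ball_vol d"
  have d: "d > 0" by (simp add: d_def)
  have v: "v > 0" by (simp add: v_def d_def)
  have [measurable]: "\<rho> \<in> borel_measurable borel" using gc_stateD(4)[OF gc] .
  have \<rho>0: "0 \<le> \<rho> x" for x using gc_stateD(5)[OF gc] .
  have Xm[measurable]: "X i \<in> borel_measurable M" "S i \<in> sets M" if "i < N" for i
    using gc_stateD(2,3)[OF gc that] by auto
  define E where "E = {\<omega>\<in>space M. \<forall>i<N. \<omega> \<in> S i \<longleftrightarrow> i \<in> T}"
  have Em[measurable]: "E \<in> sets M"
  proof -
    have "E = {\<omega>\<in>space M. \<forall>i\<in>{..<N}. \<omega> \<in> S i \<longleftrightarrow> i \<in> T}" by (auto simp: E_def)
    also have "\<dots> \<in> sets M" by (intro sets.sets_Collect_finite_All) (auto simp: Xm intro!: predE)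
    finally show ?thesis .
  qed
  define q where "q = measure M E"
  have q: "0 < q" "q \<le> 1" using pos by (auto simp: q_def E_def)
  have emE: "emeasure M E = ennreal q" by (simp add: q_def M.emeasure_eq_measure)
  obtain i0 where i0: "i0 < N" "i0 \<notin> T" using T by blast
  have finT: "finite T" "T \<subseteq> {..<N}" using T finite_subset by auto
  define p where "p n x = shell_potential s n x / shell_potential s n (0::'a)" for n and x :: 'a
  have pm[measurable]: "p n \<in> borel_measurable borel" for n unfolding p_def divide_ennreal_def by measurable
  \<comment> \<open>\<open>e1\<close> measures the power mass of the added density alone and
    \<open>e2\<close> its overlap with \<rho>, both relative to the potential created.
    \<open>e1\<close> vanishes for large k; \<open>e2\<close> grows with k but is multiplied by the
    mass of \<rho> in the shell, which vanishes for large n. So n tends to infinity first, and k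
    afterwards.\<close>
  define e1 where "e1 k = v powr - (s / d) * (2 / real k) powr s" for k :: nat
  define e2 where "e2 k = 2 * v powr - (s / d) * real k powr - s * real k powr d * 2 powr s" for k :: nat
  have main: "ennreal q * (\<integral>\<^sup>+x. ennreal (\<rho> x) * p n x \<partial>lborel) \<le>
      (\<Sum>i\<in>T. \<integral>\<^sup>+\<omega>\<in>E. p n (X i \<omega>) \<partial>M) + ennreal l * (ennreal (e1 k) + ennreal (e2 k) * (\<integral>\<^sup>+x\<in>shell n. ennreal (\<rho> x) \<partial>lborel))"
    if n: "1 \<le> n" and k: "2 \<le> k" for n k
  proof -
    \<comment> \<open>The auxiliary point is uniform in a ball of radius k n and hits the shell with
      probability of order k^-d. Thus k controls the dilution independently of the distance
      n.\<close>
    define R where "R = real k * real n"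
    have R: "R > 0" using n k by (simp add: R_def)
    define \<eta> where "\<eta> = 1 / (unit_ball_vol (real DIM('a)) * R ^ DIM('a))"
    have \<eta>: "\<eta> > 0" using R by (simp add: \<eta>_def)
    have \<eta>v: "\<eta> = 1 / (v * R powr d)"
      using R by (simp add: \<eta>_def v_def d_def powr_realpow)
    define A where "A = (shell n :: 'a set)"
    have A[measurable]: "A \<in> sets borel" and AR: "A \<subseteq> ball 0 R"
    proof -
      have "2 * real n \<le> R" using k n by (simp add: R_def)
      then show "A \<subseteq> ball 0 R" by (auto simp: A_def in_shell)
    qed (simp add: A_def)
    define J where "J = shell_potential s n (0::'a)"
    have J: "0 < J" "J < \<infinity>" using shell_potential_0_pos[OF s(1) n, where 'a='a] shell_potential_0(2)[OF s(1) n, where 'a='a]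
      by (auto simp: J_def)
    have Jp: "shell_potential s n x = J * p n x" for x
      using J ennreal_mult_divide_eq[of J "shell_potential s n x"]
      by (simp add: p_def J_def[symmetric] ennreal_times_divide mult.commute)
    obtain a where a: "J = ennreal a" "0 < a" using J by (cases J) auto
    define \<mu> where "\<mu> = v * (2 ^ DIM('a) - 1) * real n ^ DIM('a)"
    have \<mu>: "\<mu> > 0" unfolding \<mu>_def using v n by (intro mult_pos_pos) auto
    have emA: "emeasure lborel A = ennreal \<mu>"
      by (simp add: A_def emeasure_shell \<mu>_def v_def d_def)
    have a_ge: "(2 * real n) powr - s * \<mu> \<le> a"
      using shell_potential_0(1)[OF s(1) n, where 'a='a] a \<mu>
      by (simp add: J_def[symmetric] A_def[symmetric] emA flip: ennreal_mult)
    define E' where "E' i = (if i = i0 then E else {})" for i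
    define h where "h x = q * \<eta> * indicator A x" for x :: 'a
    define M' where "M' = M \<Otimes>\<^sub>M density lborel (\<lambda>y::'a. ennreal \<eta> * indicator (ball 0 R) y)"
    define X' where "X' = (\<lambda>i (\<omega>, y). if \<omega> \<in> S i then X i \<omega> else y + (0::'a))"
    define S' where "S' = (\<lambda>i. {(\<omega>, y). \<omega> \<in> S i \<or> \<omega> \<in> E' i \<and> y \<in> A})"
    define F where "F i j = (\<integral>\<^sup>+\<omega>. indicator (S i) \<omega> * indicator (E' j) \<omega> *
            (\<integral>\<^sup>+y. ennreal \<eta> * indicator A y * riesz_kernel s (X i \<omega>) (y + 0) \<partial>lborel) \<partial>M)" for i j
    have E'm: "E' i \<in> sets M" and E'd: "E' i \<inter> S i = {}" if "i < N" for i
      using i0 that Em by (auto simp: E'_def E_def)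
    have h_eq: "(\<Sum>i<N. measure M (E' i) * \<eta> * indicator A (x - 0)) = h x" for x
    proof -
      have "(\<Sum>i<N. measure M (E' i) * \<eta> * indicator A (x - 0)) = (\<Sum>i\<in>{i0}. measure M (E' i) * \<eta> * indicator A (x - 0))"
        using i0 by (intro sum.mono_neutral_right) (auto simp: E'_def)
      then show ?thesis by (simp add: h_def E'_def q_def)
    qed
    have add1: "gc_state N M' X' S' (\<lambda>x. \<rho> x + (\<Sum>i<N. measure M (E' i) * \<eta> * indicator A (x - 0)))"
      and add2: "pair_cost s N M' X' S' \<le> pair_cost s N M X S
       + 2 * (\<Sum>i<N. \<Sum>j<N. if i \<noteq> j then F i j else 0)
       + (\<Sum>i<N. \<Sum>j<N. if i \<noteq> j then emeasure M (E' i \<inter> E' j) * riesz_kernel s (0::'a) 0 else 0)"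
      unfolding M'_def X'_def S'_def F_def
      by (rule gc_state_add[OF gc E'm E'd A AR R \<eta>_def, where c = "\<lambda>_. 0"]; simp)+
    have gc': "gc_state N M' X' S' (\<lambda>x. \<rho> x + h x)" using add1 unfolding h_eq .
    have [measurable]: "h \<in> borel_measurable borel" unfolding h_def by measurable
    have h0: "0 \<le> h x" for x using q \<eta> by (simp add: h_def)
    define Q where "Q = (\<Sum>i\<in>T. \<integral>\<^sup>+\<omega>\<in>E. p n (X i \<omega>) \<partial>M)"
    have inner: "(\<integral>\<^sup>+y. ennreal \<eta> * indicator A y * riesz_kernel s x (y + 0) \<partial>lborel) = ennreal (\<eta> * a) * p n x" for x
    proof -
      have "(\<integral>\<^sup>+y. ennreal \<eta> * indicator A y * riesz_kernel s x (y + 0) \<partial>lborel)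
        = (\<integral>\<^sup>+y. ennreal \<eta> * (riesz_kernel s x y * indicator A y) \<partial>lborel)"
        by (intro nn_integral_cong) (simp add: mult_ac)
      also have "\<dots> = ennreal \<eta> * shell_potential s n x"
        unfolding shell_potential_def A_def by (intro nn_integral_cmult) measurable
      finally show ?thesis using a \<eta> by (simp add: Jp ennreal_mult mult.assoc)
    qed
    \<comment> \<open>Only j = i0 contributes. On \<open>E\<close> exactly the particles in
      \<open>T\<close> are present, so the new particle pays for these and not for the average
      density.\<close>
    have F: "(\<Sum>j<N. if i \<noteq> j then F i j else 0) \<le> ennreal (\<eta> * a) * (if i \<in> T then \<integral>\<^sup>+\<omega>\<in>E. p n (X i \<omega>) \<partial>M else 0)"
      if i: "i < N" for i
    proof -
      note [measurable] = Xm[OF i]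
      have "(\<Sum>j<N. if i \<noteq> j then F i j else 0) \<le> (\<Sum>j<N. if j = i0 then F i j else 0)"
        by (intro sum_mono) (auto simp: F_def E'_def)
      also have "\<dots> = F i i0" using i0 by (simp add: sum.delta)
      also have "F i i0 = (\<integral>\<^sup>+\<omega>. ennreal (\<eta> * a) * (if i \<in> T then p n (X i \<omega>) * indicator E \<omega> else 0) \<partial>M)"
        unfolding F_def inner using i by (intro nn_integral_cong) (auto simp: E'_def E_def indicator_def)
      also have "\<dots> = ennreal (\<eta> * a) * (if i \<in> T then \<integral>\<^sup>+\<omega>\<in>E. p n (X i \<omega>) \<partial>M else 0)"
        by (auto simp: nn_integral_cmult)
      finally show ?thesis .
    qed
    have "(\<Sum>i<N. \<Sum>j<N. if i \<noteq> j then F i j else 0) \<le>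
        (\<Sum>i<N. ennreal (\<eta> * a) * (if i \<in> T then \<integral>\<^sup>+\<omega>\<in>E. p n (X i \<omega>) \<partial>M else 0))"
      by (intro sum_mono F) auto
    also have "\<dots> = ennreal (\<eta> * a) * Q"
      unfolding Q_def sum_distrib_left[symmetric] using finT
      by (intro arg_cong2[where f="(*)"] refl) (simp add: sum.If_cases Int_absorb1)
    finally have FQ: "(\<Sum>i<N. \<Sum>j<N. if i \<noteq> j then F i j else 0) \<le> ennreal (\<eta> * a) * Q" .
    \<comment> \<open>All translations are 0, so the kernel is infinite here. The sum vanishes
      because two different slots are never filled together and 0 times \<infinity> is 0.\<close>
    have "(\<Sum>i<N. \<Sum>j<N. if i \<noteq> j then emeasure M (E' i \<inter> E' j) * riesz_kernel s (0::'a) 0 else 0) = 0"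
      by (intro sum.neutral ballI) (auto simp: E'_def)
    then have pc: "pair_cost s N M' X' S' \<le> pair_cost s N M X S + 2 * (ennreal (\<eta> * a) * Q)"
      using order_trans[OF add2 add_mono[OF add_mono[OF order_refl mult_left_mono[OF FQ]] order_refl]] by simp
    define I where "I = interaction (riesz_kernel s) \<rho> h"
    \<comment> \<open>In contrast to the cost, the energy pairs the added density with the averaged
      density \<rho>. The probability \<open>q\<close> of \<open>E\<close> enters only as a
      weight.\<close>
    have Iq: "I = ennreal (\<eta> * a) * (ennreal q * (\<integral>\<^sup>+x. ennreal (\<rho> x) * p n x \<partial>lborel))"
    proof -
      have "I = (\<integral>\<^sup>+x. ennreal (\<rho> x) * (\<integral>\<^sup>+y. ennreal (h y) * riesz_kernel s x y \<partial>lborel) \<partial>lborel)"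
        unfolding I_def by (rule interaction_inner) measurable
      also have "\<dots> = (\<integral>\<^sup>+x. ennreal (\<eta> * a) * (ennreal q * (ennreal (\<rho> x) * p n x)) \<partial>lborel)"
      proof (intro nn_integral_cong)
        fix x
        have "(\<integral>\<^sup>+y. ennreal (h y) * riesz_kernel s x y \<partial>lborel) =
            (\<integral>\<^sup>+y. ennreal q * (ennreal \<eta> * indicator A y * riesz_kernel s x (y + 0)) \<partial>lborel)"
          using q \<eta> by (intro nn_integral_cong) (auto simp: h_def ennreal_mult mult.assoc split: split_indicator)
        also have "\<dots> = ennreal q * (ennreal (\<eta> * a) * p n x)"
          unfolding inner[symmetric] by (intro nn_integral_cmult) measurable
        finally show "ennreal (\<rho> x) * (\<integral>\<^sup>+y. ennreal (h y) * riesz_kernel s x y \<partial>lborel) =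
            ennreal (\<eta> * a) * (ennreal q * (ennreal (\<rho> x) * p n x))"
          by (simp add: mult_ac)
      qed
      also have "\<dots> = ennreal (\<eta> * a) * (ennreal q * (\<integral>\<^sup>+x. ennreal (\<rho> x) * p n x \<partial>lborel))"
        by (simp add: nn_integral_cmult)
      finally show ?thesis .
    qed
    define B where "B = ennreal (e1 k) + ennreal (e2 k) * (\<integral>\<^sup>+x\<in>shell n. ennreal (\<rho> x) \<partial>lborel)"
    define H where "H = power_mass s h + 2 * (\<integral>\<^sup>+x. ennreal (\<rho> x) * ennreal (h x powr (s / d)) \<partial>lborel)"
    have \<eta>s: "\<eta> powr (s / d) = v powr - (s / d) * R powr - s"
      using R v d by (simp add: \<eta>v powr_divide powr_mult powr_powr powr_minus field_simps)
    \<comment> \<open>The increase of the power mass is expressed in units of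
      \<open>\<eta> * a\<close>, the potential at the origin of a density \<eta> on the shell. The
      same factor occurs in the gain and in the cost and can then be cancelled.\<close>
    have HB: "H \<le> ennreal (\<eta> * a) * B"
    proof -
      have pw: "(q * \<eta>) powr t \<le> \<eta> powr t" if "0 \<le> t" for t
        using that q \<eta> by (intro powr_mono2) auto
      have "power_mass s h = (\<integral>\<^sup>+x. ennreal ((q * \<eta>) powr (1 + s / d)) * indicator A x \<partial>lborel)"
        unfolding power_mass_def d_def by (intro nn_integral_cong) (auto simp: h_def indicator_def)
      also have "\<dots> = ennreal ((q * \<eta>) powr (1 + s / d) * \<mu>)"
        using \<mu> by (simp add: nn_integral_cmult_indicator emA ennreal_mult)
      also have "\<dots> \<le> ennreal (\<eta> * a * e1 k)"
      proof (intro ennreal_leI)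
        have "(q * \<eta>) powr (1 + s / d) * \<mu> \<le> \<eta> powr (1 + s / d) * \<mu>"
          using \<mu> s d by (intro mult_right_mono pw) auto
        also have "\<dots> = \<eta> * (v powr - (s / d) * R powr - s) * (2 * real n) powr s * ((2 * real n) powr - s * \<mu>)"
          using \<eta> n by (simp add: powr_add \<eta>s powr_minus)
        also have "\<dots> \<le> \<eta> * (v powr - (s / d) * R powr - s) * (2 * real n) powr s * a"
          using \<eta> by (intro mult_left_mono a_ge) auto
        also have "\<dots> = \<eta> * a * e1 k"
          using n k by (simp add: e1_def R_def powr_mult powr_divide powr_minus field_simps)
        finally show "(q * \<eta>) powr (1 + s / d) * \<mu> \<le> \<eta> * a * e1 k" .
      qed
      finally have H1: "power_mass s h \<le> ennreal (\<eta> * a) * ennreal (e1 k)"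
        using \<eta> a by (simp add: ennreal_mult e1_def)
      have "2 * (\<integral>\<^sup>+x. ennreal (\<rho> x) * ennreal (h x powr (s / d)) \<partial>lborel) =
          2 * (\<integral>\<^sup>+x. ennreal ((q * \<eta>) powr (s / d)) * (ennreal (\<rho> x) * indicator A x) \<partial>lborel)"
        by (rule arg_cong[of _ _ "(*) 2"], rule nn_integral_cong) (auto simp: h_def indicator_def mult.commute)
      also have "\<dots> = ennreal (2 * (q * \<eta>) powr (s / d)) * (\<integral>\<^sup>+x\<in>A. ennreal (\<rho> x) \<partial>lborel)"
        by (subst nn_integral_cmult) (auto simp: ennreal_mult mult.assoc)
      also have "\<dots> \<le> ennreal (\<eta> * a * e2 k) * (\<integral>\<^sup>+x\<in>A. ennreal (\<rho> x) \<partial>lborel)"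
      proof (intro mult_right_mono ennreal_leI)
        have \<mu>_ge: "v * real n powr d \<le> \<mu>"
        proof -
          have "(2::real) \<le> 2 ^ DIM('a)" using power_increasing[of 1 "DIM('a)" "2::real"] by simp
          then have "v * 1 * real n ^ DIM('a) \<le> \<mu>"
            unfolding \<mu>_def using v by (intro mult_right_mono mult_left_mono) auto
          then show ?thesis using n by (simp add: d_def powr_realpow)
        qed
        have "2 * (q * \<eta>) powr (s / d) \<le> 2 * \<eta> powr (s / d)"
          using s d by (intro mult_left_mono pw) auto
        also have "\<dots> = (\<eta> * ((2 * real n) powr - s * (v * real n powr d))) * e2 k"
          unfolding \<eta>s unfolding \<eta>v using n k v
          by (simp add: e2_def R_def powr_mult powr_minus field_simps)
        also have "\<dots> \<le> (\<eta> * ((2 * real n) powr - s * \<mu>)) * e2 k"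
          using \<eta> by (intro mult_right_mono mult_left_mono \<mu>_ge) (auto simp: e2_def)
        also have "\<dots> \<le> \<eta> * a * e2 k"
          using \<eta> by (intro mult_right_mono mult_left_mono a_ge) (auto simp: e2_def)
        finally show "2 * (q * \<eta>) powr (s / d) \<le> \<eta> * a * e2 k" .
      qed auto
      also have "\<dots> = ennreal (\<eta> * a) * (ennreal (e2 k) * (\<integral>\<^sup>+x\<in>A. ennreal (\<rho> x) \<partial>lborel))"
        using \<eta> a by (subst ennreal_mult) (auto simp: e2_def mult.assoc)
      finally show ?thesis
        unfolding H_def B_def distrib_left using H1 by (auto simp: A_def intro: add_mono)
    qed
    have rho_int: "(\<integral>\<^sup>+x\<in>shell n. ennreal (\<rho> x) \<partial>lborel) < \<infinity>"
    proof -
      have "(\<integral>\<^sup>+x\<in>shell n. ennreal (\<rho> x) \<partial>lborel) \<le> (\<integral>\<^sup>+x. ennreal (\<rho> x) \<partial>lborel)"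
        by (intro nn_integral_mono) (auto simp: indicator_def)
      also have "\<dots> \<le> ennreal (real N)" by (rule gc_state_mass_le[OF gc])
      finally show ?thesis by (simp add: le_less_trans)
    qed
    then have Hfin: "H < \<infinity>"
      by (intro le_less_trans[OF HB]) (auto simp: B_def ennreal_mult_less_top)
    have pmh: "power_mass s (\<lambda>x. \<rho> x + h x) \<le> power_mass s \<rho> + H"
      unfolding H_def d_def add.assoc[symmetric] using \<rho>0 h0 by (intro power_mass_add_le s) auto
    \<comment> \<open>The self-energy of the added density is nonnegative and dropped. The bound for
      the enlarged state and the optimality of the old one follow, after which the finite
      \<open>D s \<rho>\<close> cancels.\<close>
    have "D s \<rho> + 2 * I \<le> D s (\<lambda>x. \<rho> x + h x)"
      unfolding D_eq_interaction I_def
      by (subst interaction_add_square) (auto simp: \<rho>0 h0 riesz_kernel_commute)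
    also have "\<dots> \<le> pair_cost s N M' X' S' + ennreal (2 * l) * power_mass s (\<lambda>x. \<rho> x + h x)"
      using pmh fin Hfin
      by (intro gc_bound[OF s N gc' _ \<Lambda> l]) (auto simp: less_top[symmetric] top_unique)
    also have "\<dots> \<le> (pair_cost s N M X S + 2 * (ennreal (\<eta> * a) * Q)) + ennreal (2 * l) * (power_mass s \<rho> + H)"
      by (intro add_mono mult_left_mono pc pmh) auto
    also have "\<dots> = (pair_cost s N M X S + ennreal (2 * l) * power_mass s \<rho>) + (2 * (ennreal (\<eta> * a) * Q) + ennreal (2 * l) * H)"
      by (simp add: distrib_left add_ac)
    also have "\<dots> \<le> D s \<rho> + (2 * (ennreal (\<eta> * a) * Q) + ennreal (2 * l) * H)"
      by (intro add_right_mono opt)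
    also have "2 * (ennreal (\<eta> * a) * Q) + ennreal (2 * l) * H = 2 * (ennreal (\<eta> * a) * Q + ennreal l * H)"
      using l by (simp add: ennreal_mult distrib_left mult.assoc)
    finally have "2 * I \<le> 2 * (ennreal (\<eta> * a) * Q + ennreal l * H)"
      using Dfin by (auto simp: ennreal_add_left_cancel_le)
    then have "I \<le> ennreal (\<eta> * a) * Q + ennreal l * H"
      by (subst (asm) ennreal_mult_le_mult_iff) auto
    also have "\<dots> \<le> ennreal (\<eta> * a) * Q + ennreal l * (ennreal (\<eta> * a) * B)"
      by (intro add_mono mult_left_mono HB order_refl) auto
    also have "\<dots> = ennreal (\<eta> * a) * (Q + ennreal l * B)"
      by (simp add: distrib_left mult_ac)
    finally have "ennreal (\<eta> * a) * (ennreal q * (\<integral>\<^sup>+x. ennreal (\<rho> x) * p n x \<partial>lborel)) \<le> ennreal (\<eta> * a) * (Q + ennreal l * B)"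
      unfolding Iq .
    then have "ennreal q * (\<integral>\<^sup>+x. ennreal (\<rho> x) * p n x \<partial>lborel) \<le> Q + ennreal l * B"
      using \<eta> a by (subst (asm) ennreal_mult_le_mult_iff) auto
    then show ?thesis unfolding Q_def B_def .
  qed
  obtain C where C: "0 < C" "\<And>n (x::'a). 1 \<le> n \<Longrightarrow> shell_potential s n x \<le> ennreal C * shell_potential s n (0::'a)"
    using shell_potential_le[OF s] by blast
  have pC: "p n x \<le> ennreal C" if "1 \<le> n" for n x
  proof -
    have "p n x \<le> ennreal C * shell_potential s n (0::'a) / shell_potential s n (0::'a)"
      unfolding p_def by (intro divide_right_mono_ennreal C that)
    then show ?thesis
      using shell_potential_0_pos[OF s(1) that, where 'a='a] shell_potential_0(2)[OF s(1) that, where 'a='a]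
      by (simp add: ennreal_mult_divide_eq)
  qed
  have p1: "(\<lambda>n. p (Suc n) x) \<longlonglongrightarrow> 1" for x
    unfolding p_def by (rule LIMSEQ_Suc[OF tendsto_normalized_shell_potential[OF s(1)]])
  have mass: "(\<integral>\<^sup>+x. ennreal (\<rho> x) \<partial>lborel) < \<infinity>"
    using gc_state_mass_le[OF gc] by (simp add: le_less_trans)
  have lim1: "(\<lambda>n. \<integral>\<^sup>+x. ennreal (\<rho> x) * p (Suc n) x \<partial>lborel) \<longlonglongrightarrow> (\<integral>\<^sup>+x. ennreal (\<rho> x) \<partial>lborel)"
  proof (rule nn_integral_dominated_convergence[where w = "\<lambda>x. ennreal (\<rho> x) * ennreal C"])
    show "(\<integral>\<^sup>+x. ennreal (\<rho> x) * ennreal C \<partial>lborel) < \<infinity>"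
      using mass by (simp add: nn_integral_multc ennreal_mult_less_top)
    have "(\<lambda>n. ennreal (\<rho> x) * p (Suc n) x) \<longlonglongrightarrow> ennreal (\<rho> x) * 1" for x
      by (intro ennreal_tendsto_cmult p1) auto
    then show "AE x in lborel. (\<lambda>n. ennreal (\<rho> x) * p (Suc n) x) \<longlonglongrightarrow> ennreal (\<rho> x)" by simp
    show "AE x in lborel. ennreal (\<rho> x) * p (Suc n) x \<le> ennreal (\<rho> x) * ennreal C" for n
      by (intro AE_I2 mult_left_mono pC) auto
  qed measurable
  have lim2: "(\<lambda>n. \<integral>\<^sup>+\<omega>\<in>E. p (Suc n) (X i \<omega>) \<partial>M) \<longlonglongrightarrow> ennreal q" if "i \<in> T" for i
  proof -
    have [measurable]: "X i \<in> borel_measurable M" using that finT Xm by auto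
    have "(\<lambda>n. \<integral>\<^sup>+\<omega>\<in>E. p (Suc n) (X i \<omega>) \<partial>M) \<longlonglongrightarrow> (\<integral>\<^sup>+\<omega>. 1 * indicator E \<omega> \<partial>M)"
    proof (rule nn_integral_dominated_convergence[where w = "\<lambda>\<omega>. ennreal C"])
      show "(\<integral>\<^sup>+\<omega>. ennreal C \<partial>M) < \<infinity>" by (simp add: M.emeasure_space_1)
      show "AE \<omega> in M. (\<lambda>n. p (Suc n) (X i \<omega>) * indicator E \<omega>) \<longlonglongrightarrow> 1 * indicator E \<omega>"
        using p1 by (auto simp: indicator_def)
      show "AE \<omega> in M. p (Suc n) (X i \<omega>) * indicator E \<omega> \<le> ennreal C" for n
        using pC by (auto simp: indicator_def)
    qed measurable
    then show ?thesis by (simp add: emE)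
  qed
  have lim3: "(\<lambda>n. \<integral>\<^sup>+x\<in>shell (Suc n). ennreal (\<rho> x) \<partial>lborel) \<longlonglongrightarrow> 0"
  proof -
    have "(\<lambda>n. \<integral>\<^sup>+x\<in>shell (Suc n). ennreal (\<rho> x) \<partial>lborel) \<longlonglongrightarrow> (\<integral>\<^sup>+x. 0 \<partial>(lborel :: 'a measure))"
    proof (rule nn_integral_dominated_convergence[where w = "\<lambda>x. ennreal (\<rho> x)"])
      have "(\<lambda>n. ennreal (\<rho> x) * indicator (shell (Suc n)) x) \<longlonglongrightarrow> 0" for x
      proof (rule tendsto_eventually)
        have "eventually (\<lambda>n. norm x < real n) sequentially"
          using filterlim_at_top_dense[THEN iffD1, OF filterlim_real_sequentially] by blast
        then show "eventually (\<lambda>n. ennreal (\<rho> x) * indicator (shell (Suc n)) x = 0) sequentially"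
          by eventually_elim (auto simp: indicator_def in_shell)
      qed
      then show "AE x in lborel. (\<lambda>n. ennreal (\<rho> x) * indicator (shell (Suc n)) x) \<longlonglongrightarrow> 0" by simp
    qed (use mass in \<open>auto simp: indicator_def\<close>)
    then show ?thesis by simp
  qed
  have k: "ennreal q * (\<integral>\<^sup>+x. ennreal (\<rho> x) \<partial>lborel) \<le> ennreal (real (card T)) * ennreal q + ennreal (l * e1 (Suc k))"
    if "1 \<le> k" for k
  proof (rule LIMSEQ_le)
    show "(\<lambda>n. ennreal q * (\<integral>\<^sup>+x. ennreal (\<rho> x) * p (Suc n) x \<partial>lborel)) \<longlonglongrightarrow> ennreal q * (\<integral>\<^sup>+x. ennreal (\<rho> x) \<partial>lborel)"
      by (intro ennreal_tendsto_cmult lim1) auto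
    have "(\<lambda>n. (\<Sum>i\<in>T. \<integral>\<^sup>+\<omega>\<in>E. p (Suc n) (X i \<omega>) \<partial>M) + ennreal l * (ennreal (e1 (Suc k)) + ennreal (e2 (Suc k)) * (\<integral>\<^sup>+x\<in>shell (Suc n). ennreal (\<rho> x) \<partial>lborel)))
        \<longlonglongrightarrow> (\<Sum>i\<in>T. ennreal q) + ennreal l * (ennreal (e1 (Suc k)) + ennreal (e2 (Suc k)) * 0)"
      by (intro tendsto_add tendsto_sum ennreal_tendsto_cmult lim2 lim3 tendsto_const) auto
    then show "(\<lambda>n. (\<Sum>i\<in>T. \<integral>\<^sup>+\<omega>\<in>E. p (Suc n) (X i \<omega>) \<partial>M) + ennreal l * (ennreal (e1 (Suc k)) + ennreal (e2 (Suc k)) * (\<integral>\<^sup>+x\<in>shell (Suc n). ennreal (\<rho> x) \<partial>lborel)))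
        \<longlonglongrightarrow> ennreal (real (card T)) * ennreal q + ennreal (l * e1 (Suc k))"
      using l by (simp add: ennreal_mult e1_def ennreal_of_nat_eq_real_of_nat)
    show "\<exists>N. \<forall>n\<ge>N. ennreal q * (\<integral>\<^sup>+x. ennreal (\<rho> x) * p (Suc n) x \<partial>lborel)
        \<le> (\<Sum>i\<in>T. \<integral>\<^sup>+\<omega>\<in>E. p (Suc n) (X i \<omega>) \<partial>M) + ennreal l * (ennreal (e1 (Suc k)) + ennreal (e2 (Suc k)) * (\<integral>\<^sup>+x\<in>shell (Suc n). ennreal (\<rho> x) \<partial>lborel))"
      using that by (intro exI[of _ 0] allI impI main) auto
  qed
  have "(\<lambda>k. l * e1 (Suc k)) \<longlonglongrightarrow> 0"
  proof -
    have "e1 \<longlonglongrightarrow> v powr - (s / d) * 0"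
      unfolding e1_def
    proof (intro tendsto_mult_left)
      have "(\<lambda>k. 2 / real k) \<longlonglongrightarrow> 0"
        by (intro tendsto_divide_0[OF tendsto_const] filterlim_at_top_imp_at_infinity filterlim_real_sequentially)
      then have "(\<lambda>k. (2 / real k) powr s) \<longlonglongrightarrow> 0 powr s"
        using s by (intro tendsto_powr') auto
      then show "(\<lambda>k. (2 / real k) powr s) \<longlonglongrightarrow> 0" by simp
    qed
    then have "(\<lambda>k. l * e1 (Suc k)) \<longlonglongrightarrow> l * 0"
      by (intro tendsto_mult_left LIMSEQ_Suc) simp
    then show ?thesis by simp
  qed
  with k have "ennreal q * (\<integral>\<^sup>+x. ennreal (\<rho> x) \<partial>lborel) \<le> ennreal (real (card T)) * ennreal q"
    by (rule ennreal_le_add_vanishing)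
  then show ?thesis
    using q by (simp add: mult.commute[of _ "ennreal q"] ennreal_mult_le_mult_iff)
qed

subsection \<open>Compactness\<close>

definition cantor_code :: "(nat \<Rightarrow> bool) \<Rightarrow> real" where
  "cantor_code b = (\<Sum>j. 2 * of_bool (b j) / 3 ^ Suc j)"

text \<open>Deletes the leading ternary digit of a code. The threshold 1/2 lies in the middle third,
  which contains no codes, so the map is continuous near every code.\<close>

definition cantor_shift :: "real \<Rightarrow> real" where
  "cantor_shift t = 3 * t - 2 * of_bool (1 / 2 \<le> t)"

definition cantor_digit :: "nat \<Rightarrow> real \<Rightarrow> bool" where
  "cantor_digit j t \<longleftrightarrow> 1 / 2 \<le> (cantor_shift ^^ j) t"

lemma geometric_sums_thirds: "(\<lambda>j. 2 / 3 ^ Suc j :: real) sums 1"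
  using sums_mult[OF geometric_sums[of "1 / 3 :: real"], of "2 / 3"] by (simp add: power_divide)

lemma cantor_code_summable: "summable (\<lambda>j. 2 * of_bool (b j) / 3 ^ Suc j :: real)"
  by (rule summable_comparison_test'[OF sums_summable[OF geometric_sums_thirds], of 0]) auto

lemma cantor_code_bounds: "0 \<le> cantor_code b" "cantor_code b \<le> 1"
proof -
  show "0 \<le> cantor_code b"
    unfolding cantor_code_def by (intro suminf_nonneg cantor_code_summable) auto
  have "cantor_code b \<le> (\<Sum>j. 2 / 3 ^ Suc j)"
    unfolding cantor_code_def
    by (intro suminf_le cantor_code_summable sums_summable[OF geometric_sums_thirds]) auto
  then show "cantor_code b \<le> 1"
    using sums_unique[OF geometric_sums_thirds] by simp
qed

lemma cantor_code_unfold: "cantor_code b = (2 * of_bool (b 0) + cantor_code (\<lambda>j. b (Suc j))) / 3"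
proof -
  have "cantor_code b = (\<Sum>j. 2 * of_bool (b (Suc j)) / 3 ^ Suc (Suc j)) + 2 * of_bool (b 0) / 3"
    using suminf_split_head[OF cantor_code_summable[of b]] by (simp add: cantor_code_def)
  also have "(\<Sum>j. 2 * of_bool (b (Suc j)) / 3 ^ Suc (Suc j) :: real) = (\<Sum>j. (1 / 3) * (2 * of_bool (b (Suc j)) / 3 ^ Suc j))"
    by (intro suminf_cong) simp
  also have "\<dots> = (1 / 3) * cantor_code (\<lambda>j. b (Suc j))"
    unfolding cantor_code_def by (rule suminf_mult[OF cantor_code_summable])
  finally show ?thesis by (simp add: field_simps)
qed

text \<open>A code lies in the left or in the right third according to its first bit. This gap is
  the reason for the ternary digits 0 and 2: nearby codes share their leading bits, which fails for
  binary expansions.\<close>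

lemma cantor_code_head: "b 0 \<longleftrightarrow> 1 / 2 \<le> cantor_code b" "\<bar>cantor_code b - 1 / 2\<bar> \<ge> 1 / 6"
  using cantor_code_unfold[of b] cantor_code_bounds[of "\<lambda>j. b (Suc j)"]
  by (cases "b 0"; simp; linarith)+

lemma cantor_shift_code: "cantor_shift (cantor_code b) = cantor_code (\<lambda>j. b (Suc j))"
  using cantor_code_unfold[of b] cantor_code_head(1)[of b] by (auto simp: cantor_shift_def)

lemma cantor_digit_code: "cantor_digit j (cantor_code b) = b j"
proof -
  have "(cantor_shift ^^ j) (cantor_code b) = cantor_code (\<lambda>k. b (k + j))"
    by (induction j arbitrary: b) (simp_all add: cantor_shift_code funpow_swap1)
  then show ?thesis
    using cantor_code_head(1)[of "\<lambda>k. b (k + j)"] by (simp add: cantor_digit_def)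
qed

text \<open>Convergent codes are eventually closer to the limit than the gap of 1/6 around 1/2, so
  the first bit settles on the side of the limit. Removing it leaves a convergent sequence of
  shifted codes, to which induction applies. The limit is not assumed to be a code.\<close>

lemma cantor_code_tendsto:
  assumes "(\<lambda>n. cantor_code (b n)) \<longlonglongrightarrow> t"
  shows "\<exists>v. eventually (\<lambda>n. b n j = v) sequentially"
  using assms
proof (induction j arbitrary: b t)
  case 0
  have "eventually (\<lambda>n. \<bar>cantor_code (b n) - t\<bar> < 1 / 6) sequentially"
    using tendstoD[OF 0, of "1 / 6"] by (simp add: dist_real_def)
  then have "eventually (\<lambda>n. b n 0 = (1 / 2 \<le> t)) sequentially"
  proof eventually_elim
    case (elim n)
    then show ?case using cantor_code_head[of "b n"] by linarith
  qed
  then show ?case by blast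
next
  case (Suc j)
  have "eventually (\<lambda>n. \<bar>cantor_code (b n) - t\<bar> < 1 / 6) sequentially"
    using tendstoD[OF Suc.prems, of "1 / 6"] by (simp add: dist_real_def)
  then have "eventually (\<lambda>n. 3 * cantor_code (b n) - 2 * of_bool (1 / 2 \<le> t) = cantor_code (\<lambda>j. b n (Suc j))) sequentially"
  proof eventually_elim
    case (elim n)
    then have "1 / 2 \<le> t \<longleftrightarrow> 1 / 2 \<le> cantor_code (b n)"
      using cantor_code_head(2)[of "b n"] by linarith
    then show ?case using cantor_shift_code[of "b n"] by (simp add: cantor_shift_def)
  qed
  moreover have "(\<lambda>n. 3 * cantor_code (b n) - 2 * of_bool (1 / 2 \<le> t)) \<longlonglongrightarrow> 3 * t - 2 * of_bool (1 / 2 \<le> t)"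
    by (intro tendsto_intros Suc.prems)
  ultimately have "(\<lambda>n. cantor_code (\<lambda>j. b n (Suc j))) \<longlonglongrightarrow> 3 * t - 2 * of_bool (1 / 2 \<le> t)"
    by (rule Lim_transform_eventually[rotated])
  then show ?case using Suc.IH[of "\<lambda>n j. b n (Suc j)"] by simp
qed

lemma cantor_shift_measurable [measurable]: "cantor_shift \<in> borel_measurable borel"
  unfolding cantor_shift_def[abs_def] of_bool_def by measurable

lemma cantor_digit_measurable [measurable]: "Measurable.pred borel (cantor_digit j)"
proof -
  have [measurable]: "(cantor_shift ^^ j) \<in> borel_measurable borel"
  proof (induction j)
    case (Suc j)
    show ?case unfolding funpow.simps by (rule measurable_comp[OF Suc]) measurable
  qed (simp add: id_def)
  show ?thesis unfolding cantor_digit_def[abs_def] by measurable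
qed

text \<open>If the sequence is eventually above all rationals, or eventually below all of them, it
  diverges. Otherwise it converges to the infimum of the rationals that it eventually stays
  below.\<close>

lemma real_sequence_cuts:
  fixes y :: "nat \<Rightarrow> real"
  assumes "\<And>q::rat. \<exists>v. eventually (\<lambda>n. (y n < of_rat q) = v) sequentially"
  shows "convergent y \<or> filterlim (\<lambda>n. \<bar>y n\<bar>) at_top sequentially"
proof -
  have cut: "eventually (\<lambda>n. y n < of_rat q) sequentially \<or> eventually (\<lambda>n. of_rat q \<le> y n) sequentially" for q :: rat
    using assms[of q] by (metis (mono_tags, lifting) eventually_mono not_le)
  consider "\<And>q::rat. eventually (\<lambda>n. of_rat q \<le> y n) sequentially"
    | "\<And>q::rat. eventually (\<lambda>n. y n < of_rat q) sequentially"
    | q1 q2 :: rat where "eventually (\<lambda>n. of_rat q1 \<le> y n) sequentially" "eventually (\<lambda>n. y n < of_rat q2) sequentially"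
    using cut by blast
  then show ?thesis
  proof cases
    case 1
    have "eventually (\<lambda>n. Z \<le> \<bar>y n\<bar>) sequentially" for Z :: real
    proof -
      obtain q :: rat where "Z < of_rat q" using of_rat_dense[of Z "Z + 1"] by auto
      then show ?thesis using 1[of q] by (auto elim: eventually_mono)
    qed
    then show ?thesis by (simp add: filterlim_at_top)
  next
    case 2
    have "eventually (\<lambda>n. Z \<le> \<bar>y n\<bar>) sequentially" for Z :: real
    proof -
      obtain q :: rat where "of_rat q < - Z" using of_rat_dense[of "- Z - 1" "- Z"] by auto
      then show ?thesis using 2[of q] by (auto elim: eventually_mono)
    qed
    then show ?thesis by (simp add: filterlim_at_top)
  next
    case (3 q1 q2)
    define A where "A = {of_rat q :: real | q. eventually (\<lambda>n. y n < of_rat q) sequentially}"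
    have "of_rat q2 \<in> A" using 3 by (auto simp: A_def)
    have lower: "of_rat q \<le> a" if "eventually (\<lambda>n. of_rat q \<le> y n) sequentially" "a \<in> A" for q a
    proof -
      from that(2) obtain q' where "a = of_rat q'" "eventually (\<lambda>n. y n < of_rat q') sequentially"
        unfolding A_def by blast
      with that(1) have "eventually (\<lambda>n. of_rat q \<le> y n \<and> y n < a) sequentially"
        by (auto intro: eventually_conj)
      then obtain n where "of_rat q \<le> y n" "y n < a" by (auto simp: eventually_sequentially)
      then show ?thesis by simp
    qed
    have bdd: "bdd_below A" by (rule bdd_belowI) (rule lower[OF 3(1)])
    have "y \<longlonglongrightarrow> Inf A"
    proof (rule order_tendstoI)
      fix z assume "z < Inf A"
      then obtain q :: rat where q: "z < of_rat q" "of_rat q < Inf A" using of_rat_dense by blast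
      then have "of_rat q \<notin> A" using cInf_lower[OF _ bdd, of "of_rat q"] by auto
      then have "eventually (\<lambda>n. of_rat q \<le> y n) sequentially" using cut[of q] by (auto simp: A_def)
      then show "eventually (\<lambda>n. z < y n) sequentially" using q by (auto elim: eventually_mono)
    next
      fix z assume "Inf A < z"
      then obtain a where "a \<in> A" "a < z" using cInf_less_iff[OF _ bdd, of z] \<open>of_rat q2 \<in> A\<close> by auto
      then show "eventually (\<lambda>n. y n < z) sequentially" by (auto simp: A_def elim: eventually_mono)
    qed
    then show ?thesis by (auto simp: convergent_def)
  qed
qed

text \<open>A coordinate that does not converge diverges in absolute value, and the norm dominates
  it. So a single bad coordinate already means escape to infinity.\<close>

lemma vector_sequence_cuts:
  fixes y :: "nat \<Rightarrow> 'a::euclidean_space"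
  assumes "\<And>q::rat. \<And>b. b \<in> Basis \<Longrightarrow> \<exists>v. eventually (\<lambda>n. (y n \<bullet> b < of_rat q) = v) sequentially"
  shows "convergent y \<or> filterlim (\<lambda>n. norm (y n)) at_top sequentially"
proof (cases "\<forall>b\<in>Basis. convergent (\<lambda>n. y n \<bullet> b)")
  case True
  then have "\<forall>b\<in>Basis. (\<lambda>n. y n \<bullet> b) \<longlonglongrightarrow> lim (\<lambda>n. y n \<bullet> b)"
    by (simp add: convergent_LIMSEQ_iff)
  then have "(\<lambda>n. \<Sum>b\<in>Basis. (y n \<bullet> b) *\<^sub>R b) \<longlonglongrightarrow> (\<Sum>b\<in>Basis. lim (\<lambda>n. y n \<bullet> b) *\<^sub>R b)"
    by (intro tendsto_sum tendsto_scaleR tendsto_const) auto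
  then show ?thesis by (auto simp: euclidean_representation convergent_def)
next
  case False
  then obtain b where b: "b \<in> Basis" "\<not> convergent (\<lambda>n. y n \<bullet> b)" by blast
  then have "filterlim (\<lambda>n. \<bar>y n \<bullet> b\<bar>) at_top sequentially"
    using real_sequence_cuts[of "\<lambda>n. y n \<bullet> b"] assms by blast
  then have "filterlim (\<lambda>n. norm (y n)) at_top sequentially"
    by (rule filterlim_at_top_mono) (auto intro!: always_eventually Basis_le_norm b)
  then show ?thesis ..
qed

section \<open>Coding of configurations by rational cuts\<close>

definition config_bit :: "nat \<Rightarrow> nat \<Rightarrow> (nat \<Rightarrow> 'a::euclidean_space) \<Rightarrow> bool" where
  "config_bit N j x = (case from_nat j of (q::rat, i::nat, k::nat) \<Rightarrow>
     i < N \<and> x i \<bullet> from_nat_into Basis k < of_rat q)"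

definition config_code :: "nat \<Rightarrow> (nat \<Rightarrow> 'a::euclidean_space) \<Rightarrow> real" where
  "config_code N x = cantor_code (\<lambda>j. config_bit N j x)"

text \<open>Left inverse of the encoding: a coordinate is the infimum of the rationals above it. The
  infimum is formed in \<open>ereal\<close>, so that the map is defined and measurable on all reals,
  including those that encode no configuration.\<close>

definition config_decode :: "nat \<Rightarrow> real \<Rightarrow> (nat \<Rightarrow> 'a::euclidean_space)" where
  "config_decode N t = (\<lambda>i\<in>{..<N}. \<Sum>b\<in>Basis. real_of_ereal
     (INF q::rat. if cantor_digit (to_nat (q, i, to_nat_on (Basis :: 'a set) b)) t then ereal (of_rat q) else \<infinity>) *\<^sub>R b)"

lemma config_bit_basis:
  assumes "b \<in> Basis" "i < N"
  shows "config_bit N (to_nat (q::rat, i, to_nat_on (Basis :: 'a set) b)) x \<longleftrightarrow> x i \<bullet> (b::'a::euclidean_space) < of_rat q"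
  using assms by (simp add: config_bit_def countable_finite from_nat_into_to_nat_on)

lemma config_bit_measurable [measurable]: "Measurable.pred (config_space N) (config_bit N j)"
proof -
  obtain q :: rat and i k :: nat where j: "from_nat j = (q, i, k)" by (metis prod_cases3)
  show ?thesis
  proof (cases "i < N")
    case True
    then have [measurable]: "(\<lambda>x. x i) \<in> borel_measurable (config_space N)"
      by (intro measurable_component_singleton) auto
    show ?thesis unfolding config_bit_def[abs_def] j by measurable
  qed (simp add: config_bit_def[abs_def] j)
qed

lemma config_code_measurable [measurable]: "config_code N \<in> borel_measurable (config_space N)"
  unfolding config_code_def[abs_def] cantor_code_def of_bool_def by measurable

lemma config_decode_measurable [measurable]: "config_decode N \<in> measurable borel (config_space N)"
  unfolding config_decode_def[abs_def] by (intro measurable_restrict) measurable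

lemma INF_rat_cut: "(INF q::rat. if y < of_rat q then ereal (of_rat q) else \<infinity>) = ereal y"
proof (rule antisym)
  show "ereal y \<le> (INF q::rat. if y < of_rat q then ereal (of_rat q) else \<infinity>)"
    by (intro INF_greatest) auto
  show "(INF q::rat. if y < of_rat q then ereal (of_rat q) else \<infinity>) \<le> ereal y"
  proof (rule ereal_le_epsilon2)
    fix e :: real assume "0 < e"
    then obtain q :: rat where q: "y < of_rat q" "of_rat q < y + e" using of_rat_dense[of y "y + e"] by auto
    have "(INF q::rat. if y < of_rat q then ereal (of_rat q) else \<infinity>) \<le> ereal (of_rat q)"
      by (rule INF_lower2[of q]) (use q in auto)
    also have "\<dots> \<le> ereal y + ereal e" using q by simp
    finally show "(INF q::rat. if y < of_rat q then ereal (of_rat q) else \<infinity>) \<le> ereal y + ereal e" .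
  qed
qed

lemma config_decode_code:
  assumes "x \<in> space (config_space N)"
  shows "config_decode N (config_code N x) = (x :: nat \<Rightarrow> 'a::euclidean_space)"
proof
  fix i
  show "config_decode N (config_code N x) i = x i"
  proof (cases "i < N")
    case True
    have "config_decode N (config_code N x) i = (\<Sum>b\<in>Basis. (x i \<bullet> b) *\<^sub>R b)"
      unfolding config_decode_def config_code_def cantor_digit_code restrict_apply' [OF True[folded lessThan_iff]]
    proof (rule sum.cong[OF refl])
      fix b :: 'a assume "b \<in> Basis"
      then show "real_of_ereal (INF q::rat. if config_bit N (to_nat (q, i, to_nat_on (Basis :: 'a set) b)) x
          then ereal (of_rat q) else \<infinity>) *\<^sub>R b = (x i \<bullet> b) *\<^sub>R b"
        unfolding config_bit_basis[OF \<open>b \<in> Basis\<close> True] INF_rat_cut by simp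
    qed
    then show ?thesis by (simp add: euclidean_representation)
  next
    case False
    then show ?thesis
      using assms by (auto simp: config_decode_def space_PiM PiE_def extensional_def)
  qed
qed

text \<open>
  Skorohod's theorem on the real line, transported along an encoding of configurations into the
  Cantor set. The encoding remembers on which side of each rational every coordinate lies, so
  convergence of codes means convergence of each particle, to a point or to infinity.
\<close>

lemma skorohod_configurations:
  fixes X :: "nat \<Rightarrow> nat \<Rightarrow> 'b \<Rightarrow> 'a::euclidean_space" and M :: "nat \<Rightarrow> 'b measure"
  assumes M: "\<And>n. prob_space (M n)" and X: "\<And>n i. i < N \<Longrightarrow> X n i \<in> borel_measurable (M n)"
  obtains r and \<Omega> :: "real measure" and Y :: "nat \<Rightarrow> nat \<Rightarrow> real \<Rightarrow> 'a" where
    "strict_mono (r :: nat \<Rightarrow> nat)" "prob_space \<Omega>" "\<And>n i. i < N \<Longrightarrow> Y n i \<in> borel_measurable \<Omega>"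
    "\<And>n f. f \<in> borel_measurable (config_space N) \<Longrightarrow>
      (\<integral>\<^sup>+\<omega>. f (\<lambda>i\<in>{..<N}. Y n i \<omega>) \<partial>\<Omega>) = (\<integral>\<^sup>+\<omega>. f (\<lambda>i\<in>{..<N}. X (r n) i \<omega>) \<partial>M (r n))"
    "AE \<omega> in \<Omega>. \<forall>i<N. convergent (\<lambda>n. Y n i \<omega>) \<or> filterlim (\<lambda>n. norm (Y n i \<omega>)) at_top sequentially"
proof -
  define V where "V n \<omega> = (\<lambda>i\<in>{..<N}. X n i \<omega>)" for n \<omega>
  have V[measurable]: "V n \<in> measurable (M n) (config_space N)" for n
    unfolding V_def[abs_def] using X by (intro measurable_restrict) auto
  define \<mu> where "\<mu> n = distr (M n) borel (\<lambda>\<omega>. config_code N (V n \<omega>))" for n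
  have \<mu>: "real_distribution (\<mu> n)" for n
    unfolding \<mu>_def by (intro prob_space.real_distribution_distr M) measurable
  \<comment> \<open>Codes lie in [0, 1], so tightness is automatic however far the configurations
    spread. The left endpoint -1 keeps the code 0 inside the half-open interval.\<close>
  have "tight \<mu>"
    unfolding tight_def
  proof (intro conjI allI impI)
    fix \<epsilon> :: real assume "0 < \<epsilon>"
    show "\<exists>a b. a < b \<and> (\<forall>n. 1 - \<epsilon> < measure (\<mu> n) {a<..b})"
    proof (rule exI[of _ "-1"], rule exI[of _ 1], intro conjI allI)
      fix n
      have "measure (\<mu> n) {-1<..1} = measure (M n) ((\<lambda>\<omega>. config_code N (V n \<omega>)) -` {-1<..1} \<inter> space (M n))"
        unfolding \<mu>_def by (rule measure_distr) measurable
      also have "(\<lambda>\<omega>. config_code N (V n \<omega>)) -` {-1<..1} \<inter> space (M n) = space (M n)"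
      proof -
        have "-1 < cantor_code b" for b using cantor_code_bounds(1)[of b] by linarith
        then show ?thesis by (auto simp: config_code_def cantor_code_bounds(2))
      qed
      also have "measure (M n) (space (M n)) = 1" using prob_space.prob_space[OF M] .
      finally show "1 - \<epsilon> < measure (\<mu> n) {-1<..1}" using \<open>0 < \<epsilon>\<close> by simp
    qed simp
  qed (use \<mu> in auto)
  from tight_imp_convergent_subsubsequence[OF this strict_mono_id]
  obtain r P where r: "strict_mono (r :: nat \<Rightarrow> nat)" and P: "real_distribution P" and conv: "weak_conv_m (\<mu> \<circ> r) P"
    by auto
  obtain \<Omega> :: "real measure" and Z :: "nat \<Rightarrow> real \<Rightarrow> real" and Z' where \<Omega>: "prob_space \<Omega>"
    and Zm: "\<And>n. Z n \<in> borel_measurable \<Omega>" and Zd: "\<And>n. distr \<Omega> borel (Z n) = \<mu> (r n)"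
    and Zc: "\<And>\<omega>. \<omega> \<in> space \<Omega> \<Longrightarrow> (\<lambda>n. Z n \<omega>) \<longlonglongrightarrow> Z' \<omega>"
  proof -
    have "real_distribution ((\<mu> \<circ> r) n)" for n using \<mu> by simp
    from Skorohod[OF this P conv] show thesis
      using that unfolding comp_def measurable_lborel1[symmetric] by blast
  qed
  note [measurable] = Zm
  define Y where "Y n i \<omega> = (config_decode N (Z n \<omega>) i :: 'a)" for n i \<omega>
  have res: "(\<lambda>i\<in>{..<N}. Y n i \<omega>) = config_decode N (Z n \<omega>)" for n \<omega>
    by (auto simp: Y_def config_decode_def restrict_def)
  have transfer: "(\<integral>\<^sup>+\<omega>. f (Z n \<omega>) \<partial>\<Omega>) = (\<integral>\<^sup>+\<omega>. f (config_code N (V (r n) \<omega>)) \<partial>M (r n))"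
    if [measurable]: "f \<in> borel_measurable borel" for f n
  proof -
    have "(\<integral>\<^sup>+\<omega>. f (Z n \<omega>) \<partial>\<Omega>) = (\<integral>\<^sup>+t. f t \<partial>\<mu> (r n))"
      unfolding Zd[symmetric] by (rule nn_integral_distr[symmetric]) measurable
    also have "\<dots> = (\<integral>\<^sup>+\<omega>. f (config_code N (V (r n) \<omega>)) \<partial>M (r n))"
      unfolding \<mu>_def by (rule nn_integral_distr) measurable
    finally show ?thesis .
  qed
  have dec: "config_decode N (config_code N (V n \<omega>)) = V n \<omega>" if "\<omega> \<in> space (M n)" for n \<omega>
    by (rule config_decode_code) (use measurable_space[OF V that] in simp)
  have law: "(\<integral>\<^sup>+\<omega>. f (\<lambda>i\<in>{..<N}. Y n i \<omega>) \<partial>\<Omega>) = (\<integral>\<^sup>+\<omega>. f (\<lambda>i\<in>{..<N}. X (r n) i \<omega>) \<partial>M (r n))"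
    if [measurable]: "f \<in> borel_measurable (config_space N)" for f n
  proof -
    have "(\<integral>\<^sup>+\<omega>. f (config_decode N (Z n \<omega>)) \<partial>\<Omega>) = (\<integral>\<^sup>+\<omega>. f (config_decode N (config_code N (V (r n) \<omega>))) \<partial>M (r n))"
      by (rule transfer) measurable
    also have "\<dots> = (\<integral>\<^sup>+\<omega>. f (V (r n) \<omega>) \<partial>M (r n))"
      by (intro nn_integral_cong) (simp add: dec)
    finally show ?thesis by (simp only: res V_def)
  qed
  \<comment> \<open>Decoding is only a left inverse, so the variables from Skorohod's theorem have
    to be recognized as codes. This holds almost surely because they have the laws of codes.\<close>
  have fixed: "AE \<omega> in \<Omega>. config_code N (config_decode N (Z n \<omega>) :: nat \<Rightarrow> 'a) = Z n \<omega>" for n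
  proof -
    define B where "B = {t :: real. config_code N (config_decode N t :: nat \<Rightarrow> 'a) \<noteq> t}"
    have [measurable]: "B \<in> sets borel" unfolding B_def by measurable
    have "(\<integral>\<^sup>+\<omega>. indicator B (Z n \<omega>) \<partial>\<Omega>) = (\<integral>\<^sup>+\<omega>. indicator B (config_code N (V (r n) \<omega>)) \<partial>M (r n))"
      by (rule transfer) measurable
    also have "\<dots> = (\<integral>\<^sup>+\<omega>. 0 \<partial>M (r n))"
      by (intro nn_integral_cong) (simp add: B_def dec)
    finally have "AE \<omega> in \<Omega>. indicator B (Z n \<omega>) = (0::ennreal)"
      by (subst nn_integral_0_iff_AE[symmetric]) simp_all
    then show ?thesis by eventually_elim (auto simp: B_def indicator_def split: if_splits)
  qed
  have "AE \<omega> in \<Omega>. \<forall>n. config_code N (config_decode N (Z n \<omega>) :: nat \<Rightarrow> 'a) = Z n \<omega>"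
    using fixed by (subst AE_all_countable) blast
  then have "AE \<omega> in \<Omega>. \<forall>i<N. convergent (\<lambda>n. Y n i \<omega>) \<or> filterlim (\<lambda>n. norm (Y n i \<omega>)) at_top sequentially"
    using AE_space
  proof eventually_elim
    case (elim \<omega>)
    show ?case
    proof (intro allI impI)
      fix i assume i: "i < N"
      define b where "b n = (\<lambda>j. config_bit N j (config_decode N (Z n \<omega>) :: nat \<Rightarrow> 'a))" for n
      have "(\<lambda>n. cantor_code (b n)) \<longlonglongrightarrow> Z' \<omega>"
        using Zc[OF elim(2)] elim(1) by (simp add: b_def config_code_def)
      then have ev: "\<exists>v. eventually (\<lambda>n. b n j = v) sequentially" for j
        by (rule cantor_code_tendsto)
      show "convergent (\<lambda>n. Y n i \<omega>) \<or> filterlim (\<lambda>n. norm (Y n i \<omega>)) at_top sequentially"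
      proof (rule vector_sequence_cuts)
        fix q :: rat and e :: 'a assume e: "e \<in> Basis"
        show "\<exists>v. eventually (\<lambda>n. (Y n i \<omega> \<bullet> e < of_rat q) = v) sequentially"
          using ev[of "to_nat (q, i, to_nat_on (Basis :: 'a set) e)"]
          unfolding b_def config_bit_basis[OF e i] Y_def .
      qed
    qed
  qed
  moreover have "Y n i \<in> borel_measurable \<Omega>" if "i < N" for n i
  proof -
    have [measurable]: "(\<lambda>x. x i) \<in> borel_measurable (config_space N :: (nat \<Rightarrow> 'a) measure)"
      using that by (intro measurable_component_singleton) auto
    show ?thesis unfolding Y_def[abs_def] by measurable
  qed
  ultimately show thesis
    using that[OF r \<Omega> _ law] by blast
qed

subsection \<open>Densities of limits\<close>

text \<open>Radon-Nikodym for the law of each particle restricted to the event of its presence, a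
  finite measure that is absolutely continuous by \<open>ac\<close>. Passing to real values through
  \<open>enn2real\<close> makes the density finite and nonnegative everywhere, as a state
  requires.\<close>

lemma gc_density_exists:
  fixes X :: "nat \<Rightarrow> 'b \<Rightarrow> 'a::euclidean_space"
  assumes M: "prob_space M" and X: "\<And>i. i < N \<Longrightarrow> X i \<in> borel_measurable M" and S: "\<And>i. i < N \<Longrightarrow> S i \<in> sets M"
    and ac: "\<And>i A. i < N \<Longrightarrow> A \<in> sets borel \<Longrightarrow> emeasure lborel A = 0 \<Longrightarrow>
       (\<integral>\<^sup>+\<omega>\<in>S i. indicator A (X i \<omega>) \<partial>M) = 0"
  obtains \<rho> where "gc_state N M X S \<rho>"
proof -
  interpret M: prob_space M by fact
  have "\<exists>g. g \<in> borel_measurable borel \<and> (\<forall>x. 0 \<le> g x) \<and> (\<forall>f\<in>borel_measurable borel.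
      (\<integral>\<^sup>+x. ennreal (g x) * f x \<partial>lborel) = (\<integral>\<^sup>+\<omega>\<in>S i. f (X i \<omega>) \<partial>M))" if i: "i < N" for i
  proof -
    have [measurable]: "X i \<in> borel_measurable M" "S i \<in> sets M" using X S i by auto
    define \<nu> where "\<nu> = distr (density M (indicator (S i))) borel (X i)"
    have \<nu>: "(\<integral>\<^sup>+x. f x \<partial>\<nu>) = (\<integral>\<^sup>+\<omega>\<in>S i. f (X i \<omega>) \<partial>M)" if [measurable]: "f \<in> borel_measurable borel" for f
      unfolding \<nu>_def by (subst nn_integral_distr) (auto simp: nn_integral_density mult.commute)
    have sets\<nu>: "sets \<nu> = sets borel" by (simp add: \<nu>_def)
    interpret \<nu>: finite_measure \<nu>
    proof
      have "emeasure \<nu> (space \<nu>) = (\<integral>\<^sup>+x. 1 \<partial>\<nu>)" by simp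
      also have "\<dots> = emeasure M (S i)" by (subst \<nu>) simp_all
      finally show "emeasure \<nu> (space \<nu>) \<noteq> \<infinity>" by simp
    qed
    have ac\<nu>: "absolutely_continuous lborel \<nu>"
      unfolding absolutely_continuous_def
    proof
      fix A :: "'a set" assume "A \<in> null_sets lborel"
      then have A: "A \<in> sets borel" "emeasure lborel A = 0" by auto
      have "emeasure \<nu> A = (\<integral>\<^sup>+x. indicator A x \<partial>\<nu>)" using A by (simp add: sets\<nu>)
      also have "\<dots> = 0" using ac[OF i A] A by (subst \<nu>) auto
      finally show "A \<in> null_sets \<nu>" using A by (simp add: null_sets_def sets\<nu>)
    qed
    have sets\<nu>': "sets \<nu> = sets lborel" by (simp add: sets\<nu>)
    define g where "g x = enn2real (RN_deriv lborel \<nu> x)" for x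
    have "AE x in lborel. RN_deriv lborel \<nu> x \<noteq> \<infinity>"
      by (rule sigma_finite_measure.RN_deriv_finite[OF sigma_finite_lborel \<nu>.sigma_finite_measure_axioms ac\<nu> sets\<nu>'])
    then have gRN: "AE x in lborel. ennreal (g x) = RN_deriv lborel \<nu> x"
      by eventually_elim (simp add: g_def less_top)
    have "(\<integral>\<^sup>+x. ennreal (g x) * f x \<partial>lborel) = (\<integral>\<^sup>+\<omega>\<in>S i. f (X i \<omega>) \<partial>M)"
      if f[measurable]: "f \<in> borel_measurable borel" for f
    proof -
      have "(\<integral>\<^sup>+x. ennreal (g x) * f x \<partial>lborel) = (\<integral>\<^sup>+x. RN_deriv lborel \<nu> x * f x \<partial>lborel)"
        using gRN by (intro nn_integral_cong_AE) auto
      also have "\<dots> = (\<integral>\<^sup>+x. f x \<partial>\<nu>)"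
        by (rule sigma_finite_measure.RN_deriv_nn_integral[OF sigma_finite_lborel ac\<nu> sets\<nu>', symmetric]) simp
      finally show ?thesis using \<nu>[OF f] by simp
    qed
    moreover have "g \<in> borel_measurable borel" unfolding g_def by measurable
    ultimately show ?thesis by (intro exI[of _ g]) (auto simp: g_def)
  qed
  then obtain g where g: "\<And>i. i < N \<Longrightarrow> g i \<in> borel_measurable borel" "\<And>i x. i < N \<Longrightarrow> 0 \<le> g i x"
    "\<And>i f. i < N \<Longrightarrow> f \<in> borel_measurable borel \<Longrightarrow>
      (\<integral>\<^sup>+x. ennreal (g i x) * f x \<partial>lborel) = (\<integral>\<^sup>+\<omega>\<in>S i. f (X i \<omega>) \<partial>M)"
    by metis
  have "gc_state N M X S (\<lambda>x. \<Sum>i<N. g i x)"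
    unfolding gc_state_def
  proof (intro conjI ballI allI impI)
    fix f :: "'a \<Rightarrow> ennreal" assume f[measurable]: "f \<in> borel_measurable borel"
    have "(\<integral>\<^sup>+x. ennreal (\<Sum>i<N. g i x) * f x \<partial>lborel) = (\<integral>\<^sup>+x. (\<Sum>i<N. ennreal (g i x) * f x) \<partial>lborel)"
    proof (intro nn_integral_cong)
      fix x
      have "ennreal (\<Sum>i<N. g i x) = (\<Sum>i<N. ennreal (g i x))" using g(2) by (intro sum_ennreal[symmetric]) auto
      then show "ennreal (\<Sum>i<N. g i x) * f x = (\<Sum>i<N. ennreal (g i x) * f x)"
        by (simp add: sum_distrib_right)
    qed
    also have "\<dots> = (\<Sum>i<N. \<integral>\<^sup>+x. ennreal (g i x) * f x \<partial>lborel)"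
      using g(1) by (intro nn_integral_sum) auto
    also have "\<dots> = (\<Sum>i<N. \<integral>\<^sup>+\<omega>\<in>S i. f (X i \<omega>) \<partial>M)"
      by (intro sum.cong refl g(3) f) auto
    finally show "(\<integral>\<^sup>+x. ennreal (\<Sum>i<N. g i x) * f x \<partial>lborel) = (\<Sum>i<N. \<integral>\<^sup>+\<omega>\<in>S i. f (X i \<omega>) \<partial>M)" .
  qed (use M X S g in \<open>auto intro!: sum_nonneg\<close>)
  then show thesis by (rule that)
qed

text \<open>Restricting the presence of a particle only decreases its law, so absolute continuity is
  inherited.\<close>

lemma gc_state_thinning:
  fixes X :: "nat \<Rightarrow> 'b \<Rightarrow> 'a::euclidean_space"
  assumes gc: "gc_state N M X S \<rho>" and S': "\<And>i. i < N \<Longrightarrow> S' i \<in> sets M" "\<And>i. i < N \<Longrightarrow> S' i \<subseteq> S i"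
  obtains \<rho>' where "gc_state N M X S' \<rho>'"
proof (rule gc_density_exists[of M N X S'])
  fix i and A :: "'a set" assume i: "i < N" and A[measurable]: "A \<in> sets borel" and A0: "emeasure lborel A = 0"
  have "(\<Sum>i<N. \<integral>\<^sup>+\<omega>\<in>S i. indicator A (X i \<omega>) \<partial>M) = (\<integral>\<^sup>+x. ennreal (\<rho> x) * indicator A x \<partial>lborel)"
    by (rule gc_stateD(6)[OF gc, symmetric]) simp
  also have "\<dots> = 0"
  proof -
    have "AE x in lborel. x \<notin> A" using A A0 by (intro AE_not_in) (auto simp: null_sets_def)
    then have "(\<integral>\<^sup>+x. ennreal (\<rho> x) * indicator A x \<partial>lborel) = (\<integral>\<^sup>+x. 0 \<partial>(lborel :: 'a measure))"
      by (intro nn_integral_cong_AE) auto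
    then show ?thesis by simp
  qed
  finally have "(\<integral>\<^sup>+\<omega>\<in>S i. indicator A (X i \<omega>) \<partial>M) = 0"
    using i by (simp add: sum_eq_0_iff)
  moreover have "(\<integral>\<^sup>+\<omega>\<in>S' i. indicator A (X i \<omega>) \<partial>M) \<le> (\<integral>\<^sup>+\<omega>\<in>S i. indicator A (X i \<omega>) \<partial>M)"
    using S'(2)[OF i] by (intro nn_integral_mono) (auto simp: indicator_def)
  ultimately show "(\<integral>\<^sup>+\<omega>\<in>S' i. indicator A (X i \<omega>) \<partial>M) = 0" by simp
qed (use gc_stateD[OF gc] S' that in auto)

text \<open>Fatou's lemma for the counting measure on a finite set.\<close>

lemma liminf_sum_le:
  fixes f :: "'i \<Rightarrow> nat \<Rightarrow> ennreal"
  assumes "finite I"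
  shows "(\<Sum>i\<in>I. liminf (f i)) \<le> liminf (\<lambda>n. \<Sum>i\<in>I. f i n)"
  using nn_integral_liminf[of "\<lambda>n i. f i n" "count_space I"] assms
  by (simp add: nn_integral_count_space_finite)

section \<open>Lower semicontinuity of the power mass\<close>

lemma youngs_inequality_power:
  fixes a g p :: real
  assumes "1 < p" "0 \<le> a" "0 \<le> g"
  shows "p * (g powr (p - 1) * a) \<le> a powr p + (p - 1) * g powr p"
proof -
  define q where "q = p / (p - 1)"
  have q: "1 < q" "1 / p + 1 / q = 1" using assms by (auto simp: q_def field_simps)
  have "a * g powr (p - 1) \<le> a powr p / p + (g powr (p - 1)) powr q / q"
    using assms q by (intro Youngs_inequality) auto
  also have "(g powr (p - 1)) powr q = g powr p"
    using assms by (simp add: powr_powr q_def)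
  finally have "p * (a * g powr (p - 1)) \<le> p * (a powr p / p + g powr p / q)"
    using assms by (intro mult_left_mono) auto
  also have "\<dots> = a powr p + (p - 1) * g powr p"
    using assms by (simp add: q_def field_simps)
  finally show ?thesis by (simp add: mult.commute)
qed

text \<open>
  Lower semicontinuity of the \<open>L\<^sup>p\<close> norm by duality: \<open>a powr p\<close> is the supremum over \<open>g\<close> of
  \<open>p * g powr (p - 1) * a - (p - 1) * g powr p\<close>, and it suffices to test with continuous
  approximations \<open>g\<close> of truncations of \<open>a\<close>.
\<close>

lemma power_mass_liminf:
  fixes a :: "'a::euclidean_space \<Rightarrow> real" and b :: "nat \<Rightarrow> 'a \<Rightarrow> real"
  assumes s: "0 < s"
    and [measurable]: "a \<in> borel_measurable borel" "\<And>n. b n \<in> borel_measurable borel"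
    and a0: "\<And>x. 0 \<le> a x" and b0: "\<And>n x. 0 \<le> b n x"
    and test: "\<And>g :: 'a \<Rightarrow> real. continuous_on UNIV g \<Longrightarrow> (\<And>x. 0 \<le> g x) \<Longrightarrow>
       (\<integral>\<^sup>+x. ennreal (a x) * ennreal (g x) \<partial>lborel) \<le> liminf (\<lambda>n. \<integral>\<^sup>+x. ennreal (b n x) * ennreal (g x) \<partial>lborel)"
  shows "power_mass s a \<le> liminf (\<lambda>n. power_mass s (b n))"
proof -
  define p where "p = 1 + s / real DIM('a)"
  have p: "1 < p" using s by (simp add: p_def)
  define Lim where "Lim = liminf (\<lambda>n. power_mass s (b n))"
  have pm: "power_mass s f = (\<integral>\<^sup>+x. ennreal (f x powr p) \<partial>lborel)" for f :: "'a \<Rightarrow> real"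
    by (simp add: power_mass_def p_def)
  \<comment> \<open>The dual inequality for one continuous test function, with the term in
    \<open>g\<close> alone moved to the right to avoid subtraction. Finiteness of that term allows
    it to be taken out of the limit inferior.\<close>
  have cont: "(\<integral>\<^sup>+x. ennreal (a x) * ennreal (p * g x powr (p - 1)) \<partial>lborel)
      \<le> Lim + ennreal (p - 1) * (\<integral>\<^sup>+x. ennreal (g x powr p) \<partial>lborel)"
    if g: "continuous_on UNIV g" "\<And>x. 0 \<le> g x" and fin: "(\<integral>\<^sup>+x. ennreal (g x powr p) \<partial>lborel) < \<infinity>" for g :: "'a \<Rightarrow> real"
  proof -
    have [measurable]: "g \<in> borel_measurable borel" using g by (intro borel_measurable_continuous_onI)
    define K where "K = ennreal (p - 1) * (\<integral>\<^sup>+x. ennreal (g x powr p) \<partial>lborel)"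
    have "(\<integral>\<^sup>+x. ennreal (a x) * ennreal (p * g x powr (p - 1)) \<partial>lborel)
        \<le> liminf (\<lambda>n. \<integral>\<^sup>+x. ennreal (b n x) * ennreal (p * g x powr (p - 1)) \<partial>lborel)"
      using p g by (intro test continuous_on_mult continuous_on_const continuous_on_powr') auto
    also have "\<dots> \<le> liminf (\<lambda>n. power_mass s (b n) + K)"
    proof (intro Liminf_mono always_eventually allI)
      fix n
      have "(\<integral>\<^sup>+x. ennreal (b n x) * ennreal (p * g x powr (p - 1)) \<partial>lborel) \<le>
          (\<integral>\<^sup>+x. ennreal (b n x powr p) + ennreal (p - 1) * ennreal (g x powr p) \<partial>lborel)"
      proof (intro nn_integral_mono)
        fix x
        have "b n x * (p * g x powr (p - 1)) \<le> b n x powr p + (p - 1) * g x powr p"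
          using youngs_inequality_power[OF p b0[of n x] g(2)[of x]] by (simp add: mult_ac)
        then have "ennreal (b n x * (p * g x powr (p - 1))) \<le> ennreal (b n x powr p + (p - 1) * g x powr p)"
          by (rule ennreal_leI)
        then show "ennreal (b n x) * ennreal (p * g x powr (p - 1)) \<le> ennreal (b n x powr p) + ennreal (p - 1) * ennreal (g x powr p)"
          using p b0[of n x] by (simp add: ennreal_mult)
      qed
      also have "\<dots> = power_mass s (b n) + K"
        unfolding pm K_def by (simp add: nn_integral_add nn_integral_cmult)
      finally show "(\<integral>\<^sup>+x. ennreal (b n x) * ennreal (p * g x powr (p - 1)) \<partial>lborel) \<le> power_mass s (b n) + K" .
    qed
    also have "\<dots> = Lim + K"
      unfolding Lim_def using fin by (intro Liminf_add_const) (auto simp: K_def ennreal_mult_less_top)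
    finally show ?thesis unfolding K_def .
  qed
  \<comment> \<open>Truncation in height and in space makes the power integral finite, which the
    final cancellation requires.\<close>
  define u where "u m x = min (a x) (real m) * indicator (ball 0 (real m)) x" for m :: nat and x :: 'a
  have u0: "0 \<le> u m x" "u m x \<le> real m" "u m x \<le> a x" for m x
    using a0[of x] by (auto simp: u_def indicator_def)
  have [measurable]: "u m \<in> borel_measurable borel" for m
  proof -
    have [measurable]: "ball (0::'a) (real m) \<in> sets borel" by simp
    show ?thesis unfolding u_def by measurable
  qed
  have trunc: "(\<integral>\<^sup>+x. ennreal (u m x powr p) \<partial>lborel) \<le> Lim" for m
  proof -
    \<comment> \<open>A measurable function is an almost everywhere limit of continuous ones; this
      reduces the duality argument to continuous test functions.\<close>
    have "u m \<in> borel_measurable lebesgue" by (intro measurable_completion) simp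
    then have "u m measurable_on UNIV" using sets.top[of lebesgue]
      by (intro lebesgue_measurable_imp_measurable_on_real) simp_all
    then obtain Z g where Z: "negligible Z" and gc: "\<And>j::nat. continuous_on UNIV (g j)"
      and gl: "\<And>x. x \<notin> Z \<Longrightarrow> (\<lambda>j. g j x) \<longlonglongrightarrow> u m x"
      unfolding measurable_on_def by auto
    \<comment> \<open>The cutoff equals 1 on the ball of radius m and vanishes outside radius m + 1.
      Together with clipping to values between 0 and m it gives a common integrable majorant without
      changing the limit.\<close>
    define cut where "cut x = max 0 (min 1 (real m + 1 - norm x))" for x :: 'a
    define f where "f j x = cut x * max 0 (min (real m) (g j x))" for j x
    have fc: "continuous_on UNIV (f j)" for j
      unfolding f_def cut_def
      by (intro continuous_on_mult continuous_on_max continuous_on_min continuous_on_diff continuous_on_const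
          continuous_on_norm continuous_on_id gc)
    have f0: "0 \<le> f j x" for j x by (auto simp: f_def cut_def)
    have f_le: "f j x \<le> real m * indicator (ball 0 (real m + 1)) x" for j x
    proof (cases "norm x < real m + 1")
      case True
      have "f j x \<le> 1 * real m" unfolding f_def cut_def by (intro mult_mono) auto
      then show ?thesis using True by simp
    next
      case False
      then show ?thesis by (simp add: f_def cut_def)
    qed
    have [measurable]: "f j \<in> borel_measurable borel" for j
      using fc by (intro borel_measurable_continuous_onI)
    have "AE x in lebesgue. x \<notin> Z"
      using Z by (intro AE_not_in) (simp add: negligible_iff_null_sets)
    then have "AE x in lborel. x \<notin> Z"
      by (simp add: AE_completion_iff)
    then have fl: "AE x in lborel. (\<lambda>j. f j x) \<longlonglongrightarrow> u m x"
    proof eventually_elim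
      case (elim x)
      have "(\<lambda>j. f j x) \<longlonglongrightarrow> cut x * max 0 (min (real m) (u m x))"
        unfolding f_def by (intro tendsto_mult tendsto_const tendsto_max tendsto_min gl elim)
      also have "cut x * max 0 (min (real m) (u m x)) = u m x"
        using u0[of m x] by (cases "norm x < real m") (auto simp: cut_def u_def)
      finally show ?case .
    qed
    have [measurable]: "ball (0::'a) (real m + 1) \<in> sets borel" by simp
    define w where "w x = ennreal (real m powr p) * indicator (ball (0::'a) (real m + 1)) x" for x
    have wfin: "(\<integral>\<^sup>+x. w x \<partial>lborel) < \<infinity>"
      unfolding w_def by (subst nn_integral_cmult_indicator) (auto simp: emeasure_lborel_ball ennreal_mult_less_top)
    have fw: "ennreal (f j x powr p) \<le> w x" for j x
    proof -
      have "f j x powr p \<le> (real m * indicator (ball 0 (real m + 1)) x) powr p"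
        using f0 f_le p by (intro powr_mono2) auto
      then have "ennreal (f j x powr p) \<le> ennreal ((real m * indicator (ball 0 (real m + 1)) x) powr p)"
        by (rule ennreal_leI)
      then show ?thesis by (auto simp: w_def indicator_def split: if_splits)
    qed
    have ffin: "(\<integral>\<^sup>+x. ennreal (f j x powr p) \<partial>lborel) < \<infinity>" for j
      using wfin fw by (intro le_less_trans[OF nn_integral_mono wfin])
    have lim_p: "(\<lambda>j. \<integral>\<^sup>+x. ennreal (f j x powr p) \<partial>lborel) \<longlonglongrightarrow> (\<integral>\<^sup>+x. ennreal (u m x powr p) \<partial>lborel)"
    proof (rule nn_integral_dominated_convergence[OF _ _ _ _ wfin])
      show "AE x in lborel. (\<lambda>j. ennreal (f j x powr p)) \<longlonglongrightarrow> ennreal (u m x powr p)"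
        using fl by eventually_elim (use p f0 in \<open>auto intro!: tendsto_ennrealI tendsto_powr' always_eventually\<close>)
    qed (use fw in \<open>auto simp: w_def\<close>)
    have ufin: "(\<integral>\<^sup>+x. ennreal (u m x powr p) \<partial>lborel) < \<infinity>"
    proof -
      have "(\<integral>\<^sup>+x. ennreal (u m x powr p) \<partial>lborel) \<le> (\<integral>\<^sup>+x. w x \<partial>lborel)"
        by (rule LIMSEQ_le_const2[OF lim_p]) (auto intro!: nn_integral_mono fw)
      then show ?thesis using wfin by simp
    qed
    have "(\<integral>\<^sup>+x. ennreal (a x) * ennreal (p * u m x powr (p - 1)) \<partial>lborel) =
        (\<integral>\<^sup>+x. liminf (\<lambda>j. ennreal (a x) * ennreal (p * f j x powr (p - 1))) \<partial>lborel)"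
    proof (intro nn_integral_cong_AE)
      show "AE x in lborel. ennreal (a x) * ennreal (p * u m x powr (p - 1)) =
          liminf (\<lambda>j. ennreal (a x) * ennreal (p * f j x powr (p - 1)))"
        using fl
      proof eventually_elim
        case (elim x)
        have "(\<lambda>j. ennreal (a x) * ennreal (p * f j x powr (p - 1))) \<longlonglongrightarrow> ennreal (a x) * ennreal (p * u m x powr (p - 1))"
          using p f0 elim by (intro ennreal_tendsto_cmult tendsto_ennrealI tendsto_mult tendsto_powr') (auto intro!: always_eventually)
        then show ?case by (simp add: lim_imp_Liminf)
      qed
    qed
    also have "\<dots> \<le> liminf (\<lambda>j. \<integral>\<^sup>+x. ennreal (a x) * ennreal (p * f j x powr (p - 1)) \<partial>lborel)"
      by (intro nn_integral_liminf) measurable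
    also have "\<dots> \<le> liminf (\<lambda>j. Lim + ennreal (p - 1) * (\<integral>\<^sup>+x. ennreal (f j x powr p) \<partial>lborel))"
      by (intro Liminf_mono always_eventually allI cont fc f0 ffin)
    also have "\<dots> = Lim + ennreal (p - 1) * (\<integral>\<^sup>+x. ennreal (u m x powr p) \<partial>lborel)"
      by (intro lim_imp_Liminf tendsto_add tendsto_const ennreal_tendsto_cmult lim_p) auto
    finally have "(\<integral>\<^sup>+x. ennreal (a x) * ennreal (p * u m x powr (p - 1)) \<partial>lborel) \<le> \<dots>" .
    moreover have "ennreal p * (\<integral>\<^sup>+x. ennreal (u m x powr p) \<partial>lborel) \<le> (\<integral>\<^sup>+x. ennreal (a x) * ennreal (p * u m x powr (p - 1)) \<partial>lborel)"
    proof (subst nn_integral_cmult[symmetric])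
      show "(\<integral>\<^sup>+x. ennreal p * ennreal (u m x powr p) \<partial>lborel) \<le> (\<integral>\<^sup>+x. ennreal (a x) * ennreal (p * u m x powr (p - 1)) \<partial>lborel)"
      proof (intro nn_integral_mono)
        fix x
        have "u m x powr p = u m x * u m x powr (p - 1)"
          using u0[of m x] by (cases "u m x = 0") (auto simp: powr_diff)
        then have "p * u m x powr p \<le> a x * (p * u m x powr (p - 1))"
          using u0[of m x] p by (simp add: mult_right_mono mult.left_commute)
        then show "ennreal p * ennreal (u m x powr p) \<le> ennreal (a x) * ennreal (p * u m x powr (p - 1))"
          using p a0[of x] by (simp add: ennreal_leI flip: ennreal_mult)
      qed
    qed simp
    \<comment> \<open>With J the power integral of the truncation, the dual inequality now reads p J
      \<le> Lim + (p - 1) J. As J is finite, it yields J \<le> Lim.\<close>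
    ultimately have "ennreal p * (\<integral>\<^sup>+x. ennreal (u m x powr p) \<partial>lborel) \<le> Lim + ennreal (p - 1) * (\<integral>\<^sup>+x. ennreal (u m x powr p) \<partial>lborel)"
      by (rule order_trans[rotated])
    moreover obtain r where r: "(\<integral>\<^sup>+x. ennreal (u m x powr p) \<partial>lborel) = ennreal r" "0 \<le> r"
      using ufin by (cases "\<integral>\<^sup>+x. ennreal (u m x powr p) \<partial>lborel") auto
    moreover have "ennreal p * ennreal r = ennreal (p - 1) * ennreal r + ennreal r"
    proof -
      have "ennreal p = ennreal (p - 1) + 1" using p by (simp flip: ennreal_1 ennreal_plus)
      then show ?thesis by (simp add: distrib_right)
    qed
    ultimately have "ennreal (p - 1) * ennreal r + ennreal r \<le> ennreal (p - 1) * ennreal r + Lim"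
      by (simp add: add.commute)
    then have "ennreal r \<le> Lim"
      by (subst (asm) ennreal_add_left_cancel_le) (auto simp: ennreal_mult_eq_top_iff)
    then show ?thesis using r by simp
  qed
  have "power_mass s a = (\<integral>\<^sup>+x. liminf (\<lambda>m. ennreal (u m x powr p)) \<partial>lborel)"
    unfolding pm
  proof (intro nn_integral_cong)
    fix x
    obtain m0 where m0: "max (a x) (norm x) < real m0" using reals_Archimedean2 by blast
    have "(\<lambda>m. ennreal (u m x powr p)) \<longlonglongrightarrow> ennreal (a x powr p)"
    proof (rule tendsto_eventually, rule eventually_sequentiallyI[of m0])
      fix m assume "m0 \<le> m"
      then have "real m0 \<le> real m" by simp
      then have "a x < real m" "norm x < real m" using m0 by linarith+
      then show "ennreal (u m x powr p) = ennreal (a x powr p)" by (simp add: u_def)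
    qed
    then show "ennreal (a x powr p) = liminf (\<lambda>m. ennreal (u m x powr p))"
      by (rule lim_imp_Liminf[OF sequentially_bot, symmetric])
  qed
  also have "\<dots> \<le> liminf (\<lambda>m. \<integral>\<^sup>+x. ennreal (u m x powr p) \<partial>lborel)"
    by (intro nn_integral_liminf) measurable
  also have "\<dots> \<le> liminf (\<lambda>m::nat. Lim)"
    by (intro Liminf_mono always_eventually allI trunc)
  also have "\<dots> = Lim" by (simp add: Liminf_const)
  finally show ?thesis unfolding Lim_def .
qed

subsection \<open>Limits of states\<close>

text \<open>The case in which all pairs are counted. This estimate of Hardy-Littlewood-Sobolev type
  makes \<open>D\<close> finite and \<open>Lambda\<close> bounded.\<close>

lemma D_le_power_mass:
  fixes \<rho> :: "'a::euclidean_space \<Rightarrow> real"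
  assumes s: "0 < s" "s < real DIM('a)" and \<rho>: "\<rho> \<in> borel_measurable borel" "\<And>x. 0 \<le> \<rho> x"
    and m: "0 < m" "(\<integral>\<^sup>+x. ennreal (\<rho> x) \<partial>lborel) \<le> ennreal m"
  shows "D s \<rho> \<le> ennreal (2 * (riesz_const TYPE('a) s + 1) * m powr (1 - s / real DIM('a))) * power_mass s \<rho>"
  using riesz_energy_le[OF s, of "\<lambda>_ _. True" \<rho> m] \<rho> m by (simp add: D_def power_mass_def)

text \<open>Split at height T: below it the volume of \<open>U\<close> bounds the mass, above it
  \<rho> is at most T^(-s/d) times its power 1 + s/d. With T free, this makes densities of bounded
  power mass equi-integrable.\<close>

lemma mass_le_power_mass:
  fixes \<rho> :: "'a::euclidean_space \<Rightarrow> real"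
  assumes s: "0 < s" and [measurable]: "\<rho> \<in> borel_measurable borel" "U \<in> sets borel" and T: "0 < T"
  shows "(\<integral>\<^sup>+x\<in>U. ennreal (\<rho> x) \<partial>lborel) \<le>
     ennreal T * emeasure lborel U + ennreal (T powr - (s / real DIM('a))) * power_mass s \<rho>"
proof -
  define q where "q = s / real DIM('a)"
  have q: "q > 0" using s by (simp add: q_def)
  have "(\<integral>\<^sup>+x\<in>U. ennreal (\<rho> x) \<partial>lborel) \<le>
      (\<integral>\<^sup>+x. ennreal T * indicator U x + ennreal (T powr - q) * ennreal (\<rho> x powr (1 + q)) \<partial>lborel)"
  proof (intro nn_integral_mono)
    fix x
    have "\<rho> x \<le> T powr - q * \<rho> x powr (1 + q)" if "T < \<rho> x"
    proof -
      have "T powr q \<le> \<rho> x powr q" using that T q by (intro powr_mono2) auto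
      then show ?thesis using that T by (simp add: powr_minus powr_add field_simps)
    qed
    then have "ennreal (\<rho> x) \<le> ennreal T + ennreal (T powr - q) * ennreal (\<rho> x powr (1 + q))"
    proof (cases "T < \<rho> x")
      case True
      with \<open>T < \<rho> x \<Longrightarrow> \<rho> x \<le> T powr - q * \<rho> x powr (1 + q)\<close>
      have "ennreal (\<rho> x) \<le> ennreal (T powr - q) * ennreal (\<rho> x powr (1 + q))"
        by (simp add: ennreal_leI flip: ennreal_mult)
      then show ?thesis by (rule add_increasing[rotated]) simp
    next
      case False
      then show ?thesis by (intro add_increasing2 ennreal_leI) auto
    qed
    then show "ennreal (\<rho> x) * indicator U x \<le> ennreal T * indicator U x + ennreal (T powr - q) * ennreal (\<rho> x powr (1 + q))"
      by (auto simp: indicator_def)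
  qed
  also have "\<dots> = ennreal T * emeasure lborel U + ennreal (T powr - q) * power_mass s \<rho>"
    unfolding power_mass_def q_def[symmetric]
    by (subst nn_integral_add) (auto simp: nn_integral_cmult nn_integral_cmult_indicator)
  finally show ?thesis unfolding q_def .
qed

section \<open>Near and far parts of the kernel\<close>

definition near_kernel :: "real \<Rightarrow> real \<Rightarrow> 'a::euclidean_space \<Rightarrow> 'a \<Rightarrow> ennreal" where
  "near_kernel s r x y = riesz_kernel s x y * indicator {y. dist x y < r} y"

text \<open>Truncated in height rather than cut off at distance r, so that it is bounded, continuous
  and below the Riesz kernel. The sum with the near part therefore exceeds the Riesz kernel at short
  distance, which is harmless for upper bounds.\<close>

definition far_kernel :: "real \<Rightarrow> real \<Rightarrow> 'a::euclidean_space \<Rightarrow> 'a \<Rightarrow> ennreal" where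
  "far_kernel s r x y = min (riesz_kernel s x y) (ennreal (r powr - s))"

lemma near_kernel_measurable [measurable]:
  "(\<lambda>(x, y). near_kernel s r x (y :: 'a::euclidean_space)) \<in> borel_measurable (borel \<Otimes>\<^sub>M borel)"
  unfolding near_kernel_def indicator_def by measurable

lemma far_kernel_measurable [measurable]:
  "(\<lambda>(x, y). far_kernel s r x (y :: 'a::euclidean_space)) \<in> borel_measurable (borel \<Otimes>\<^sub>M borel)"
  unfolding far_kernel_def by measurable

lemma near_kernel_commute: "near_kernel s r x y = near_kernel s r y x"
  by (simp add: near_kernel_def riesz_kernel_commute[of s x] dist_commute indicator_def)

lemma riesz_kernel_le_near_far:
  assumes "0 < s" "0 < r"
  shows "riesz_kernel s x y \<le> near_kernel s r x y + far_kernel s r x y"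
  using riesz_kernel_le[OF assms, of x y]
  by (auto simp: near_kernel_def far_kernel_def indicator_def dist_norm min_def not_less)

lemma interaction_mono:
  assumes "\<And>x y. k x y \<le> k' x y"
  shows "interaction k f g \<le> interaction k' f g"
  unfolding interaction_def using assms by (intro nn_integral_mono mult_left_mono) auto

lemma interaction_add_kernel:
  fixes k k' :: "'a::euclidean_space \<Rightarrow> 'a \<Rightarrow> ennreal"
  assumes [measurable]: "(\<lambda>(x, y). k x y) \<in> borel_measurable (borel \<Otimes>\<^sub>M borel)"
    "(\<lambda>(x, y). k' x y) \<in> borel_measurable (borel \<Otimes>\<^sub>M borel)"
    "f \<in> borel_measurable borel" "g \<in> borel_measurable borel"
  shows "interaction (\<lambda>x y. k x y + k' x y) f g = interaction k f g + interaction k' f g"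
proof -
  have 1: "(\<lambda>y. ennreal (f x) * ennreal (g y) * k x y) \<in> borel_measurable lborel"
    "(\<lambda>y. ennreal (f x) * ennreal (g y) * k' x y) \<in> borel_measurable lborel" for x
    by measurable
  have 2: "(\<lambda>x. \<integral>\<^sup>+y. ennreal (f x) * ennreal (g y) * k x y \<partial>lborel) \<in> borel_measurable lborel"
    "(\<lambda>x. \<integral>\<^sup>+y. ennreal (f x) * ennreal (g y) * k' x y \<partial>lborel) \<in> borel_measurable lborel"
    by measurable
  show ?thesis
    unfolding interaction_def distrib_left nn_integral_add[OF 1] nn_integral_add[OF 2] ..
qed

lemma near_interaction_le:
  fixes \<rho> :: "'a::euclidean_space \<Rightarrow> real"
  assumes s: "0 < s" "s < real DIM('a)" and \<rho>: "\<rho> \<in> borel_measurable borel" "\<And>x. 0 \<le> \<rho> x"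
    and m: "0 < m" "\<And>x. (\<integral>\<^sup>+y\<in>ball x r. ennreal (\<rho> y) \<partial>lborel) \<le> ennreal m"
  shows "interaction (near_kernel s r) \<rho> \<rho> \<le>
    ennreal (2 * (riesz_const TYPE('a) s + 1) * m powr (1 - s / real DIM('a))) * power_mass s \<rho>"
proof -
  have "{y. dist x y < r} = ball x r" for x :: 'a by auto
  then show ?thesis
    using riesz_energy_le[OF s, of "\<lambda>x y. dist x y < r" \<rho> m] \<rho> m
    by (simp add: interaction_def near_kernel_def power_mass_def mult.assoc dist_commute)
qed

text \<open>The exponent 1 - s/d is not 0, so the mass at which the energy constant takes a
  prescribed value can be solved for.\<close>

lemma energy_threshold:
  assumes s: "0 < s" "s < real DIM('a::euclidean_space)" and \<epsilon>: "0 < \<epsilon>"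
  obtains m where "0 < m" "2 * (riesz_const TYPE('a) s + 1) * m powr (1 - s / real DIM('a)) = \<epsilon>"
proof -
  define C where "C = 2 * (riesz_const TYPE('a) s + 1)"
  have C: "C > 0" using riesz_const_pos[OF s(2)] by (simp add: C_def)
  have "1 - s / real DIM('a) \<noteq> 0" using s by (simp add: field_simps)
  then have "C * ((\<epsilon> / C) powr (1 / (1 - s / real DIM('a)))) powr (1 - s / real DIM('a)) = \<epsilon>"
    using C \<epsilon> by (simp add: powr_powr)
  moreover have "0 < (\<epsilon> / C) powr (1 / (1 - s / real DIM('a)))" using C \<epsilon> by simp
  ultimately show thesis using that unfolding C_def by blast
qed

text \<open>A bounded power mass forces balls of small radius to carry little mass, uniformly in the
  density and the centre, and then the energy of close pairs is small. This uniformity allows the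
  singular part of the kernel to be removed before the limit.\<close>

lemma near_interaction_small:
  assumes s: "0 < s" "s < real DIM('a::euclidean_space)" and \<epsilon>: "0 < \<epsilon>"
  shows "\<exists>r>0. \<forall>\<rho> :: 'a \<Rightarrow> real. \<rho> \<in> borel_measurable borel \<longrightarrow> (\<forall>x. 0 \<le> \<rho> x) \<longrightarrow>
     power_mass s \<rho> \<le> 1 \<longrightarrow> interaction (near_kernel s r) \<rho> \<rho> \<le> ennreal \<epsilon>"
proof -
  define d where "d = real DIM('a)"
  define v where "v = unit_ball_vol d"
  have d: "d > 0" and v: "v > 0" by (simp_all add: d_def v_def)
  obtain m where m: "0 < m" "2 * (riesz_const TYPE('a) s + 1) * m powr (1 - s / real DIM('a)) = \<epsilon>"
    using energy_threshold[OF s \<epsilon>] .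
  \<comment> \<open>T makes the part of the density above height T contribute at most m/2; r below
    makes a ball of radius r contribute m/2 through the part below height T.\<close>
  define T where "T = (m / 2) powr - (d / s)"
  have T: "T > 0" "T powr - (s / d) = m / 2" using m s d by (auto simp: T_def powr_powr)
  define r where "r = (m / (2 * T * v)) powr (1 / d)"
  have r: "r > 0" using m T v by (simp add: r_def)
  have rd: "T * (v * r ^ DIM('a)) = m / 2"
  proof -
    have "r ^ DIM('a) = r powr d" using r by (simp add: d_def powr_realpow)
    also have "\<dots> = m / (2 * T * v)" using m T v d by (simp add: r_def powr_powr)
    finally show ?thesis using T v by simp
  qed
  have "interaction (near_kernel s r) \<rho> \<rho> \<le> ennreal \<epsilon>"
    if \<rho>: "\<rho> \<in> borel_measurable borel" "\<And>x. 0 \<le> \<rho> x" and pm: "power_mass s \<rho> \<le> 1" for \<rho> :: "'a \<Rightarrow> real"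
  proof -
    have "(\<integral>\<^sup>+y\<in>ball x r. ennreal (\<rho> y) \<partial>lborel) \<le> ennreal m" for x
    proof -
      have "(\<integral>\<^sup>+y\<in>ball x r. ennreal (\<rho> y) \<partial>lborel) \<le>
          ennreal T * emeasure lborel (ball x r) + ennreal (T powr - (s / real DIM('a))) * power_mass s \<rho>"
        by (rule mass_le_power_mass) (use s \<rho> T in auto)
      also have "\<dots> \<le> ennreal T * emeasure lborel (ball x r) + ennreal (T powr - (s / real DIM('a))) * 1"
        by (intro add_mono order_refl mult_left_mono pm) auto
      also have "\<dots> = ennreal (T * (v * r ^ DIM('a)) + m / 2)"
        using r T v m by (subst emeasure_lborel_ball) (auto simp: T(2)[unfolded d_def] v_def d_def simp flip: ennreal_mult)
      finally show ?thesis by (simp add: rd)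
    qed
    then have "interaction (near_kernel s r) \<rho> \<rho> \<le> ennreal \<epsilon> * power_mass s \<rho>"
      using near_interaction_le[OF s \<rho> m(1), of r] m(2) by simp
    also have "\<dots> \<le> ennreal \<epsilon> * 1" by (intro mult_left_mono pm) auto
    finally show ?thesis by simp
  qed
  with r show ?thesis by blast
qed

text \<open>Excludes vanishing in the sense of concentration compactness. If all balls of radius R
  carried at most m, close pairs would contribute at most \<kappa>/4 to the energy and the others at
  most K^2 R^-s = \<kappa>/4, less than \<kappa> together.\<close>

lemma nonvanishing:
  assumes s: "0 < s" "s < real DIM('a::euclidean_space)" and \<kappa>: "0 < \<kappa>" and K: "0 < K"
  shows "\<exists>R>0. \<exists>m>0. \<forall>\<rho> :: 'a \<Rightarrow> real. \<rho> \<in> borel_measurable borel \<longrightarrow> (\<forall>x. 0 \<le> \<rho> x) \<longrightarrow>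
      power_mass s \<rho> \<le> 1 \<longrightarrow> (\<integral>\<^sup>+x. ennreal (\<rho> x) \<partial>lborel) \<le> ennreal K \<longrightarrow> ennreal \<kappa> \<le> D s \<rho> \<longrightarrow>
      (\<exists>x. ennreal m \<le> (\<integral>\<^sup>+y\<in>ball x R. ennreal (\<rho> y) \<partial>lborel))"
proof -
  define R where "R = (\<kappa> / (4 * K\<^sup>2)) powr - (1 / s)"
  have R: "R > 0" "R powr - s = \<kappa> / (4 * K\<^sup>2)" using \<kappa> K s by (auto simp: R_def powr_powr)
  obtain m where m: "0 < m" "2 * (riesz_const TYPE('a) s + 1) * m powr (1 - s / real DIM('a)) = \<kappa> / 4"
    using energy_threshold[OF s, of "\<kappa> / 4"] \<kappa> by auto
  have "\<exists>x. ennreal m \<le> (\<integral>\<^sup>+y\<in>ball x R. ennreal (\<rho> y) \<partial>lborel)"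
    if \<rho>[measurable]: "\<rho> \<in> borel_measurable borel" and nn: "\<And>x. 0 \<le> \<rho> x" and pm: "power_mass s \<rho> \<le> 1"
      and mass: "(\<integral>\<^sup>+x. ennreal (\<rho> x) \<partial>lborel) \<le> ennreal K" and D: "ennreal \<kappa> \<le> D s \<rho>" for \<rho> :: "'a \<Rightarrow> real"
  proof (rule ccontr)
    assume "\<nexists>x. ennreal m \<le> (\<integral>\<^sup>+y\<in>ball x R. ennreal (\<rho> y) \<partial>lborel)"
    then have small: "(\<integral>\<^sup>+y\<in>ball x R. ennreal (\<rho> y) \<partial>lborel) \<le> ennreal m" for x
      by (metis le_cases)
    have "ennreal \<kappa> \<le> interaction (\<lambda>x y. near_kernel s R x y + far_kernel s R x y) \<rho> \<rho>"
      using D unfolding D_eq_interaction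
      by (rule order_trans) (intro interaction_mono riesz_kernel_le_near_far s R)
    also have "\<dots> = interaction (near_kernel s R) \<rho> \<rho> + interaction (far_kernel s R) \<rho> \<rho>"
      by (rule interaction_add_kernel) measurable
    also have "\<dots> \<le> ennreal (\<kappa> / 4) * 1 + ennreal (\<kappa> / 4)"
    proof (intro add_mono)
      have "interaction (near_kernel s R) \<rho> \<rho> \<le> ennreal (\<kappa> / 4) * power_mass s \<rho>"
        using near_interaction_le[OF s \<rho> nn m(1) small] unfolding m(2) .
      also have "\<dots> \<le> ennreal (\<kappa> / 4) * 1" by (intro mult_left_mono pm) auto
      finally show "interaction (near_kernel s R) \<rho> \<rho> \<le> ennreal (\<kappa> / 4) * 1" .
      have "interaction (far_kernel s R) \<rho> \<rho> \<le> interaction (\<lambda>x y. ennreal (R powr - s)) \<rho> \<rho>"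
        by (intro interaction_mono) (simp add: far_kernel_def)
      also have "\<dots> = (\<integral>\<^sup>+x. ennreal (\<rho> x) \<partial>lborel) * ((\<integral>\<^sup>+x. ennreal (\<rho> x) \<partial>lborel) * ennreal (R powr - s))"
        by (subst interaction_inner) (simp_all add: nn_integral_multc)
      also have "\<dots> \<le> ennreal K * (ennreal K * ennreal (R powr - s))"
        by (intro mult_mono mass) auto
      also have "\<dots> = ennreal (\<kappa> / 4)"
        using K \<kappa> by (simp add: R power2_eq_square flip: ennreal_mult)
      finally show "interaction (far_kernel s R) \<rho> \<rho> \<le> ennreal (\<kappa> / 4)" .
    qed
    also have "\<dots> = ennreal (\<kappa> / 2)" using \<kappa> by (simp flip: ennreal_plus)
    finally show False using \<kappa> by (simp add: ennreal_le_iff)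
  qed
  with R(1) m(1) show ?thesis by blast
qed

text \<open>Dominated convergence twice, once for each of two independent copies; the constant bound
  on the kernel is the majorant. The limit \<open>l\<close> is left open because it is the kernel at
  the limit points when both particles stay and 0 when one of them escapes.\<close>

lemma interaction_limit:
  fixes k :: "'a::euclidean_space \<Rightarrow> 'a \<Rightarrow> ennreal" and Y :: "nat \<Rightarrow> nat \<Rightarrow> 'b \<Rightarrow> 'a"
  assumes k[measurable]: "(\<lambda>(x, y). k x y) \<in> borel_measurable (borel \<Otimes>\<^sub>M borel)" and kC: "\<And>x y. k x y \<le> ennreal C"
    and gc: "\<And>n. gc_state N M (Y n) S (a n)" and gc': "\<And>n. gc_state N M (Y n) S' (b n)"
    and lim: "\<And>i j. i < N \<Longrightarrow> j < N \<Longrightarrow> AE \<omega> in M. AE \<omega>' in M. \<omega> \<in> S i \<longrightarrow> \<omega>' \<in> S' j \<longrightarrow>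
        (\<lambda>n. k (Y n i \<omega>) (Y n j \<omega>')) \<longlonglongrightarrow> l i j \<omega> \<omega>'"
    and lm: "\<And>i j. i < N \<Longrightarrow> j < N \<Longrightarrow> (\<lambda>(\<omega>, \<omega>'). l i j \<omega> \<omega>') \<in> borel_measurable (M \<Otimes>\<^sub>M M)"
  shows "(\<lambda>n. interaction k (a n) (b n)) \<longlonglongrightarrow>
     (\<Sum>i<N. \<Sum>j<N. \<integral>\<^sup>+\<omega>\<in>S i. (\<integral>\<^sup>+\<omega>'\<in>S' j. l i j \<omega> \<omega>' \<partial>M) \<partial>M)"
  unfolding gc_state_interaction[OF k gc gc']
proof (intro tendsto_sum)
  interpret M: prob_space M using gc_stateD(1)[OF gc] .
  fix i j assume "i \<in> {..<N}" "j \<in> {..<N}"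
  then have ij: "i < N" "j < N" by auto
  note [measurable] = gc_stateD(2)[OF gc ij(1)] gc_stateD(2)[OF gc ij(2)] gc_stateD(3)[OF gc ij(1)]
    gc_stateD(3)[OF gc' ij(2)] lm[OF ij]
  have [measurable]: "l i j \<omega> \<in> borel_measurable M" if "\<omega> \<in> space M" for \<omega>
    using measurable_compose[OF measurable_Pair1'[OF that] lm[OF ij]] by simp
  have C1: "(\<integral>\<^sup>+\<omega>. ennreal C \<partial>M) < \<infinity>" by (simp add: M.emeasure_space_1)
  show "(\<lambda>n. \<integral>\<^sup>+\<omega>\<in>S i. (\<integral>\<^sup>+\<omega>'\<in>S' j. k (Y n i \<omega>) (Y n j \<omega>') \<partial>M) \<partial>M)
      \<longlonglongrightarrow> (\<integral>\<^sup>+\<omega>\<in>S i. (\<integral>\<^sup>+\<omega>'\<in>S' j. l i j \<omega> \<omega>' \<partial>M) \<partial>M)"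
  proof (rule nn_integral_dominated_convergence[where w = "\<lambda>_. ennreal C"])
    show "AE \<omega> in M. (\<lambda>n. (\<integral>\<^sup>+\<omega>'\<in>S' j. k (Y n i \<omega>) (Y n j \<omega>') \<partial>M) * indicator (S i) \<omega>)
       \<longlonglongrightarrow> (\<integral>\<^sup>+\<omega>'\<in>S' j. l i j \<omega> \<omega>' \<partial>M) * indicator (S i) \<omega>"
      using lim[OF ij] AE_space
    proof eventually_elim
      case (elim \<omega>)
      note \<omega>[measurable] = elim(2)
      show ?case
      proof (cases "\<omega> \<in> S i")
        case True
        have "(\<lambda>n. \<integral>\<^sup>+\<omega>'\<in>S' j. k (Y n i \<omega>) (Y n j \<omega>') \<partial>M) \<longlonglongrightarrow> (\<integral>\<^sup>+\<omega>'\<in>S' j. l i j \<omega> \<omega>' \<partial>M)"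
        proof (rule nn_integral_dominated_convergence[where w = "\<lambda>_. ennreal C"])
          show "AE \<omega>' in M. (\<lambda>n. k (Y n i \<omega>) (Y n j \<omega>') * indicator (S' j) \<omega>') \<longlonglongrightarrow> l i j \<omega> \<omega>' * indicator (S' j) \<omega>'"
            using elim(1) by eventually_elim (use True in \<open>auto simp: indicator_def\<close>)
          show "AE \<omega>' in M. k (Y n i \<omega>) (Y n j \<omega>') * indicator (S' j) \<omega>' \<le> ennreal C" for n
            using kC by (auto simp: indicator_def)
        qed (use C1 in measurable)
        then show ?thesis using True by simp
      qed simp
    qed
    show "AE \<omega> in M. (\<integral>\<^sup>+\<omega>'\<in>S' j. k (Y n i \<omega>) (Y n j \<omega>') \<partial>M) * indicator (S i) \<omega> \<le> ennreal C" for n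
    proof (intro AE_I2)
      fix \<omega>
      have "(\<integral>\<^sup>+\<omega>'\<in>S' j. k (Y n i \<omega>) (Y n j \<omega>') \<partial>M) \<le> (\<integral>\<^sup>+\<omega>'. ennreal C \<partial>M)"
        using kC by (intro nn_integral_mono) (auto simp: indicator_def)
      then show "(\<integral>\<^sup>+\<omega>'\<in>S' j. k (Y n i \<omega>) (Y n j \<omega>') \<partial>M) * indicator (S i) \<omega> \<le> ennreal C"
        by (auto simp: M.emeasure_space_1 indicator_def)
    qed
  qed (use C1 in measurable)
qed

lemma power_mass_cong_AE:
  assumes "AE x in lborel. f x = g x"
  shows "power_mass s f = power_mass s g"
  unfolding power_mass_def using assms by (intro nn_integral_cong_AE) auto

text \<open>Densities of parts of a state come from Radon-Nikodym and are chosen freely, so their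
  sum agrees with the given density only almost everywhere.\<close>

lemma gc_state_unique:
  fixes X :: "nat \<Rightarrow> 'b \<Rightarrow> 'a::euclidean_space"
  assumes gc: "gc_state N M X S \<rho>" and gc': "gc_state N M X S \<rho>'"
  shows "AE x in lborel. \<rho> x = \<rho>' x"
proof -
  have [measurable]: "\<rho> \<in> borel_measurable borel" "\<rho>' \<in> borel_measurable borel"
    using gc_stateD(4)[OF gc] gc_stateD(4)[OF gc'] by auto
  have "density lborel (\<lambda>x. ennreal (\<rho> x)) = density lborel (\<lambda>x. ennreal (\<rho>' x))"
  proof (rule measure_eqI)
    fix A assume "A \<in> sets (density lborel (\<lambda>x. ennreal (\<rho> x)))"
    then have [measurable]: "A \<in> sets borel" by simp
    show "emeasure (density lborel (\<lambda>x. ennreal (\<rho> x))) A = emeasure (density lborel (\<lambda>x. ennreal (\<rho>' x))) A"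
      using gc_stateD(6)[OF gc, of "indicator A"] gc_stateD(6)[OF gc', of "indicator A"]
      by (simp add: emeasure_density)
  qed simp
  then have "AE x in lborel. ennreal (\<rho> x) = ennreal (\<rho>' x)"
    by (subst (asm) sigma_finite_measure.density_unique_iff[OF sigma_finite_lborel]) auto
  then show ?thesis
    by eventually_elim (use gc_stateD(5)[OF gc] gc_stateD(5)[OF gc'] in auto)
qed

lemma gc_state_union:
  fixes X :: "nat \<Rightarrow> 'b \<Rightarrow> 'a::euclidean_space"
  assumes gc: "gc_state N M X S \<rho>" and gc': "gc_state N M X S' \<rho>'" and disj: "\<And>i. i < N \<Longrightarrow> S i \<inter> S' i = {}"
  shows "gc_state N M X (\<lambda>i. S i \<union> S' i) (\<lambda>x. \<rho> x + \<rho>' x)"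
proof -
  have [measurable]: "\<rho> \<in> borel_measurable borel" "\<rho>' \<in> borel_measurable borel"
    using gc_stateD(4)[OF gc] gc_stateD(4)[OF gc'] by auto
  show ?thesis
    unfolding gc_state_def
  proof (intro conjI ballI allI impI)
    fix f :: "'a \<Rightarrow> ennreal" assume f[measurable]: "f \<in> borel_measurable borel"
    have "(\<integral>\<^sup>+x. ennreal (\<rho> x + \<rho>' x) * f x \<partial>lborel) = (\<integral>\<^sup>+x. ennreal (\<rho> x) * f x \<partial>lborel) + (\<integral>\<^sup>+x. ennreal (\<rho>' x) * f x \<partial>lborel)"
      using gc_stateD(5)[OF gc] gc_stateD(5)[OF gc'] by (simp add: distrib_right nn_integral_add)
    also have "\<dots> = (\<Sum>i<N. (\<integral>\<^sup>+\<omega>\<in>S i. f (X i \<omega>) \<partial>M) + (\<integral>\<^sup>+\<omega>\<in>S' i. f (X i \<omega>) \<partial>M))"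
      unfolding gc_stateD(6)[OF gc f] gc_stateD(6)[OF gc' f] by (simp add: sum.distrib)
    also have "\<dots> = (\<Sum>i<N. \<integral>\<^sup>+\<omega>\<in>S i \<union> S' i. f (X i \<omega>) \<partial>M)"
    proof (rule sum.cong[OF refl])
      fix i assume "i \<in> {..<N}"
      then have i: "i < N" by simp
      note [measurable] = gc_stateD(2)[OF gc i] gc_stateD(3)[OF gc i] gc_stateD(3)[OF gc' i]
      show "(\<integral>\<^sup>+\<omega>\<in>S i. f (X i \<omega>) \<partial>M) + (\<integral>\<^sup>+\<omega>\<in>S' i. f (X i \<omega>) \<partial>M) = (\<integral>\<^sup>+\<omega>\<in>S i \<union> S' i. f (X i \<omega>) \<partial>M)"
        using disj[OF i] by (subst nn_integral_add[symmetric]) (auto intro!: nn_integral_cong split: split_indicator)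
    qed
    finally show "(\<integral>\<^sup>+x. ennreal (\<rho> x + \<rho>' x) * f x \<partial>lborel) = (\<Sum>i<N. \<integral>\<^sup>+\<omega>\<in>S i \<union> S' i. f (X i \<omega>) \<partial>M)" .
  qed (use gc_stateD[OF gc] gc_stateD[OF gc'] in auto)
qed


text \<open>Absolute continuity survives the limit by equi-integrability. Enclose a null set in an
  open set of volume at most T^-2. Particles converging into the null set eventually enter the open
  set, whose mass is at most T times T^-2 plus T^(-s/d), uniformly in n; then let T grow.\<close>

lemma gc_limit_density_exists:
  fixes Y :: "nat \<Rightarrow> nat \<Rightarrow> 'b \<Rightarrow> 'a::euclidean_space"
  assumes s: "0 < s" and gc: "\<And>n. gc_state N M (Y n) S (a n)" and pm: "\<And>n. power_mass s (a n) \<le> 1"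
    and Z: "\<And>i. i < N \<Longrightarrow> Z i \<in> borel_measurable M"
    and lim: "\<And>i. i < N \<Longrightarrow> AE \<omega> in M. \<omega> \<in> S i \<longrightarrow> (\<lambda>n. Y n i \<omega>) \<longlonglongrightarrow> Z i \<omega>"
  obtains \<rho> where "gc_state N M Z S \<rho>"
proof (rule gc_density_exists[of M N Z S])
  define q where "q = s / real DIM('a)"
  have q: "q > 0" using s by (simp add: q_def)
  fix i and A :: "'a set" assume i: "i < N" and A[measurable]: "A \<in> sets borel" and A0: "emeasure lborel A = 0"
  note [measurable] = Z[OF i] gc_stateD(3)[OF gc i] gc_stateD(2)[OF gc i]
  have bound: "(\<integral>\<^sup>+\<omega>\<in>S i. indicator A (Z i \<omega>) \<partial>M) \<le> 0 + ennreal (1 / real T + real T powr - q)" if T: "1 \<le> T" for T :: nat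
  proof -
    obtain U where U: "open U" "A \<subseteq> U" "emeasure lborel (U - A) < ennreal (1 / real T ^ 2)"
      using outer_regular_lborel[OF A, of "1 / real T ^ 2"] T by auto
    have [measurable]: "U \<in> sets borel" using U by simp
    have "emeasure lborel U = emeasure lborel (A \<union> (U - A))" using U by (simp add: Un_absorb1)
    also have "\<dots> \<le> emeasure lborel A + emeasure lborel (U - A)" by (rule emeasure_subadditive) auto
    also have "\<dots> \<le> ennreal (1 / real T ^ 2)" using A0 U by simp
    finally have Uvol: "emeasure lborel U \<le> ennreal (1 / real T ^ 2)" .
    have "(\<integral>\<^sup>+\<omega>\<in>S i. indicator A (Z i \<omega>) \<partial>M) \<le> (\<integral>\<^sup>+\<omega>. liminf (\<lambda>n. indicator U (Y n i \<omega>) * indicator (S i) \<omega>) \<partial>M)"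
    proof (rule nn_integral_mono_AE)
      show "AE \<omega> in M. indicator A (Z i \<omega>) * indicator (S i) \<omega> \<le> liminf (\<lambda>n. indicator U (Y n i \<omega>) * indicator (S i) \<omega> :: ennreal)"
        using lim[OF i]
      proof eventually_elim
        case (elim \<omega>)
        show ?case
        proof (cases "\<omega> \<in> S i \<and> Z i \<omega> \<in> A")
          case True
          then have "eventually (\<lambda>n. Y n i \<omega> \<in> U) sequentially"
            using elim U by (intro topological_tendstoD[of _ "Z i \<omega>"]) auto
          then have "(\<lambda>n. indicator U (Y n i \<omega>) * indicator (S i) \<omega> :: ennreal) \<longlonglongrightarrow> 1"
            using True by (intro tendsto_eventually) (auto elim: eventually_mono)
          then show ?thesis using True by (simp add: lim_imp_Liminf)
        qed (auto simp: indicator_def)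
      qed
    qed
    also have "\<dots> \<le> liminf (\<lambda>n. \<integral>\<^sup>+\<omega>\<in>S i. indicator U (Y n i \<omega>) \<partial>M)"
      by (intro nn_integral_liminf) measurable
    also have "\<dots> \<le> liminf (\<lambda>n::nat. ennreal (1 / real T + real T powr - q))"
    proof (intro Liminf_mono always_eventually allI)
      fix n
      have [measurable]: "a n \<in> borel_measurable borel" using gc_stateD(4)[OF gc] .
      have "(\<integral>\<^sup>+\<omega>\<in>S i. indicator U (Y n i \<omega>) \<partial>M) \<le> (\<Sum>i<N. \<integral>\<^sup>+\<omega>\<in>S i. indicator U (Y n i \<omega>) \<partial>M)"
        using i by (intro member_le_sum) auto
      also have "\<dots> = (\<integral>\<^sup>+x\<in>U. ennreal (a n x) \<partial>lborel)"
        by (rule gc_stateD(6)[OF gc, symmetric]) simp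
      also have "\<dots> \<le> ennreal (real T) * emeasure lborel U + ennreal (real T powr - q) * power_mass s (a n)"
        unfolding q_def using T by (intro mass_le_power_mass s) auto
      also have "\<dots> \<le> ennreal (real T) * ennreal (1 / real T ^ 2) + ennreal (real T powr - q) * 1"
        by (intro add_mono mult_left_mono Uvol pm) auto
      also have "\<dots> = ennreal (1 / real T + real T powr - q)"
        using T by (simp add: power2_eq_square flip: ennreal_mult ennreal_plus)
      finally show "(\<integral>\<^sup>+\<omega>\<in>S i. indicator U (Y n i \<omega>) \<partial>M) \<le> ennreal (1 / real T + real T powr - q)" .
    qed
    also have "\<dots> = ennreal (1 / real T + real T powr - q)" by (simp add: Liminf_const)
    finally show ?thesis by simp
  qed
  have "(\<lambda>T. 1 / real T + real T powr - q) \<longlonglongrightarrow> 0 + 0"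
    using q tendsto_neg_powr[OF _ filterlim_real_sequentially, of "- q"] by (intro tendsto_add lim_1_over_n) auto
  then have "(\<integral>\<^sup>+\<omega>\<in>S i. indicator A (Z i \<omega>) \<partial>M) \<le> 0"
    using bound by (intro ennreal_le_add_vanishing[of _ 0 "\<lambda>T. 1 / real T + real T powr - q"]) auto
  then show "(\<integral>\<^sup>+\<omega>\<in>S i. indicator A (Z i \<omega>) \<partial>M) = 0" by simp
qed (use gc_stateD[OF gc] Z that in auto)

text \<open>Fatou's lemma. The Riesz kernel is continuous into the extended half-line also on the
  diagonal, so the integrand converges even where limits of two particles coincide.\<close>

lemma pair_cost_liminf:
  fixes Y :: "nat \<Rightarrow> nat \<Rightarrow> 'b \<Rightarrow> 'a::euclidean_space"
  assumes s: "0 < s" and Y: "\<And>n i. i < N \<Longrightarrow> Y n i \<in> borel_measurable M" and S: "\<And>i. i < N \<Longrightarrow> S i \<in> sets M"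
    and lim: "\<And>i. i < N \<Longrightarrow> AE \<omega> in M. \<omega> \<in> S i \<longrightarrow> (\<lambda>n. Y n i \<omega>) \<longlonglongrightarrow> Z i \<omega>"
  shows "pair_cost s N M Z S \<le> liminf (\<lambda>n. pair_cost s N M (Y n) S)"
proof -
  have "AE \<omega> in M. \<forall>i\<in>{..<N}. \<omega> \<in> S i \<longrightarrow> (\<lambda>n. Y n i \<omega>) \<longlonglongrightarrow> Z i \<omega>"
    using lim by (intro AE_finite_allI) auto
  then have "pair_cost s N M Z S = (\<integral>\<^sup>+\<omega>. liminf (\<lambda>n. \<Sum>i<N. \<Sum>j<N. if i \<noteq> j
     then indicator (S i) \<omega> * indicator (S j) \<omega> * riesz_kernel s (Y n i \<omega>) (Y n j \<omega>) else 0) \<partial>M)"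
    unfolding pair_cost_def
  proof (intro nn_integral_cong_AE, eventually_elim)
    case (elim \<omega>)
    have "(\<lambda>n. \<Sum>i<N. \<Sum>j<N. if i \<noteq> j
       then indicator (S i) \<omega> * indicator (S j) \<omega> * riesz_kernel s (Y n i \<omega>) (Y n j \<omega>) else 0) \<longlonglongrightarrow>
       (\<Sum>i<N. \<Sum>j<N. if i \<noteq> j
       then indicator (S i) \<omega> * indicator (S j) \<omega> * riesz_kernel s (Z i \<omega>) (Z j \<omega>) else 0)"
    proof (intro tendsto_sum)
      fix i j assume ij: "i \<in> {..<N}" "j \<in> {..<N}"
      show "(\<lambda>n. if i \<noteq> j then indicator (S i) \<omega> * indicator (S j) \<omega> * riesz_kernel s (Y n i \<omega>) (Y n j \<omega>) else 0)
         \<longlonglongrightarrow> (if i \<noteq> j then indicator (S i) \<omega> * indicator (S j) \<omega> * riesz_kernel s (Z i \<omega>) (Z j \<omega>) else 0)"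
      proof (cases "i \<noteq> j \<and> \<omega> \<in> S i \<and> \<omega> \<in> S j")
        case True
        then show ?thesis using elim ij by (simp add: tendsto_riesz_kernel[OF s])
      qed auto
    qed
    then show ?case by (rule lim_imp_Liminf[OF sequentially_bot, symmetric])
  qed
  also have "\<dots> \<le> liminf (\<lambda>n. pair_cost s N M (Y n) S)"
    unfolding pair_cost_def
  proof (rule nn_integral_liminf)
    fix n
    have "(\<lambda>\<omega>. if i \<noteq> j then indicator (S i) \<omega> * indicator (S j) \<omega> * riesz_kernel s (Y n i \<omega>) (Y n j \<omega>) else 0)
        \<in> borel_measurable M" if "i < N" "j < N" for i j
    proof -
      note [measurable] = Y[OF that(1)] Y[OF that(2)] S[OF that(1)] S[OF that(2)]
      show ?thesis by measurable
    qed
    then show "(\<lambda>\<omega>. \<Sum>i<N. \<Sum>j<N. if i \<noteq> j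
       then indicator (S i) \<omega> * indicator (S j) \<omega> * riesz_kernel s (Y n i \<omega>) (Y n j \<omega>) else 0) \<in> borel_measurable M"
      by (intro borel_measurable_sum) auto
  qed
  finally show ?thesis .
qed

text \<open>Integrals of a continuous test function against the density are expectations over the
  particles, which converge pointwise. Fatou's lemma thus supplies the test hypothesis of
  \<open>power_mass_liminf\<close>.\<close>

lemma power_mass_gc_liminf:
  fixes Y :: "nat \<Rightarrow> nat \<Rightarrow> 'b \<Rightarrow> 'a::euclidean_space"
  assumes s: "0 < s" and gc: "\<And>n. gc_state N M (Y n) S (a n)" and gcZ: "gc_state N M Z S \<rho>"
    and lim: "\<And>i. i < N \<Longrightarrow> AE \<omega> in M. \<omega> \<in> S i \<longrightarrow> (\<lambda>n. Y n i \<omega>) \<longlonglongrightarrow> Z i \<omega>"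
  shows "power_mass s \<rho> \<le> liminf (\<lambda>n. power_mass s (a n))"
proof (rule power_mass_liminf[OF s gc_stateD(4)[OF gcZ] gc_stateD(4)[OF gc] gc_stateD(5)[OF gcZ] gc_stateD(5)[OF gc]])
  fix g :: "'a \<Rightarrow> real" assume g: "continuous_on UNIV g" "\<And>x. 0 \<le> g x"
  have [measurable]: "g \<in> borel_measurable borel" using g by (intro borel_measurable_continuous_onI)
  have gm: "(\<lambda>x. ennreal (g x)) \<in> borel_measurable borel" by measurable
  have "(\<integral>\<^sup>+x. ennreal (\<rho> x) * ennreal (g x) \<partial>lborel) = (\<Sum>i<N. \<integral>\<^sup>+\<omega>\<in>S i. ennreal (g (Z i \<omega>)) \<partial>M)"
    by (rule gc_stateD(6)[OF gcZ gm])
  also have "\<dots> \<le> (\<Sum>i<N. liminf (\<lambda>n. \<integral>\<^sup>+\<omega>\<in>S i. ennreal (g (Y n i \<omega>)) \<partial>M))"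
  proof (intro sum_mono)
    fix i assume "i \<in> {..<N}"
    then have i: "i < N" by simp
    note [measurable] = gc_stateD(2,3)[OF gc i]
    have "(\<integral>\<^sup>+\<omega>\<in>S i. ennreal (g (Z i \<omega>)) \<partial>M) = (\<integral>\<^sup>+\<omega>. liminf (\<lambda>n. ennreal (g (Y n i \<omega>)) * indicator (S i) \<omega>) \<partial>M)"
    proof (rule nn_integral_cong_AE)
      show "AE \<omega> in M. ennreal (g (Z i \<omega>)) * indicator (S i) \<omega> = liminf (\<lambda>n. ennreal (g (Y n i \<omega>)) * indicator (S i) \<omega>)"
        using lim[OF i]
      proof eventually_elim
        case (elim \<omega>)
        show ?case
        proof (cases "\<omega> \<in> S i")
          case True
          then have "(\<lambda>n. ennreal (g (Y n i \<omega>))) \<longlonglongrightarrow> ennreal (g (Z i \<omega>))"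
            using elim by (intro tendsto_ennrealI continuous_on_tendsto_compose[OF g(1)]) auto
          then show ?thesis
            using True by (simp add: lim_imp_Liminf[OF sequentially_bot])
        qed (simp add: Liminf_const)
      qed
    qed
    also have "\<dots> \<le> liminf (\<lambda>n. \<integral>\<^sup>+\<omega>\<in>S i. ennreal (g (Y n i \<omega>)) \<partial>M)"
      by (intro nn_integral_liminf) measurable
    finally show "(\<integral>\<^sup>+\<omega>\<in>S i. ennreal (g (Z i \<omega>)) \<partial>M) \<le> liminf (\<lambda>n. \<integral>\<^sup>+\<omega>\<in>S i. ennreal (g (Y n i \<omega>)) \<partial>M)" .
  qed
  also have "\<dots> \<le> liminf (\<lambda>n. \<Sum>i<N. \<integral>\<^sup>+\<omega>\<in>S i. ennreal (g (Y n i \<omega>)) \<partial>M)"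
    by (rule liminf_sum_le) simp
  also have "\<dots> = liminf (\<lambda>n. \<integral>\<^sup>+x. ennreal (a n x) * ennreal (g x) \<partial>lborel)"
    by (simp only: gc_stateD(6)[OF gc gm])
  finally show "(\<integral>\<^sup>+x. ennreal (\<rho> x) * ennreal (g x) \<partial>lborel) \<le> liminf (\<lambda>n. \<integral>\<^sup>+x. ennreal (a n x) * ennreal (g x) \<partial>lborel)" .
qed

lemma riesz_kernel_tendsto_0:
  assumes s: "0 < s" and X: "X \<longlonglongrightarrow> x" and Y: "filterlim (\<lambda>n. norm (Y n)) at_top sequentially"
  shows "(\<lambda>n. riesz_kernel s (X n) (Y n)) \<longlonglongrightarrow> 0"
proof -
  have "filterlim (\<lambda>n. - norm (X n) + norm (Y n)) at_top sequentially"
    by (rule filterlim_tendsto_add_at_top[OF tendsto_minus[OF tendsto_norm[OF X]] Y])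
  then have far: "filterlim (\<lambda>n. norm (X n - Y n)) at_top sequentially"
  proof (rule filterlim_at_top_mono)
    show "eventually (\<lambda>n. - norm (X n) + norm (Y n) \<le> norm (X n - Y n)) sequentially"
    proof (intro always_eventually allI)
      fix n show "- norm (X n) + norm (Y n) \<le> norm (X n - Y n)"
        using norm_triangle_ineq2[of "Y n" "X n"] by (simp add: norm_minus_commute)
    qed
  qed
  have "(\<lambda>n. ennreal (norm (X n - Y n) powr - s)) \<longlonglongrightarrow> ennreal 0"
    using s by (intro tendsto_ennrealI tendsto_neg_powr[OF _ far]) auto
  moreover have "eventually (\<lambda>n. ennreal (norm (X n - Y n) powr - s) = riesz_kernel s (X n) (Y n)) sequentially"
    using filterlim_at_top_dense[THEN iffD1, OF far, rule_format, of 0]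
    by eventually_elim (auto simp: riesz_kernel_offdiag)
  ultimately show ?thesis by (simp add: Lim_transform_eventually)
qed

lemma liminf_cmult_le:
  fixes c :: ennreal
  shows "c * liminf f \<le> liminf (\<lambda>n. c * f n)"
  unfolding liminf_SUP_INF SUP_mult_left_ennreal
  by (intro SUP_mono bexI INF_greatest mult_left_mono INF_lower) auto

lemma liminf_add_le:
  fixes f g :: "nat \<Rightarrow> ennreal"
  shows "liminf f + liminf g \<le> liminf (\<lambda>n. f n + g n)"
  using liminf_sum_le[of "UNIV :: bool set" "\<lambda>b. if b then f else g"] by (simp add: UNIV_bool add.commute)

text \<open>Pairs of one particle in \<open>S\<close> and one in the complement are dropped; their
  cost is nonnegative.\<close>

lemma pair_cost_split:
  assumes X: "\<And>i. i < N \<Longrightarrow> X i \<in> borel_measurable M" and S: "\<And>i. i < N \<Longrightarrow> S i \<in> sets M"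
  shows "pair_cost s N M X S + pair_cost s N M X (\<lambda>i. space M - S i) \<le> pair_cost s N M X (\<lambda>_. space M)"
proof -
  have S': "space M - S i \<in> sets M" if "i < N" for i using S[OF that] by auto
  have "pair_cost s N M X S + pair_cost s N M X (\<lambda>i. space M - S i) =
    (\<Sum>i<N. \<Sum>j<N. if i \<noteq> j then
       (\<integral>\<^sup>+\<omega>. indicator (S i) \<omega> * indicator (S j) \<omega> * riesz_kernel s (X i \<omega>) (X j \<omega>) \<partial>M) +
       (\<integral>\<^sup>+\<omega>. indicator (space M - S i) \<omega> * indicator (space M - S j) \<omega> * riesz_kernel s (X i \<omega>) (X j \<omega>) \<partial>M) else 0)"
    using pair_cost_eq_sum[of N X M S s, OF X S] pair_cost_eq_sum[of N X M "\<lambda>i. space M - S i" s, OF X S']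
    by (simp add: sum.distrib[symmetric]) (intro sum.cong refl, simp)
  also have "\<dots> \<le> (\<Sum>i<N. \<Sum>j<N. if i \<noteq> j then
       \<integral>\<^sup>+\<omega>. indicator (space M) \<omega> * indicator (space M) \<omega> * riesz_kernel s (X i \<omega>) (X j \<omega>) \<partial>M else 0)"
  proof (intro sum_mono)
    fix i j assume "i \<in> {..<N}" "j \<in> {..<N}"
    then have ij: "i < N" "j < N" by auto
    note [measurable] = X[OF ij(1)] X[OF ij(2)] S[OF ij(1)] S[OF ij(2)]
    have "(\<integral>\<^sup>+\<omega>. indicator (S i) \<omega> * indicator (S j) \<omega> * riesz_kernel s (X i \<omega>) (X j \<omega>) \<partial>M) +
       (\<integral>\<^sup>+\<omega>. indicator (space M - S i) \<omega> * indicator (space M - S j) \<omega> * riesz_kernel s (X i \<omega>) (X j \<omega>) \<partial>M)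
      = (\<integral>\<^sup>+\<omega>. indicator (S i) \<omega> * indicator (S j) \<omega> * riesz_kernel s (X i \<omega>) (X j \<omega>) +
         indicator (space M - S i) \<omega> * indicator (space M - S j) \<omega> * riesz_kernel s (X i \<omega>) (X j \<omega>) \<partial>M)"
      by (rule nn_integral_add[symmetric]) measurable
    also have "\<dots> \<le> (\<integral>\<^sup>+\<omega>. indicator (space M) \<omega> * indicator (space M) \<omega> * riesz_kernel s (X i \<omega>) (X j \<omega>) \<partial>M)"
      by (intro nn_integral_mono) (auto simp: indicator_def)
    finally show "(if i \<noteq> j then
       (\<integral>\<^sup>+\<omega>. indicator (S i) \<omega> * indicator (S j) \<omega> * riesz_kernel s (X i \<omega>) (X j \<omega>) \<partial>M) +
       (\<integral>\<^sup>+\<omega>. indicator (space M - S i) \<omega> * indicator (space M - S j) \<omega> * riesz_kernel s (X i \<omega>) (X j \<omega>) \<partial>M) else 0)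
      \<le> (if i \<noteq> j then
       \<integral>\<^sup>+\<omega>. indicator (space M) \<omega> * indicator (space M) \<omega> * riesz_kernel s (X i \<omega>) (X j \<omega>) \<partial>M else 0)" by simp
  qed
  also have "\<dots> = pair_cost s N M X (\<lambda>_. space M)"
    using X by (intro pair_cost_eq_sum[symmetric]) auto
  finally show ?thesis .
qed

text \<open>
  Along an optimizing sequence the particles that stay (\<open>S\<close>) decouple from those that escape. The
  escaping ones satisfy \<open>gc_bound\<close>, so they can be dropped: the limit of the others is optimal.
\<close>

lemma limit_state:
  fixes Y :: "nat \<Rightarrow> nat \<Rightarrow> 'b \<Rightarrow> 'a::euclidean_space"
  assumes s: "0 < s" "s < real DIM('a)" and N: "1 \<le> N"
    and conv: "AE \<omega> in M. \<forall>i<N. convergent (\<lambda>n. Y n i \<omega>) \<or> filterlim (\<lambda>n. norm (Y n i \<omega>)) at_top sequentially"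
    and gc: "\<And>n. gc_state N M (Y n) (\<lambda>_. space M) (\<rho> n)" and pm: "\<And>n. power_mass s (\<rho> n) = 1"
    and \<Lambda>: "Lambda TYPE('a) s N \<le> ereal l" and l: "0 \<le> l"
    and opt: "\<And>n. pair_cost s N M (Y n) (\<lambda>_. space M) + ennreal (2 * l) \<le> D s (\<rho> n) + ennreal (e n)"
    and e: "e \<longlonglongrightarrow> 0"
    and tight: "0 < m" "\<And>n. ennreal m \<le> (\<integral>\<^sup>+x\<in>ball 0 R. ennreal (\<rho> n x) \<partial>lborel)"
  obtains Z S a where "gc_state N M Z S a" "power_mass s (a :: 'a \<Rightarrow> real) < \<infinity>"
    "pair_cost s N M Z S + ennreal (2 * l) * power_mass s a \<le> D s a" "D s a < \<infinity>"
    "0 < (\<integral>\<^sup>+x. ennreal (a x) \<partial>lborel)"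
proof -
  interpret M: prob_space M using gc_stateD(1)[OF gc] .
  have Ym[measurable]: "Y n i \<in> borel_measurable M" if "i < N" for n i using gc_stateD(2)[OF gc that] .
  \<comment> \<open>Staying is expressed by the Cauchy property, a countable condition and hence
    measurable. The event does not depend on n, so one splitting serves the whole sequence.\<close>
  define S where "S i = {\<omega>\<in>space M. Cauchy (\<lambda>n. Y n i \<omega>)}" for i
  define S' where "S' i = space M - S i" for i
  define Z where "Z i \<omega> = lim (\<lambda>n. Y n i \<omega>)" for i \<omega>
  have Sm: "S i \<in> sets M" if "i < N" for i
    unfolding S_def using Ym[OF that] by (rule sets_Collect_Cauchy)
  have S'm: "S' i \<in> sets M" if "i < N" for i using Sm[OF that] by (auto simp: S'_def)
  have Zm: "Z i \<in> borel_measurable M" if "i < N" for i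
    unfolding Z_def using Ym[OF that] by (rule borel_measurable_lim_metric)
  have limS: "(\<lambda>n. Y n i \<omega>) \<longlonglongrightarrow> Z i \<omega>" if "\<omega> \<in> S i" for i \<omega>
    using that by (simp add: S_def Z_def Cauchy_convergent_iff convergent_LIMSEQ_iff)
  have limS': "AE \<omega> in M. \<omega> \<in> S' i \<longrightarrow> filterlim (\<lambda>n. norm (Y n i \<omega>)) at_top sequentially" if "i < N" for i
    using conv by eventually_elim (use that in \<open>auto simp: S'_def S_def Cauchy_convergent_iff\<close>)
  have limS_AE: "AE \<omega> in M. \<omega> \<in> S i \<longrightarrow> (\<lambda>n. Y n i \<omega>) \<longlonglongrightarrow> Z i \<omega>" for i
    using limS by simp
  have thin: "\<exists>a. \<forall>n. gc_state N M (Y n) A (a n)"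
    if A: "\<And>i. i < N \<Longrightarrow> A i \<in> sets M" for A
  proof (intro choice allI)
    fix n
    show "\<exists>a. gc_state N M (Y n) A a"
      by (rule gc_state_thinning[OF gc[of n] A sets.sets_into_space[OF A]]) (auto intro: exI)
  qed
  obtain a where a: "\<And>n. gc_state N M (Y n) S (a n)" using thin[of S, OF Sm] by blast
  obtain b where b: "\<And>n. gc_state N M (Y n) S' (b n)" using thin[of S', OF S'm] by blast
  \<comment> \<open>A version of the density that is exactly the sum of the staying and the escaping
    part; it agrees with \<rho> almost everywhere and has the same energy and power mass.\<close>
  define c where "c n x = a n x + b n x" for n x
  have [measurable]: "a n \<in> borel_measurable borel" "b n \<in> borel_measurable borel" for n
    using gc_stateD(4)[OF a] gc_stateD(4)[OF b] by auto
  have [measurable]: "c n \<in> borel_measurable borel" for n unfolding c_def by measurable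
  have a0: "0 \<le> a n x" and b0: "0 \<le> b n x" for n x using gc_stateD(5)[OF a] gc_stateD(5)[OF b] by auto
  then have c0: "0 \<le> c n x" for n x by (simp add: c_def)
  have cgc: "gc_state N M (Y n) (\<lambda>_. space M) (c n)" for n
  proof -
    have "gc_state N M (Y n) (\<lambda>i. S i \<union> S' i) (\<lambda>x. a n x + b n x)"
      by (intro gc_state_union a b) (auto simp: S'_def)
    moreover have "S i \<union> S' i = space M" for i by (auto simp: S_def S'_def)
    ultimately show ?thesis by (simp add: c_def[abs_def])
  qed
  have cpm: "power_mass s (c n) = 1" for n
    using power_mass_cong_AE[OF gc_state_unique[OF cgc gc]] pm by simp
  have cD: "D s (c n) = D s (\<rho> n)" for n
    unfolding D_eq_interaction
    by (simp only: gc_state_interaction[OF riesz_kernel_measurable_pair cgc cgc] gc_state_interaction[OF riesz_kernel_measurable_pair gc gc])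
  have pm_split: "power_mass s (a n) + power_mass s (b n) \<le> 1" for n
  proof -
    define p where "p = 1 + s / real DIM('a)"
    have p: "1 \<le> p" using s by (simp add: p_def)
    have "power_mass s (a n) + power_mass s (b n) = (\<integral>\<^sup>+x. ennreal (a n x powr p) + ennreal (b n x powr p) \<partial>lborel)"
      unfolding power_mass_def p_def[symmetric] by (rule nn_integral_add[symmetric]) measurable
    also have "\<dots> \<le> (\<integral>\<^sup>+x. ennreal (c n x powr p) \<partial>lborel)"
      using powr_superadditive[OF a0 b0 p] by (intro nn_integral_mono) (simp add: c_def ennreal_leI flip: ennreal_plus)
    finally show ?thesis using cpm[of n] by (simp add: power_mass_def p_def)
  qed
  have apm: "power_mass s (a n) \<le> 1" for n
    by (rule order_trans[OF _ pm_split[of n]]) simp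
  have bpm: "power_mass s (b n) \<le> 1" for n
    by (rule order_trans[OF _ pm_split[of n]]) simp
  define I where "I n = interaction (riesz_kernel s) (a n) (b n)" for n
  have Nmass: "(\<integral>\<^sup>+x. ennreal (c n x) \<partial>lborel) \<le> ennreal (real N)" for n by (rule gc_state_mass_le[OF cgc])
  have Dfin: "D s (c n) < \<infinity>" for n
    using N by (intro le_less_trans[OF D_le_power_mass[OF s _ c0 _ Nmass]]) (auto simp: cpm)
  \<comment> \<open>Near-optimality of the whole minus the bound for the escaping part. The
    interaction of the two parts remains as an error on the side of the energy, since the cost of
    mixed pairs was discarded.\<close>
  have key: "pair_cost s N M (Y n) S + ennreal (2 * l) * power_mass s (a n) \<le> D s (a n) + 2 * I n + ennreal (e n)" for n
  proof -
    define B where "B = pair_cost s N M (Y n) S' + ennreal (2 * l) * power_mass s (b n)"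
    have DB: "D s (b n) \<le> B"
      unfolding B_def by (rule gc_bound[OF s N b _ \<Lambda> l]) (use bpm[of n] in \<open>auto simp: le_less_trans\<close>)
    have split: "pair_cost s N M (Y n) S + pair_cost s N M (Y n) S' \<le> pair_cost s N M (Y n) (\<lambda>_. space M)"
      unfolding S'_def by (rule pair_cost_split[OF Ym Sm])
    have "pair_cost s N M (Y n) S' \<le> pair_cost s N M (Y n) S + pair_cost s N M (Y n) S'" by simp
    also note split
    also have "pair_cost s N M (Y n) (\<lambda>_. space M) \<le> D s (\<rho> n) + ennreal (e n)"
      using opt[of n] by (rule order_trans[rotated]) simp
    also have "\<dots> < \<infinity>" using Dfin[of n] by (simp add: cD)
    finally have "pair_cost s N M (Y n) S' < \<infinity>" .
    \<comment> \<open>\<open>B\<close> is cancelled on both sides below, which is valid in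
      \<open>ennreal\<close> only for finite values.\<close>
    then have Bfin: "B < \<infinity>"
      unfolding B_def using bpm[of n] by (auto simp: ennreal_mult_less_top le_less_trans)
    have "(pair_cost s N M (Y n) S + ennreal (2 * l) * power_mass s (a n)) + B =
        (pair_cost s N M (Y n) S + pair_cost s N M (Y n) S') + ennreal (2 * l) * (power_mass s (a n) + power_mass s (b n))"
      by (simp add: B_def distrib_left add_ac)
    also have "\<dots> \<le> pair_cost s N M (Y n) (\<lambda>_. space M) + ennreal (2 * l) * 1"
      by (intro add_mono mult_left_mono split pm_split) auto
    also have "\<dots> \<le> D s (c n) + ennreal (e n)" using opt[of n] by (simp add: cD)
    also have "D s (c n) = D s (a n) + 2 * I n + D s (b n)"
      unfolding D_eq_interaction I_def c_def
      by (rule interaction_add_square) (auto simp: a0 b0 riesz_kernel_commute)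
    also have "D s (a n) + 2 * I n + D s (b n) + ennreal (e n) \<le> D s (a n) + 2 * I n + B + ennreal (e n)"
      by (intro add_mono DB order_refl)
    finally have "B + (pair_cost s N M (Y n) S + ennreal (2 * l) * power_mass s (a n)) \<le> B + (D s (a n) + 2 * I n + ennreal (e n))"
      by (simp add: add_ac)
    then show ?thesis using Bfin by (auto simp: ennreal_add_left_cancel_le)
  qed
  obtain \<alpha> where \<alpha>: "gc_state N M Z S \<alpha>"
    using gc_limit_density_exists[OF s(1) a apm Zm limS_AE] .
  have [measurable]: "\<alpha> \<in> borel_measurable borel" using gc_stateD(4)[OF \<alpha>] .
  have pm_liminf: "power_mass s \<alpha> \<le> liminf (\<lambda>n. power_mass s (a n))"
    by (rule power_mass_gc_liminf[OF s(1) a \<alpha> limS_AE])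
  also have "\<dots> \<le> liminf (\<lambda>n::nat. 1)" by (intro Liminf_mono always_eventually allI apm)
  finally have \<alpha>pm: "power_mass s \<alpha> \<le> 1" by (simp add: Liminf_const)
  \<comment> \<open>The number \<epsilon> absorbs the energy of close pairs. With that removed, the
    energy and the mixed interaction converge by dominated convergence.\<close>
  have opt_\<alpha>: "pair_cost s N M Z S + ennreal (2 * l) * power_mass s \<alpha> \<le> D s \<alpha> + ennreal \<epsilon>" if \<epsilon>: "0 < \<epsilon>" for \<epsilon>
  proof -
    obtain r where r: "0 < r" and near: "\<And>\<rho> :: 'a \<Rightarrow> real. \<rho> \<in> borel_measurable borel \<Longrightarrow> (\<And>x. 0 \<le> \<rho> x) \<Longrightarrow>
       power_mass s \<rho> \<le> 1 \<Longrightarrow> interaction (near_kernel s r) \<rho> \<rho> \<le> ennreal \<epsilon>"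
      using near_interaction_small[OF s \<epsilon>] by blast
    define F where "F f g = interaction (far_kernel s r) f g" for f g :: "'a \<Rightarrow> real"
    define Ne where "Ne f g = interaction (near_kernel s r) f g" for f g :: "'a \<Rightarrow> real"
    have NF: "interaction (riesz_kernel s) f g \<le> Ne f g + F f g"
      if [measurable]: "f \<in> borel_measurable borel" "g \<in> borel_measurable borel" for f g :: "'a \<Rightarrow> real"
    proof -
      have "interaction (riesz_kernel s) f g \<le> interaction (\<lambda>x y. near_kernel s r x y + far_kernel s r x y) f g"
        by (intro interaction_mono riesz_kernel_le_near_far s r)
      also have "\<dots> = Ne f g + F f g"
        unfolding Ne_def F_def by (rule interaction_add_kernel) measurable
      finally show ?thesis .
    qed
    have far_le: "far_kernel s r x y \<le> ennreal (r powr - s)" for x y :: 'a by (simp add: far_kernel_def)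
    \<comment> \<open>The near interactions of the staying part with itself and with the escaping
      part are together at most the near self-interaction of the whole, to which the uniform bound
      applies.\<close>
    have est: "D s (a n) + 2 * I n \<le> ennreal \<epsilon> + (F (a n) (a n) + 2 * F (a n) (b n))" for n
    proof -
      have "D s (a n) + 2 * I n \<le> (Ne (a n) (a n) + F (a n) (a n)) + 2 * (Ne (a n) (b n) + F (a n) (b n))"
        unfolding D_eq_interaction I_def by (intro add_mono mult_left_mono NF) auto
      also have "\<dots> = (Ne (a n) (a n) + 2 * Ne (a n) (b n)) + (F (a n) (a n) + 2 * F (a n) (b n))"
        by (simp add: distrib_left add_ac)
      also have "Ne (a n) (a n) + 2 * Ne (a n) (b n) \<le> Ne (c n) (c n)"
      proof -
        have "Ne (c n) (c n) = Ne (a n) (a n) + 2 * Ne (a n) (b n) + Ne (b n) (b n)"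
          unfolding Ne_def c_def by (rule interaction_add_square) (auto simp: a0 b0 near_kernel_commute)
        then show ?thesis by simp
      qed
      also have "Ne (c n) (c n) \<le> ennreal \<epsilon>"
        unfolding Ne_def by (rule near) (auto simp: c0 cpm)
      finally show ?thesis by simp
    qed
    have lim_aa: "(\<lambda>n. F (a n) (a n)) \<longlonglongrightarrow> F \<alpha> \<alpha>"
      unfolding F_def gc_state_interaction[OF far_kernel_measurable \<alpha> \<alpha>]
    proof (rule interaction_limit[OF far_kernel_measurable far_le a a])
      fix i j assume ij: "i < N" "j < N"
      note [measurable] = Zm[OF ij(1)] Zm[OF ij(2)]
      show "AE \<omega> in M. AE \<omega>' in M. \<omega> \<in> S i \<longrightarrow> \<omega>' \<in> S j \<longrightarrow>
        (\<lambda>n. far_kernel s r (Y n i \<omega>) (Y n j \<omega>')) \<longlonglongrightarrow> far_kernel s r (Z i \<omega>) (Z j \<omega>')"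
        unfolding far_kernel_def
        by (intro AE_I2 impI tendsto_min tendsto_const tendsto_riesz_kernel s limS)
      show "(\<lambda>(\<omega>, \<omega>'). far_kernel s r (Z i \<omega>) (Z j \<omega>')) \<in> borel_measurable (M \<Otimes>\<^sub>M M)"
        unfolding far_kernel_def by measurable
    qed
    \<comment> \<open>Two independent copies are compared: one particle converges while the other
      goes to infinity, so their kernel tends to 0.\<close>
    have lim_ab: "(\<lambda>n. F (a n) (b n)) \<longlonglongrightarrow> 0"
    proof -
      have "(\<lambda>n. F (a n) (b n)) \<longlonglongrightarrow> (\<Sum>i<N. \<Sum>j<N. \<integral>\<^sup>+\<omega>\<in>S i. (\<integral>\<^sup>+\<omega>'\<in>S' j. 0 \<partial>M) \<partial>M)"
        unfolding F_def
      proof (rule interaction_limit[OF far_kernel_measurable far_le a b])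
        fix i j assume ij: "i < N" "j < N"
        show "AE \<omega> in M. AE \<omega>' in M. \<omega> \<in> S i \<longrightarrow> \<omega>' \<in> S' j \<longrightarrow>
          (\<lambda>n. far_kernel s r (Y n i \<omega>) (Y n j \<omega>')) \<longlonglongrightarrow> 0"
        proof (rule AE_I2)
          fix \<omega>
          show "AE \<omega>' in M. \<omega> \<in> S i \<longrightarrow> \<omega>' \<in> S' j \<longrightarrow> (\<lambda>n. far_kernel s r (Y n i \<omega>) (Y n j \<omega>')) \<longlonglongrightarrow> 0"
            using limS'[OF ij(2)]
          proof eventually_elim
            case (elim \<omega>')
            show ?case
            proof (intro impI)
              assume "\<omega> \<in> S i" "\<omega>' \<in> S' j"
              then have "(\<lambda>n. riesz_kernel s (Y n i \<omega>) (Y n j \<omega>')) \<longlonglongrightarrow> 0"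
                using elim limS by (intro riesz_kernel_tendsto_0[OF s(1)]) auto
              then show "(\<lambda>n. far_kernel s r (Y n i \<omega>) (Y n j \<omega>')) \<longlonglongrightarrow> 0"
                by (rule tendsto_sandwich[OF _ _ tendsto_const, rotated 2]) (auto simp: far_kernel_def)
            qed
          qed
        qed
      qed simp
      then show ?thesis by simp
    qed
    have "pair_cost s N M Z S + ennreal (2 * l) * power_mass s \<alpha> \<le>
        liminf (\<lambda>n. pair_cost s N M (Y n) S) + liminf (\<lambda>n. ennreal (2 * l) * power_mass s (a n))"
      by (intro add_mono pair_cost_liminf[OF s(1) Ym Sm limS_AE] order_trans[OF mult_left_mono[OF pm_liminf] liminf_cmult_le]) auto
    also have "\<dots> \<le> liminf (\<lambda>n. pair_cost s N M (Y n) S + ennreal (2 * l) * power_mass s (a n))"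
      by (rule liminf_add_le)
    also have "\<dots> \<le> liminf (\<lambda>n. ennreal \<epsilon> + (F (a n) (a n) + 2 * F (a n) (b n)) + ennreal (e n))"
      by (intro Liminf_mono always_eventually allI order_trans[OF key] add_mono est order_refl)
    also have "\<dots> = ennreal \<epsilon> + (F \<alpha> \<alpha> + 2 * 0) + ennreal 0"
      by (intro lim_imp_Liminf tendsto_add tendsto_const ennreal_tendsto_cmult lim_aa lim_ab tendsto_ennrealI e) auto
    also have "\<dots> \<le> ennreal \<epsilon> + D s \<alpha>"
      unfolding F_def D_eq_interaction by (simp, intro interaction_mono) (simp add: far_kernel_def)
    finally show ?thesis by (simp add: add.commute)
  qed
  have opt0: "pair_cost s N M Z S + ennreal (2 * l) * power_mass s \<alpha> \<le> D s \<alpha>"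
    by (rule ennreal_le_add_vanishing[OF opt_\<alpha> lim_1_over_n]) simp
  have \<alpha>D: "D s \<alpha> < \<infinity>"
    using N gc_stateD(5)[OF \<alpha>] \<alpha>pm gc_state_mass_le[OF \<alpha>]
    by (intro le_less_trans[OF D_le_power_mass[OF s, of \<alpha> "real N"]]) (auto simp: ennreal_mult_less_top le_less_trans)
  have "0 < (\<integral>\<^sup>+x. ennreal (\<alpha> x) \<partial>lborel)"
  \<comment> \<open>If no particle stayed with positive probability, all would leave the ball of
    radius \<open>R\<close>, contradicting the mass \<open>m\<close> kept there by
    \<open>tight\<close>.\<close>
  proof (rule ccontr)
    assume "\<not> 0 < (\<integral>\<^sup>+x. ennreal (\<alpha> x) \<partial>lborel)"
    then have "(\<Sum>i<N. emeasure M (S i)) = 0" using gc_state_mass[OF \<alpha>] by simp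
    then have "emeasure M (S i) = 0" if "i < N" for i using that by (simp add: sum_eq_0_iff)
    then have notS: "AE \<omega> in M. \<omega> \<notin> S i" if "i < N" for i
      using that Sm by (intro AE_not_in) (auto simp: null_sets_def)
    have "(\<lambda>n. \<Sum>i<N. \<integral>\<^sup>+\<omega>\<in>space M. indicator (ball 0 R) (Y n i \<omega>) \<partial>M) \<longlonglongrightarrow> (\<Sum>i<N. \<integral>\<^sup>+\<omega>. 0 \<partial>M)"
    proof (intro tendsto_sum)
      fix i assume "i \<in> {..<N}"
      then have i: "i < N" by simp
      note [measurable] = Ym[OF i]
      have [measurable]: "ball (0::'a) R \<in> sets borel" by simp
      show "(\<lambda>n. \<integral>\<^sup>+\<omega>\<in>space M. indicator (ball 0 R) (Y n i \<omega>) \<partial>M) \<longlonglongrightarrow> (\<integral>\<^sup>+\<omega>. 0 \<partial>M)"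
      proof (rule nn_integral_dominated_convergence[where w = "\<lambda>_. 1"])
        show "AE \<omega> in M. (\<lambda>n. indicator (ball 0 R) (Y n i \<omega>) * indicator (space M) \<omega> :: ennreal) \<longlonglongrightarrow> 0"
          using notS[OF i] limS'[OF i] AE_space
        proof eventually_elim
          case (elim \<omega>)
          then have "filterlim (\<lambda>n. norm (Y n i \<omega>)) at_top sequentially" by (auto simp: S'_def)
          then have "eventually (\<lambda>n. R \<le> norm (Y n i \<omega>)) sequentially" by (simp add: filterlim_at_top)
          then have "eventually (\<lambda>n. indicator (ball 0 R) (Y n i \<omega>) * indicator (space M) \<omega> = (0::ennreal)) sequentially"
            by eventually_elim (simp add: indicator_def)
          then show ?case by (rule tendsto_eventually)
        qed
      qed (auto simp: M.emeasure_space_1 indicator_def)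
    qed
    moreover have "(\<Sum>i<N. \<integral>\<^sup>+\<omega>\<in>space M. indicator (ball 0 R) (Y n i \<omega>) \<partial>M) = (\<integral>\<^sup>+x\<in>ball 0 R. ennreal (\<rho> n x) \<partial>lborel)" for n
      by (intro gc_stateD(6)[OF gc, symmetric] borel_measurable_indicator borel_open open_ball)
    ultimately have "(\<lambda>n. \<integral>\<^sup>+x\<in>ball 0 R. ennreal (\<rho> n x) \<partial>lborel) \<longlonglongrightarrow> 0" by simp
    then have "ennreal m \<le> 0"
      by (rule LIMSEQ_le_const) (use tight(2) in blast)
    then show False using tight(1) by (simp add: ennreal_le_iff)
  qed
  moreover have "power_mass s \<alpha> < \<infinity>" using \<alpha>pm by (simp add: le_less_trans)
  ultimately show thesis using that[OF \<alpha> _ opt0 \<alpha>D] by blast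
qed

subsection \<open>Scaling, relabelling and plans\<close>

lemma nn_integral_lborel_affine:
  fixes f :: "'a::euclidean_space \<Rightarrow> ennreal"
  assumes [measurable]: "f \<in> borel_measurable borel" and c: "0 < c"
  shows "(\<integral>\<^sup>+x. f x \<partial>lborel) = ennreal (c ^ DIM('a)) * (\<integral>\<^sup>+x. f (c *\<^sub>R x + v) \<partial>lborel)"
proof -
  have "(\<integral>\<^sup>+x. f x \<partial>lborel) = (\<integral>\<^sup>+x. f x \<partial>density (distr lborel borel (\<lambda>x. v + c *\<^sub>R x)) (\<lambda>_. ennreal (c ^ DIM('a))))"
  proof (rule arg_cong[where f = "\<lambda>M. nn_integral M f"])
    have "c \<noteq> 0" "\<bar>c\<bar> = c" using c by auto
    with lborel_affine[of c v]
    show "lborel = density (distr lborel borel (\<lambda>x. v + c *\<^sub>R x)) (\<lambda>_. ennreal (c ^ DIM('a)))"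
      by metis
  qed
  also have "\<dots> = ennreal (c ^ DIM('a)) * (\<integral>\<^sup>+x. f (c *\<^sub>R x + v) \<partial>lborel)"
    by (simp add: nn_integral_density nn_integral_distr nn_integral_cmult add.commute)
  finally show ?thesis .
qed

text \<open>Dilation preserves the mass, while energy, cost and power mass all acquire the factor
  c^-s. So the power mass can be normalized without changing the ratio; with c = 1 the lemma gives
  translations.\<close>

lemma gc_state_affine:
  fixes X :: "nat \<Rightarrow> 'b \<Rightarrow> 'a::euclidean_space" and v :: 'a
  assumes c: "0 < c" and gc: "gc_state N M X S \<rho>"
  defines "X' \<equiv> \<lambda>i \<omega>. c *\<^sub>R X i \<omega> + v" and "\<rho>' \<equiv> \<lambda>x. \<rho> ((x - v) /\<^sub>R c) / c ^ DIM('a)"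
  shows "gc_state N M X' S \<rho>'" "power_mass s \<rho>' = ennreal (c powr - s) * power_mass s \<rho>"
    "pair_cost s N M X' S = ennreal (c powr - s) * pair_cost s N M X S" "D s \<rho>' = ennreal (c powr - s) * D s \<rho>"
proof -
  have [measurable]: "\<rho> \<in> borel_measurable borel" using gc_stateD(4)[OF gc] .
  have \<rho>'m[measurable]: "\<rho>' \<in> borel_measurable borel" unfolding \<rho>'_def by measurable
  have \<rho>'c: "\<rho>' (c *\<^sub>R x + v) = \<rho> x / c ^ DIM('a)" for x using c by (simp add: \<rho>'_def)
  show gc': "gc_state N M X' S \<rho>'"
    unfolding gc_state_def
  proof (intro conjI ballI allI impI)
    fix f :: "'a \<Rightarrow> ennreal" assume f[measurable]: "f \<in> borel_measurable borel"
    have "(\<integral>\<^sup>+x. ennreal (\<rho>' x) * f x \<partial>lborel) =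
        ennreal (c ^ DIM('a)) * (\<integral>\<^sup>+x. ennreal (\<rho> x / c ^ DIM('a)) * f (c *\<^sub>R x + v) \<partial>lborel)"
      using c by (subst nn_integral_lborel_affine[of _ c v]) (simp_all add: \<rho>'c)
    also have "\<dots> = (\<integral>\<^sup>+x. ennreal (c ^ DIM('a)) * (ennreal (\<rho> x / c ^ DIM('a)) * f (c *\<^sub>R x + v)) \<partial>lborel)"
      by (rule nn_integral_cmult[symmetric]) measurable
    also have "\<dots> = (\<integral>\<^sup>+x. ennreal (\<rho> x) * f (c *\<^sub>R x + v) \<partial>lborel)"
    proof (intro nn_integral_cong)
      fix x
      have "ennreal (c ^ DIM('a)) * ennreal (\<rho> x / c ^ DIM('a)) = ennreal (\<rho> x)"
        using c gc_stateD(5)[OF gc, of x] by (simp flip: ennreal_mult)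
      then show "ennreal (c ^ DIM('a)) * (ennreal (\<rho> x / c ^ DIM('a)) * f (c *\<^sub>R x + v)) = ennreal (\<rho> x) * f (c *\<^sub>R x + v)"
        by (simp add: mult.assoc[symmetric])
    qed
    also have "\<dots> = (\<Sum>i<N. \<integral>\<^sup>+\<omega>\<in>S i. f (X' i \<omega>) \<partial>M)"
      unfolding X'_def by (rule gc_stateD(6)[OF gc]) measurable
    finally show "(\<integral>\<^sup>+x. ennreal (\<rho>' x) * f x \<partial>lborel) = (\<Sum>i<N. \<integral>\<^sup>+\<omega>\<in>S i. f (X' i \<omega>) \<partial>M)" .
  next
    fix i assume "i < N"
    then have [measurable]: "X i \<in> borel_measurable M" using gc_stateD(2)[OF gc] by simp
    show "X' i \<in> borel_measurable M" unfolding X'_def by measurable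
  next
    show "0 \<le> \<rho>' x" for x unfolding \<rho>'_def using c gc_stateD(5)[OF gc] by simp
  qed (use gc_stateD[OF gc] \<rho>'m in auto)
  show "power_mass s \<rho>' = ennreal (c powr - s) * power_mass s \<rho>"
  proof -
    define p where "p = 1 + s / real DIM('a)"
    have "power_mass s \<rho>' = ennreal (c ^ DIM('a)) * (\<integral>\<^sup>+x. ennreal ((\<rho> x / c ^ DIM('a)) powr p) \<partial>lborel)"
      unfolding power_mass_def p_def[symmetric]
      using c by (subst nn_integral_lborel_affine[of _ c v]) (simp_all add: \<rho>'c)
    also have "\<dots> = (\<integral>\<^sup>+x. ennreal (c ^ DIM('a)) * ennreal ((\<rho> x / c ^ DIM('a)) powr p) \<partial>lborel)"
      by (rule nn_integral_cmult[symmetric]) measurable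
    also have "\<dots> = (\<integral>\<^sup>+x. ennreal (c powr - s) * ennreal (\<rho> x powr p) \<partial>lborel)"
    proof (intro nn_integral_cong)
      fix x
      have "c ^ DIM('a) * (\<rho> x / c ^ DIM('a)) powr p = c powr - s * \<rho> x powr p"
      proof -
        have "(c ^ DIM('a)) powr p = c ^ DIM('a) * c powr s"
          using c by (simp add: p_def powr_add powr_powr flip: powr_realpow)
        then show ?thesis
          using c gc_stateD(5)[OF gc, of x] by (simp add: powr_divide powr_minus field_simps)
      qed
      then show "ennreal (c ^ DIM('a)) * ennreal ((\<rho> x / c ^ DIM('a)) powr p) = ennreal (c powr - s) * ennreal (\<rho> x powr p)"
        using c by (simp flip: ennreal_mult)
    qed
    also have "\<dots> = ennreal (c powr - s) * power_mass s \<rho>"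
      unfolding power_mass_def p_def by (rule nn_integral_cmult) measurable
    finally show ?thesis .
  qed
  show "pair_cost s N M X' S = ennreal (c powr - s) * pair_cost s N M X S"
  proof -
    have "(\<lambda>\<omega>. if i \<noteq> j then indicator (S i) \<omega> * indicator (S j) \<omega> * riesz_kernel s (X i \<omega>) (X j \<omega>) else 0)
        \<in> borel_measurable M" if "i < N" "j < N" for i j
    proof -
      note [measurable] = gc_stateD(2,3)[OF gc that(1)] gc_stateD(2,3)[OF gc that(2)]
      show ?thesis by measurable
    qed
    then have m: "(\<lambda>\<omega>. \<Sum>i<N. \<Sum>j<N. if i \<noteq> j then indicator (S i) \<omega> * indicator (S j) \<omega> * riesz_kernel s (X i \<omega>) (X j \<omega>) else 0)
        \<in> borel_measurable M"
      by (intro borel_measurable_sum) auto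
    show ?thesis
      unfolding pair_cost_def nn_integral_cmult[OF m, symmetric] X'_def riesz_kernel_affine[OF c]
      by (intro nn_integral_cong) (auto simp: sum_distrib_left mult_ac intro!: sum.cong)
  qed
  show "D s \<rho>' = ennreal (c powr - s) * D s \<rho>"
  proof -
    have km: "(\<lambda>(x, y). ennreal (c powr - s) * riesz_kernel s x (y::'a)) \<in> borel_measurable (borel \<Otimes>\<^sub>M borel)"
      by measurable
    have "D s \<rho>' = interaction (\<lambda>x y. ennreal (c powr - s) * riesz_kernel s x y) \<rho> \<rho>"
      unfolding D_eq_interaction gc_state_interaction[OF riesz_kernel_measurable_pair gc' gc']
        gc_state_interaction[OF km gc gc] X'_def riesz_kernel_affine[OF c] ..
    also have "\<dots> = ennreal (c powr - s) * D s \<rho>"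
    proof -
      have 1: "(\<lambda>y. ennreal (\<rho> x) * ennreal (\<rho> y) * riesz_kernel s x y) \<in> borel_measurable lborel" for x
        by measurable
      have 2: "(\<lambda>x. \<integral>\<^sup>+y. ennreal (\<rho> x) * ennreal (\<rho> y) * riesz_kernel s x y \<partial>lborel) \<in> borel_measurable lborel"
        by measurable
      show ?thesis
        unfolding D_def nn_integral_cmult[OF 2, symmetric] nn_integral_cmult[OF 1, symmetric] interaction_def
        by (simp only: mult_ac)
    qed
    finally show ?thesis .
  qed
qed

text \<open>The present particles are renumbered in increasing order of their old indices. The set
  of present indices takes finitely many values, each on a measurable event, so the renumbered
  particles are measurable.\<close>

lemma gc_state_relabel:
  fixes X :: "nat \<Rightarrow> 'b \<Rightarrow> 'a::euclidean_space"
  assumes gc: "gc_state N M X S \<rho>" and card: "AE \<omega> in M. card {i\<in>{..<N}. \<omega> \<in> S i} = k"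
  obtains X' where "gc_state k M X' (\<lambda>_. space M) \<rho>"
    "pair_cost s k M X' (\<lambda>_. space M) = pair_cost s N M X S"
proof -
  interpret M: prob_space M using gc_stateD(1)[OF gc] .
  have XS[measurable]: "X i \<in> borel_measurable M" "S i \<in> sets M" if "i < N" for i using gc_stateD(2,3)[OF gc that] by auto
  define P where "P \<omega> = {i\<in>{..<N}. \<omega> \<in> S i}" for \<omega>
  define en where "en T j = sorted_list_of_set T ! j" for T :: "nat set" and j
  \<comment> \<open>The value 0 serves configurations without a j-th present particle, where
    \<open>en\<close> need not return an index below \<open>N\<close>. For j < k this happens only
    on a null set.\<close>
  define X' where "X' j \<omega> = (if en (P \<omega>) j < N then X (en (P \<omega>) j) \<omega> else 0)" for j \<omega>
  have Pfin: "finite (P \<omega>)" for \<omega> by (simp add: P_def)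
  have bij: "bij_betw (en T) {..<card T} T" if "finite T" for T
    unfolding en_def using that by (intro bij_betw_nth) auto
  have Pm: "{\<omega>\<in>space M. P \<omega> = T} \<in> sets M" for T
  proof (cases "T \<subseteq> {..<N}")
    case True
    then have "{\<omega>\<in>space M. P \<omega> = T} = {\<omega>\<in>space M. \<forall>i\<in>{..<N}. \<omega> \<in> S i \<longleftrightarrow> i \<in> T}" by (auto simp: P_def)
    also have "\<dots> \<in> sets M" by (intro sets.sets_Collect_finite_All) (auto simp: XS intro!: predE)
    finally show ?thesis .
  next
    case False
    then have "{\<omega>\<in>space M. P \<omega> = T} = {}" by (auto simp: P_def)
    then show ?thesis by (simp only: sets.empty_sets)
  qed
  have X'm: "X' j \<in> borel_measurable M" for j
  proof -
    have "P \<in> measurable M (count_space (Pow {..<N}))"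
      using Pm by (subst measurable_count_space_eq2) (auto simp: P_def vimage_def Int_def conj_commute)
    then show ?thesis
      unfolding X'_def
    proof (rule measurable_compose_countable'[where f = "\<lambda>T \<omega>. if en T j < N then X (en T j) \<omega> else 0" and I = "Pow {..<N}", rotated])
      show "countable (Pow {..<N})" by (simp add: countable_finite)
      fix T :: "nat set"
      show "(\<lambda>\<omega>. if en T j < N then X (en T j) \<omega> else 0) \<in> borel_measurable M"
        using XS(1) by (cases "en T j < N") auto
    qed
  qed
  have card': "AE \<omega> in M. card (P \<omega>) = k" using card by (simp add: P_def)
  have sum_P: "(\<Sum>j<k. F (en (P \<omega>) j)) = (\<Sum>i<N. indicator (S i) \<omega> * F i)" if "card (P \<omega>) = k" for \<omega> and F :: "nat \<Rightarrow> ennreal"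
  proof -
    have "(\<Sum>j<k. F (en (P \<omega>) j)) = (\<Sum>i\<in>P \<omega>. F i)"
      using sum.reindex_bij_betw[OF bij[OF Pfin[of \<omega>]], of F] that by simp
    also have "\<dots> = (\<Sum>i<N. if i \<in> P \<omega> then F i else 0)"
      by (simp add: sum.If_cases P_def Int_def)
    also have "\<dots> = (\<Sum>i<N. indicator (S i) \<omega> * F i)"
      by (intro sum.cong refl) (auto simp: P_def indicator_def)
    finally show ?thesis .
  qed
  have enN: "en (P \<omega>) j < N" "en (P \<omega>) j \<in> P \<omega>" if "card (P \<omega>) = k" "j < k" for \<omega> j
  proof -
    show "en (P \<omega>) j \<in> P \<omega>" using bij[OF Pfin, of \<omega>] that by (auto simp: bij_betw_def)
    then show "en (P \<omega>) j < N" by (simp add: P_def)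
  qed
  have "gc_state k M X' (\<lambda>_. space M) \<rho>"
    unfolding gc_state_def
  proof (intro conjI ballI allI impI)
    fix f :: "'a \<Rightarrow> ennreal" assume f[measurable]: "f \<in> borel_measurable borel"
    have "(\<integral>\<^sup>+x. ennreal (\<rho> x) * f x \<partial>lborel) = (\<Sum>i<N. \<integral>\<^sup>+\<omega>\<in>S i. f (X i \<omega>) \<partial>M)"
      by (rule gc_stateD(6)[OF gc f])
    also have "\<dots> = (\<integral>\<^sup>+\<omega>. (\<Sum>i<N. f (X i \<omega>) * indicator (S i) \<omega>) \<partial>M)"
    proof (rule nn_integral_sum[symmetric])
      fix i assume "i \<in> {..<N}"
      then have [measurable]: "X i \<in> borel_measurable M" "S i \<in> sets M" using XS by auto
      show "(\<lambda>\<omega>. f (X i \<omega>) * indicator (S i) \<omega>) \<in> borel_measurable M" by measurable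
    qed
    also have "\<dots> = (\<integral>\<^sup>+\<omega>. (\<Sum>j<k. f (X' j \<omega>) * indicator (space M) \<omega>) \<partial>M)"
    proof (rule nn_integral_cong_AE)
      show "AE \<omega> in M. (\<Sum>i<N. f (X i \<omega>) * indicator (S i) \<omega>) = (\<Sum>j<k. f (X' j \<omega>) * indicator (space M) \<omega>)"
        using card' AE_space
      proof eventually_elim
        case (elim \<omega>)
        have "(\<Sum>j<k. f (X' j \<omega>) * indicator (space M) \<omega>) = (\<Sum>j<k. f (X (en (P \<omega>) j) \<omega>))"
          using elim enN(1)[OF elim(1)] by (intro sum.cong) (auto simp: X'_def)
        also have "\<dots> = (\<Sum>i<N. indicator (S i) \<omega> * f (X i \<omega>))" by (rule sum_P[OF elim(1)])
        finally show ?case by (simp add: mult.commute)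
      qed
    qed
    also have "\<dots> = (\<Sum>j<k. \<integral>\<^sup>+\<omega>\<in>space M. f (X' j \<omega>) \<partial>M)"
    proof (rule nn_integral_sum)
      fix j
      note [measurable] = X'm[of j]
      show "(\<lambda>\<omega>. f (X' j \<omega>) * indicator (space M) \<omega>) \<in> borel_measurable M" by measurable
    qed
    finally show "(\<integral>\<^sup>+x. ennreal (\<rho> x) * f x \<partial>lborel) = (\<Sum>j<k. \<integral>\<^sup>+\<omega>\<in>space M. f (X' j \<omega>) \<partial>M)" .
  qed (use gc_stateD[OF gc] X'm in auto)
  moreover have "pair_cost s k M X' (\<lambda>_. space M) = pair_cost s N M X S"
    unfolding pair_cost_def
  proof (rule nn_integral_cong_AE)
    show "AE \<omega> in M. (\<Sum>i<k. \<Sum>j<k. if i \<noteq> j then indicator (space M) \<omega> * indicator (space M) \<omega> * riesz_kernel s (X' i \<omega>) (X' j \<omega>) else 0)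
      = (\<Sum>i<N. \<Sum>j<N. if i \<noteq> j then indicator (S i) \<omega> * indicator (S j) \<omega> * riesz_kernel s (X i \<omega>) (X j \<omega>) else 0)"
      using card' AE_space
    proof eventually_elim
      case (elim \<omega>)
      define F where "F a b = (if a \<noteq> b then riesz_kernel s (X a \<omega>) (X b \<omega>) else 0)" for a b
      have inj: "en (P \<omega>) i = en (P \<omega>) j \<longleftrightarrow> i = j" if "i < k" "j < k" for i j
        using bij[OF Pfin, of \<omega>] that elim(1) by (auto simp: bij_betw_def inj_on_def)
      have "(\<Sum>i<k. \<Sum>j<k. if i \<noteq> j then indicator (space M) \<omega> * indicator (space M) \<omega> * riesz_kernel s (X' i \<omega>) (X' j \<omega>) else 0)
          = (\<Sum>i<k. \<Sum>j<k. F (en (P \<omega>) i) (en (P \<omega>) j))"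
        using elim enN(1)[OF elim(1)] inj by (intro sum.cong refl) (auto simp: X'_def F_def)
      also have "\<dots> = (\<Sum>i<N. indicator (S i) \<omega> * (\<Sum>j<N. indicator (S j) \<omega> * F i j))"
        unfolding sum_P[OF elim(1)] by (rule sum_P[OF elim(1)])
      also have "\<dots> = (\<Sum>i<N. \<Sum>j<N. if i \<noteq> j then indicator (S i) \<omega> * indicator (S j) \<omega> * riesz_kernel s (X i \<omega>) (X j \<omega>) else 0)"
        unfolding sum_distrib_left by (intro sum.cong refl) (auto simp: F_def mult.assoc)
      finally show ?case .
    qed
  qed
  ultimately show thesis by (rule that)
qed

text \<open>Admissible functions are nonnegative only almost everywhere, while states carry
  densities that are nonnegative everywhere. Passing to the positive part changes none of the
  quantities involved.\<close>

lemma admissible_nonneg_part: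
  fixes \<rho> :: "'a::euclidean_space \<Rightarrow> real"
  assumes "\<rho> \<in> admissible s N"
  defines "\<rho>' \<equiv> \<lambda>x. max 0 (\<rho> x)"
  shows "\<rho>' \<in> borel_measurable borel" "(\<integral>\<^sup>+x. ennreal (\<rho>' x) \<partial>lborel) = ennreal (real N)"
    "power_mass s \<rho>' < \<infinity>" "L s \<rho> = enn2real (power_mass s \<rho>')" "D s \<rho> = D s \<rho>'" "AE x in lborel. \<rho> x = \<rho>' x"
proof -
  have int: "integrable lborel \<rho>" and intp: "integrable lborel (\<lambda>x. \<bar>\<rho> x\<bar> powr (1 + s / real DIM('a)))"
    and nn: "AE x in lborel. 0 \<le> \<rho> x" and N: "(LINT x|lborel. \<rho> x) = real N"
    using assms(1) by (auto simp: admissible_def)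
  have [measurable]: "\<rho> \<in> borel_measurable borel" using int by simp
  show m[measurable]: "\<rho>' \<in> borel_measurable borel" unfolding \<rho>'_def by measurable
  show eq: "AE x in lborel. \<rho> x = \<rho>' x" using nn by eventually_elim (simp add: \<rho>'_def)
  have "(\<integral>\<^sup>+x. ennreal (\<rho>' x) \<partial>lborel) = (\<integral>\<^sup>+x. ennreal (\<rho> x) \<partial>lborel)"
    by (intro nn_integral_cong) (simp add: \<rho>'_def max_def ennreal_neg)
  then show "(\<integral>\<^sup>+x. ennreal (\<rho>' x) \<partial>lborel) = ennreal (real N)"
    using nn_integral_eq_integral[OF int nn] N by simp
  have "power_mass s \<rho>' = (\<integral>\<^sup>+x. ennreal (\<bar>\<rho> x\<bar> powr (1 + s / real DIM('a))) \<partial>lborel)"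
    unfolding power_mass_def using nn by (intro nn_integral_cong_AE) (auto simp: \<rho>'_def)
  then show "power_mass s \<rho>' < \<infinity>"
    using intp by (simp add: nn_integral_eq_integral)
  have "L s \<rho> = (LINT x|lborel. \<rho>' x powr (1 + s / real DIM('a)))"
    unfolding L_def using eq by (intro integral_cong_AE) auto
  also have "\<dots> = enn2real (power_mass s \<rho>')"
    unfolding power_mass_def by (rule integral_eq_nn_integral) auto
  finally show "L s \<rho> = enn2real (power_mass s \<rho>')" .
  have "ennreal (\<rho>' x) = ennreal (\<rho> x)" for x by (simp add: \<rho>'_def max_def ennreal_neg)
  then show "D s \<rho> = D s \<rho>'" by (simp add: D_def)
qed

text \<open>A plan is itself the probability space of a state, with the coordinates as particles.
  Its one-body measure determines integrals of indicators; general test functions are reached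
  through a Radon-Nikodym density, which agrees with \<rho> almost everywhere.\<close>

lemma plan_gc_state:
  fixes \<rho> :: "'a::euclidean_space \<Rightarrow> real"
  assumes \<rho>: "\<rho> \<in> borel_measurable borel" "\<And>x. 0 \<le> \<rho> x"
    and P: "sym_prob N P" "one_body N P = density lborel (\<lambda>x. ennreal (\<rho> x))"
  obtains \<rho>' where "gc_state N P (\<lambda>i x. x i) (\<lambda>_. space P) \<rho>'" "AE x in lborel. \<rho> x = \<rho>' x"
    "pair_cost s N P (\<lambda>i x. x i) (\<lambda>_. space P) = 2 * (\<integral>\<^sup>+x. (\<Sum>j<N. \<Sum>i<j. riesz_kernel s (x i) (x j)) \<partial>P)"
proof -
  have setsP: "sets P = sets (config_space N)" and "prob_space P" using P by (auto simp: sym_prob_def)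
  interpret P: prob_space P by fact
  note [measurable] = \<rho>(1)
  have xi: "(\<lambda>x. x i) \<in> borel_measurable P" if "i < N" for i
    using that by (simp add: measurable_cong_sets[OF setsP refl] measurable_component_singleton)
  have sum_ind: "(\<Sum>i<N. \<integral>\<^sup>+x\<in>space P. indicator A (x i) \<partial>P) = (\<integral>\<^sup>+x. ennreal (\<rho> x) * indicator A x \<partial>lborel)"
    if A[measurable]: "A \<in> sets borel" for A
  proof -
    have "(\<Sum>i<N. \<integral>\<^sup>+x\<in>space P. indicator A (x i) \<partial>P) = (\<Sum>i<N. emeasure (distr P borel (\<lambda>x. x i)) A)"
    proof (rule sum.cong[OF refl])
      fix i assume "i \<in> {..<N}"
      then have i: "(\<lambda>x. x i) \<in> borel_measurable P" using xi by simp
      have "(\<integral>\<^sup>+x\<in>space P. indicator A (x i) \<partial>P) = (\<integral>\<^sup>+x. indicator A (x i) \<partial>P)"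
        by (intro nn_integral_cong) simp
      also have "\<dots> = (\<integral>\<^sup>+y. indicator A y \<partial>distr P borel (\<lambda>x. x i))"
        by (rule nn_integral_distr[OF i, symmetric]) simp
      finally show "(\<integral>\<^sup>+x\<in>space P. indicator A (x i) \<partial>P) = emeasure (distr P borel (\<lambda>x. x i)) A" by simp
    qed
    also have "\<dots> = emeasure (density lborel (\<lambda>x. ennreal (\<rho> x))) A"
      using emeasure_one_body[OF A, of N P] P(2) by simp
    finally show ?thesis by (simp add: emeasure_density)
  qed
  obtain \<rho>' where \<rho>': "gc_state N P (\<lambda>i x. x i) (\<lambda>_. space P) \<rho>'"
  proof (rule gc_density_exists[of P N "\<lambda>i x. x i" "\<lambda>_. space P"])
    fix i and A :: "'a set" assume i: "i < N" and A: "A \<in> sets borel" "emeasure lborel A = 0"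
    have "AE x in lborel. x \<notin> A" using A by (intro AE_not_in) (auto simp: null_sets_def)
    then have "(\<integral>\<^sup>+x. ennreal (\<rho> x) * indicator A x \<partial>lborel) = (\<integral>\<^sup>+x. 0 \<partial>(lborel :: 'a measure))"
      by (intro nn_integral_cong_AE) auto
    then have "(\<Sum>i<N. \<integral>\<^sup>+x\<in>space P. indicator A (x i) \<partial>P) = 0" using sum_ind[OF A(1)] by simp
    then show "(\<integral>\<^sup>+x\<in>space P. indicator A (x i) \<partial>P) = 0" using i by (simp add: sum_eq_0_iff)
  qed (use xi P.prob_space_axioms in auto)
  have [measurable]: "\<rho>' \<in> borel_measurable borel" using gc_stateD(4)[OF \<rho>'] .
  have "density lborel (\<lambda>x. ennreal (\<rho> x)) = density lborel (\<lambda>x. ennreal (\<rho>' x))"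
  proof (rule measure_eqI)
    fix A assume "A \<in> sets (density lborel (\<lambda>x. ennreal (\<rho> x)))"
    then have [measurable]: "A \<in> sets borel" by simp
    show "emeasure (density lborel (\<lambda>x. ennreal (\<rho> x))) A = emeasure (density lborel (\<lambda>x. ennreal (\<rho>' x))) A"
      using gc_stateD(6)[OF \<rho>', of "indicator A"] sum_ind[of A] by (simp add: emeasure_density)
  qed simp
  then have "AE x in lborel. ennreal (\<rho> x) = ennreal (\<rho>' x)"
    by (subst (asm) sigma_finite_measure.density_unique_iff[OF sigma_finite_lborel]) auto
  then have "AE x in lborel. \<rho> x = \<rho>' x"
    by eventually_elim (use \<rho>(2) gc_stateD(5)[OF \<rho>'] in auto)
  moreover have "pair_cost s N P (\<lambda>i x. x i) (\<lambda>_. space P) = 2 * (\<integral>\<^sup>+x. (\<Sum>j<N. \<Sum>i<j. riesz_kernel s (x i) (x j)) \<partial>P)"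
  proof -
    have m: "(\<lambda>x. \<Sum>j<N. \<Sum>i<j. riesz_kernel s (x i) (x j)) \<in> borel_measurable P"
      by (intro borel_measurable_sum riesz_kernel_measurable xi) auto
    have "pair_cost s N P (\<lambda>i x. x i) (\<lambda>_. space P) =
        (\<integral>\<^sup>+x. (\<Sum>i<N. \<Sum>j<N. if i \<noteq> j then riesz_kernel s (x i) (x j) else 0) \<partial>P)"
      unfolding pair_cost_def by (intro nn_integral_cong sum.cong refl) auto
    also have "\<dots> = (\<integral>\<^sup>+x. 2 * (\<Sum>j<N. \<Sum>i<j. riesz_kernel s (x i) (x j)) \<partial>P)"
      by (intro nn_integral_cong sum_pairs_eq_twice riesz_kernel_commute)
    finally show ?thesis by (simp add: nn_integral_cmult[OF m])
  qed
  ultimately show thesis using that \<rho>' by blast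
qed

lemma D_cong_AE:
  assumes "AE x in lborel. f x = g x"
  shows "D s f = D s g"
  unfolding D_def
proof (rule nn_integral_cong_AE, use assms in eventually_elim)
  fix x :: 'a assume "f x = g x"
  then show "(\<integral>\<^sup>+y. ennreal (f x) * ennreal (f y) * riesz_kernel s x y \<partial>lborel) = (\<integral>\<^sup>+y. ennreal (g x) * ennreal (g y) * riesz_kernel s x y \<partial>lborel)"
    by (intro nn_integral_cong_AE) (use assms in auto)
qed

subsection \<open>Existence of a maximizer\<close>

text \<open>One particle uniform in the unit ball, all other slots empty: there are no pairs, hence
  no cost, while \<open>D\<close> contains the self-interaction of the density. It serves to show
  that \<open>Lambda\<close> is positive.\<close>

lemma one_particle_state:
  assumes s: "0 < s" and N: "1 \<le> N"
  obtains M :: "'a::euclidean_space measure" and X S \<rho> where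
    "gc_state N M X S (\<rho> :: 'a \<Rightarrow> real)" "power_mass s \<rho> < \<infinity>" "pair_cost s N M X S = 0" "0 < D s \<rho>"
proof -
  define \<eta> where "\<eta> = 1 / unit_ball_vol (real DIM('a))"
  have \<eta>: "\<eta> > 0" by (simp add: \<eta>_def)
  define B where "B = ball (0::'a) 1"
  have [measurable]: "B \<in> sets borel" by (simp add: B_def)
  have emB: "ennreal \<eta> * emeasure lborel B = 1"
    unfolding B_def using unit_ball_vol_pos[of "real DIM('a)"]
    by (subst emeasure_lborel_ball) (simp_all add: \<eta>_def less_imp_neq[symmetric] flip: ennreal_mult)
  define \<rho> where "\<rho> x = \<eta> * indicator B x" for x :: 'a
  have \<rho>e: "ennreal (\<rho> x) = ennreal \<eta> * indicator B x" for x by (simp add: \<rho>_def split: split_indicator)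
  have [measurable]: "\<rho> \<in> borel_measurable borel" unfolding \<rho>_def by measurable
  have mass: "(\<integral>\<^sup>+x. ennreal (\<rho> x) \<partial>lborel) = 1"
    unfolding \<rho>e by (simp add: nn_integral_cmult_indicator emB)
  define M where "M = density lborel (\<lambda>x. ennreal (\<rho> x))"
  have [measurable_cong]: "sets M = sets borel" by (simp add: M_def)
  have spM: "space M = UNIV" by (simp add: M_def)
  define S where "S i = (if i = 0 then space M else {})" for i :: nat
  have "gc_state N M (\<lambda>_ x. x) S \<rho>"
    unfolding gc_state_def
  proof (intro conjI ballI allI impI)
    show "prob_space M"
      by standard (simp add: M_def emeasure_density mass)
    fix f :: "'a \<Rightarrow> ennreal" assume [measurable]: "f \<in> borel_measurable borel"
    have "(\<Sum>i<N. \<integral>\<^sup>+\<omega>\<in>S i. f \<omega> \<partial>M) = (\<Sum>i\<in>{0}. \<integral>\<^sup>+\<omega>\<in>S i. f \<omega> \<partial>M)"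
      using N by (intro sum.mono_neutral_right) (auto simp: S_def)
    also have "\<dots> = (\<integral>\<^sup>+x. f x \<partial>M)" by (simp add: S_def spM)
    also have "\<dots> = (\<integral>\<^sup>+x. ennreal (\<rho> x) * f x \<partial>lborel)"
      unfolding M_def by (rule nn_integral_density) measurable
    finally show "(\<integral>\<^sup>+x. ennreal (\<rho> x) * f x \<partial>lborel) = (\<Sum>i<N. \<integral>\<^sup>+\<omega>\<in>S i. f \<omega> \<partial>M)" by simp
  qed (use \<eta> in \<open>auto simp: \<rho>_def S_def\<close>)
  moreover have "power_mass s \<rho> < \<infinity>"
  proof -
    have "power_mass s \<rho> = (\<integral>\<^sup>+x. ennreal (\<eta> powr (1 + s / real DIM('a))) * indicator B x \<partial>lborel)"
      unfolding power_mass_def by (intro nn_integral_cong) (simp add: \<rho>_def split: split_indicator)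
    also have "\<dots> < \<infinity>"
      unfolding B_def by (subst nn_integral_cmult_indicator) (auto simp: emeasure_lborel_ball ennreal_mult_less_top)
    finally show ?thesis .
  qed
  moreover have "pair_cost s N M (\<lambda>_ x. x) S = 0"
  proof -
    have "(\<Sum>i<N. \<Sum>j<N. if i \<noteq> j then indicator (S i) \<omega> * indicator (S j) \<omega> * riesz_kernel s \<omega> \<omega> else 0) = 0" for \<omega>
      by (intro sum.neutral ballI) (auto simp: S_def)
    then show ?thesis unfolding pair_cost_def by simp
  qed
  moreover have "0 < D s \<rho>"
  proof -
    have K: "ennreal (2 powr - s) \<le> riesz_kernel s x y" if "x \<in> B" "y \<in> B" for x y
    proof (cases "x = y")
      case False
      have "norm (x - y) \<le> 2"
        using that norm_triangle_ineq4[of x y] by (simp add: B_def)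
      then show ?thesis
        using False s by (simp add: riesz_kernel_offdiag ennreal_leI powr_mono2')
    qed (simp add: riesz_kernel_diag)
    have "0 < ennreal (2 powr - s)" by simp
    also have "ennreal (2 powr - s) = (\<integral>\<^sup>+x. ennreal (\<rho> x) * (\<integral>\<^sup>+y. ennreal (\<rho> y) * ennreal (2 powr - s) \<partial>lborel) \<partial>lborel)"
      by (simp add: nn_integral_multc mass)
    also have "\<dots> = (\<integral>\<^sup>+x. \<integral>\<^sup>+y. ennreal (\<rho> x) * ennreal (\<rho> y) * ennreal (2 powr - s) \<partial>lborel \<partial>lborel)"
      by (subst nn_integral_cmult[symmetric]) (simp_all add: mult.assoc)
    also have "\<dots> \<le> D s \<rho>"
      unfolding D_def \<rho>e
      by (intro nn_integral_mono) (auto simp: indicator_def intro!: mult_left_mono K)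
    finally show ?thesis .
  qed
  ultimately show thesis by (rule that)
qed

text \<open>The upper bound drops \<open>W\<close> and uses the estimate of \<open>D\<close> by the
  power mass. If the supremum were at most 0, \<open>gc_bound\<close> with l = 0 would give
  \<open>D\<close> \<le> 0 for a single particle without cost.\<close>

lemma Lambda_finite:
  assumes s: "0 < s" "s < real DIM('a::euclidean_space)" and N: "1 \<le> N"
  obtains l where "0 < l" "Lambda TYPE('a) s N = ereal l"
proof -
  define K where "K = (riesz_const TYPE('a) s + 1) * real N powr (1 - s / real DIM('a))"
  have K: "K > 0" using riesz_const_pos[OF s(2)] N by (simp add: K_def)
  have "G s N \<rho> / ereal (L s \<rho>) \<le> ereal K" if \<rho>: "\<rho> \<in> admissible s N" for \<rho> :: "'a \<Rightarrow> real"
  proof -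
    define \<rho>' where "\<rho>' x = max 0 (\<rho> x)" for x
    note adm = admissible_nonneg_part[OF \<rho>, folded \<rho>'_def]
    have nn: "0 \<le> \<rho>' x" for x by (simp add: \<rho>'_def)
    obtain m where m: "power_mass s \<rho>' = ennreal m" "0 \<le> m"
      using adm(3) by (cases "power_mass s \<rho>'") auto
    have "0 < power_mass s \<rho>'" by (rule power_mass_pos) (use adm nn N in auto)
    then have Lm: "L s \<rho> = m" "0 < m" using adm(4) m by auto
    have "2 * K = 2 * (riesz_const TYPE('a) s + 1) * real N powr (1 - s / real DIM('a))" by (simp add: K_def)
    moreover have "D s \<rho>' \<le> ennreal (2 * (riesz_const TYPE('a) s + 1) * real N powr (1 - s / real DIM('a))) * power_mass s \<rho>'"
      using N adm(2) by (intro D_le_power_mass s adm(1) nn) auto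
    ultimately have "D s \<rho> \<le> ennreal (2 * K) * ennreal m" by (simp only: adm(5) m(1))
    then have "D s \<rho> \<le> ennreal (2 * K * m)" using K m by (simp add: ennreal_mult)
    then have "ereal (1/2) * enn2ereal (D s \<rho>) \<le> ereal (1/2) * ereal (2 * K * m)"
      using K m by (intro ereal_mult_left_mono) (simp_all add: less_eq_ennreal.rep_eq enn2ereal_ennreal)
    moreover have "G s N \<rho> \<le> ereal (1/2) * enn2ereal (D s \<rho>)"
      unfolding G_def by (cases "W s N \<rho>"; cases "D s \<rho>") (auto simp: enn2ereal_ennreal)
    ultimately have "G s N \<rho> \<le> ereal (m * K)" by (simp add: mult.commute)
    then show ?thesis using Lm by (simp add: ereal_divide_le_pos)
  qed
  then have up: "Lambda TYPE('a) s N \<le> ereal K" unfolding Lambda_def by (rule SUP_least)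
  have "0 < Lambda TYPE('a) s N"
  proof (rule ccontr)
    assume "\<not> 0 < Lambda TYPE('a) s N"
    then have le0: "Lambda TYPE('a) s N \<le> ereal 0" by (simp add: not_less flip: zero_ereal_def)
    obtain M :: "'a measure" and X S \<rho> where "gc_state N M X S (\<rho> :: 'a \<Rightarrow> real)" "power_mass s \<rho> < \<infinity>"
      "pair_cost s N M X S = 0" "0 < D s \<rho>"
      using one_particle_state[OF s(1) N] .
    with gc_bound[OF s N _ _ le0, of M X S \<rho>] show False by simp
  qed
  with up show thesis using that by (cases "Lambda TYPE('a) s N") auto
qed

text \<open>An almost maximizing density with an almost minimizing plan, dilated to power mass 1.
  The density misses the supremum by less than \<epsilon>/4 and the plan misses \<open>W\<close> by
  less than \<epsilon> m/4; counting ordered pairs doubles both, which leaves \<epsilon> after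
  division by m.\<close>

lemma near_optimal_state:
  assumes s: "0 < s" "s < real DIM('a::euclidean_space)" and N: "1 \<le> N"
    and l: "0 < l" "Lambda TYPE('a) s N = ereal l" and \<epsilon>: "0 < \<epsilon>"
  obtains P :: "(nat \<Rightarrow> 'a::euclidean_space) measure" and X \<rho> where "gc_state N P X (\<lambda>_. space P) (\<rho> :: 'a \<Rightarrow> real)"
    "power_mass s \<rho> = 1" "pair_cost s N P X (\<lambda>_. space P) + ennreal (2 * l) \<le> D s \<rho> + ennreal \<epsilon>"
proof -
  have "ereal (l - \<epsilon> / 4) < Lambda TYPE('a) s N" using \<epsilon> by (simp add: l)
  then obtain \<rho>0 :: "'a \<Rightarrow> real" where \<rho>0: "\<rho>0 \<in> admissible s N" and GL: "ereal (l - \<epsilon> / 4) < G s N \<rho>0 / ereal (L s \<rho>0)"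
    unfolding Lambda_def less_SUP_iff by blast
  define \<rho> where "\<rho> x = max 0 (\<rho>0 x)" for x
  note adm = admissible_nonneg_part[OF \<rho>0, folded \<rho>_def]
  have nn: "0 \<le> \<rho> x" for x by (simp add: \<rho>_def)
  obtain m where m: "power_mass s \<rho> = ennreal m" "0 \<le> m"
    using adm(3) by (cases "power_mass s \<rho>") auto
  have "0 < power_mass s \<rho>" by (rule power_mass_pos) (use adm nn N in auto)
  then have Lm: "L s \<rho>0 = m" "0 < m" using adm(4) m by auto
  have "D s \<rho> < \<infinity>"
    using N adm by (intro le_less_trans[OF D_le_power_mass[OF s adm(1) nn, of "real N"]]) (auto simp: ennreal_mult_less_top)
  then obtain \<delta> where \<delta>: "D s \<rho> = ennreal \<delta>" "0 \<le> \<delta>" by (cases "D s \<rho>") auto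
  have "W s N \<rho>0 \<noteq> \<infinity>"
  proof
    assume "W s N \<rho>0 = \<infinity>"
    then have "G s N \<rho>0 = - \<infinity>" by (simp add: G_def adm(5) \<delta> enn2ereal_ennreal)
    then show False using GL Lm by simp
  qed
  then obtain w where w: "W s N \<rho>0 = ennreal w" "0 \<le> w" by (cases "W s N \<rho>0") auto
  have "ereal (l - \<epsilon> / 4) < ereal ((\<delta> / 2 - w) / m)"
    using GL Lm \<delta> w by (simp add: G_def adm(5) enn2ereal_ennreal)
  then have gap: "(l - \<epsilon> / 4) * m < \<delta> / 2 - w"
    using Lm by (simp add: pos_less_divide_eq)
  have "W s N \<rho>0 < ennreal (w + \<epsilon> * m / 4)" using w \<epsilon> Lm by (simp add: ennreal_lessI)
  then obtain P where P: "P \<in> plans N \<rho>0" and cost: "(\<integral>\<^sup>+x. (\<Sum>j<N. \<Sum>i<j. riesz_kernel s (x i) (x j)) \<partial>P) < ennreal (w + \<epsilon> * m / 4)"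
    unfolding W_def INF_less_iff by blast
  have "ennreal (\<rho> x) = ennreal (\<rho>0 x)" for x by (simp add: \<rho>_def max_def ennreal_neg)
  then have sp: "sym_prob N P" "one_body N P = density lborel (\<lambda>x. ennreal (\<rho> x))"
    using P by (simp_all add: plans_def)
  obtain \<rho>1 where gc1: "gc_state N P (\<lambda>i x. x i) (\<lambda>_. space P) \<rho>1" and eq1: "AE x in lborel. \<rho> x = \<rho>1 x"
    and pc1: "pair_cost s N P (\<lambda>i x. x i) (\<lambda>_. space P) = 2 * (\<integral>\<^sup>+x. (\<Sum>j<N. \<Sum>i<j. riesz_kernel s (x i) (x j)) \<partial>P)"
    using plan_gc_state[OF adm(1) nn sp] .
  have pm1: "power_mass s \<rho>1 = ennreal m" and D1: "D s \<rho>1 = ennreal \<delta>"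
    using power_mass_cong_AE[OF eq1] D_cong_AE[OF eq1] m \<delta> by auto
  \<comment> \<open>Chosen so that c^-s = 1/m, the factor that brings the power mass m to 1.\<close>
  define c where "c = m powr (1 / s)"
  have c: "c > 0" "c powr - s = 1 / m" using Lm s by (auto simp: c_def powr_powr powr_minus field_simps)
  define X where "X i x = c *\<^sub>R x i + (0::'a)" for i :: nat and x :: "nat \<Rightarrow> 'a"
  define \<rho>2 where "\<rho>2 x = \<rho>1 ((x - 0) /\<^sub>R c) / c ^ DIM('a)" for x
  have gc2: "gc_state N P X (\<lambda>_. space P) \<rho>2" and pm2: "power_mass s \<rho>2 = ennreal (c powr - s) * power_mass s \<rho>1"
    and pc2: "pair_cost s N P X (\<lambda>_. space P) = ennreal (c powr - s) * pair_cost s N P (\<lambda>i x. x i) (\<lambda>_. space P)"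
    and D2: "D s \<rho>2 = ennreal (c powr - s) * D s \<rho>1"
    unfolding X_def[abs_def] \<rho>2_def[abs_def] by (rule gc_state_affine[OF c(1) gc1])+
  have "power_mass s \<rho>2 = 1" using Lm by (simp add: pm2 pm1 c flip: ennreal_mult)
  moreover have "pair_cost s N P X (\<lambda>_. space P) + ennreal (2 * l) \<le> D s \<rho>2 + ennreal \<epsilon>"
  proof -
    have "pair_cost s N P (\<lambda>i x. x i) (\<lambda>_. space P) \<le> 2 * ennreal (w + \<epsilon> * m / 4)"
      unfolding pc1 using cost by (intro mult_left_mono) auto
    also have "\<dots> = ennreal (2 * (w + \<epsilon> * m / 4))"
    proof -
      have h: "ennreal (2 * (w + \<epsilon> * m / 4)) = ennreal 2 * ennreal (w + \<epsilon> * m / 4)"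
        using w \<epsilon> Lm by (intro ennreal_mult) auto
      show ?thesis unfolding h by simp
    qed
    also have "\<dots> \<le> ennreal (\<delta> - 2 * l * m + \<epsilon> * m)"
      using gap by (intro ennreal_leI) (simp add: algebra_simps)
    finally have pcle: "pair_cost s N P (\<lambda>i x. x i) (\<lambda>_. space P) \<le> ennreal (\<delta> - 2 * l * m + \<epsilon> * m)" .
    have pos: "0 \<le> \<delta> - 2 * l * m + \<epsilon> * m"
    proof -
      have "0 \<le> 2 * (w + \<epsilon> * m / 4)" using w \<epsilon> Lm by simp
      also have "\<dots> \<le> \<delta> - 2 * l * m + \<epsilon> * m" using gap by (simp add: algebra_simps)
      finally show ?thesis .
    qed
    have "pair_cost s N P X (\<lambda>_. space P) + ennreal (2 * l) \<le> ennreal (1 / m) * ennreal (\<delta> - 2 * l * m + \<epsilon> * m) + ennreal (2 * l)"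
      unfolding pc2 c by (intro add_mono mult_left_mono pcle) auto
    also have "\<dots> = ennreal ((1 / m) * (\<delta> - 2 * l * m + \<epsilon> * m) + 2 * l)"
      using Lm l pos by (subst ennreal_mult[symmetric]) auto
    also have "(1 / m) * (\<delta> - 2 * l * m + \<epsilon> * m) + 2 * l = (1 / m) * \<delta> + \<epsilon>"
      using Lm by (simp add: field_simps)
    also have "ennreal ((1 / m) * \<delta> + \<epsilon>) = ennreal (1 / m) * ennreal \<delta> + ennreal \<epsilon>"
      using Lm \<delta> \<epsilon> by (subst ennreal_mult[symmetric]) auto
    finally show ?thesis unfolding D2 D1 c .
  qed
  ultimately show thesis using that gc2 by blast
qed

lemma optimal_canonical_state:
  assumes s: "0 < s" "s < real DIM('a::euclidean_space)" and N: "1 \<le> N"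
    and l: "0 < l" "Lambda TYPE('a) s N = ereal l"
  obtains k and M :: "real measure" and X \<rho> where "1 \<le> k" "k \<le> N"
    "gc_state k M X (\<lambda>_. space M) (\<rho> :: 'a \<Rightarrow> real)" "power_mass s \<rho> < \<infinity>" "D s \<rho> < \<infinity>"
    "pair_cost s k M X (\<lambda>_. space M) + ennreal (2 * l) * power_mass s \<rho> \<le> D s \<rho>"
proof -
  \<comment> \<open>The errors tend to 0 and never exceed l, so every state of the sequence has
    energy at least l; this lower bound is what excludes vanishing.\<close>
  define e where "e n = l / (real n + 1)" for n :: nat
  have e: "0 < e n" "e n \<le> l" for n using l(1) by (auto simp: e_def divide_le_eq mult_le_cancel_left1)
  have "\<exists>R>0. \<exists>m>0. \<forall>\<rho> :: 'a \<Rightarrow> real. \<rho> \<in> borel_measurable borel \<longrightarrow> (\<forall>x. 0 \<le> \<rho> x) \<longrightarrow>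
      power_mass s \<rho> \<le> 1 \<longrightarrow> (\<integral>\<^sup>+x. ennreal (\<rho> x) \<partial>lborel) \<le> ennreal (real N) \<longrightarrow> ennreal l \<le> D s \<rho> \<longrightarrow>
      (\<exists>x. ennreal m \<le> (\<integral>\<^sup>+y\<in>ball x R. ennreal (\<rho> y) \<partial>lborel))"
    using N by (intro nonvanishing s l) auto
  then obtain R m where m: "0 < m" and nonv: "\<And>\<rho> :: 'a \<Rightarrow> real. \<rho> \<in> borel_measurable borel \<Longrightarrow> (\<forall>x. 0 \<le> \<rho> x) \<Longrightarrow>
      power_mass s \<rho> \<le> 1 \<Longrightarrow> (\<integral>\<^sup>+x. ennreal (\<rho> x) \<partial>lborel) \<le> ennreal (real N) \<Longrightarrow> ennreal l \<le> D s \<rho> \<Longrightarrow>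
      \<exists>x. ennreal m \<le> (\<integral>\<^sup>+y\<in>ball x R. ennreal (\<rho> y) \<partial>lborel)"
    by blast
  define Q where "Q n P X \<rho> \<longleftrightarrow>
      gc_state N (P :: (nat \<Rightarrow> 'a) measure) X (\<lambda>_. space P) (\<rho> :: 'a \<Rightarrow> real) \<and> power_mass s \<rho> = 1 \<and>
      pair_cost s N P X (\<lambda>_. space P) + ennreal (2 * l) \<le> D s \<rho> + ennreal (e n) \<and>
      ennreal m \<le> (\<integral>\<^sup>+x\<in>ball 0 R. ennreal (\<rho> x) \<partial>lborel)" for n P X \<rho>
  have "\<exists>P X \<rho>. Q n P X \<rho>" for n
  proof -
    obtain P :: "(nat \<Rightarrow> 'a) measure" and X and \<rho> :: "'a \<Rightarrow> real" where gc: "gc_state N P X (\<lambda>_. space P) \<rho>"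
      and pm: "power_mass s \<rho> = 1" and opt: "pair_cost s N P X (\<lambda>_. space P) + ennreal (2 * l) \<le> D s \<rho> + ennreal (e n)"
      using near_optimal_state[OF s N l e(1)] .
    have [measurable]: "\<rho> \<in> borel_measurable borel" using gc_stateD(4)[OF gc] .
    have "ennreal l + ennreal l = ennreal (2 * l)" using l by (simp flip: ennreal_plus)
    also have "\<dots> \<le> pair_cost s N P X (\<lambda>_. space P) + ennreal (2 * l)" by simp
    also have "\<dots> \<le> D s \<rho> + ennreal l"
      by (rule order_trans[OF opt]) (intro add_mono order_refl ennreal_leI e)
    finally have "ennreal l + ennreal l \<le> ennreal l + D s \<rho>"
      unfolding add.commute[of "D s \<rho>"] .
    then have "ennreal l \<le> D s \<rho>"
      by (simp add: ennreal_add_left_cancel_le)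
    then obtain x where x: "ennreal m \<le> (\<integral>\<^sup>+y\<in>ball x R. ennreal (\<rho> y) \<partial>lborel)"
      using nonv[of \<rho>] gc_stateD(4,5)[OF gc] pm gc_state_mass_le[OF gc] by auto
    \<comment> \<open>Translation that moves the centre of a ball carrying mass at least
      \<open>m\<close> to the origin.\<close>
    define X' where "X' i \<omega> = 1 *\<^sub>R X i \<omega> + - x" for i \<omega>
    define \<rho>' where "\<rho>' y = \<rho> ((y - - x) /\<^sub>R 1) / 1 ^ DIM('a)" for y
    have "gc_state N P X' (\<lambda>_. space P) \<rho>'" "power_mass s \<rho>' = 1"
      "pair_cost s N P X' (\<lambda>_. space P) = pair_cost s N P X (\<lambda>_. space P)" "D s \<rho>' = D s \<rho>"
      unfolding X'_def[abs_def] \<rho>'_def[abs_def] gc_state_affine(2-4)[OF zero_less_one gc] pm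
      by (rule gc_state_affine(1)[OF zero_less_one gc]) simp_all
    moreover have "(\<integral>\<^sup>+y\<in>ball 0 R. ennreal (\<rho>' y) \<partial>lborel) = (\<integral>\<^sup>+y\<in>ball x R. ennreal (\<rho> y) \<partial>lborel)"
    proof -
      have "(\<integral>\<^sup>+y\<in>ball 0 R. ennreal (\<rho>' y) \<partial>lborel) = (\<integral>\<^sup>+y. ennreal (\<rho> (y + x)) * indicator (ball x R) (y + x) \<partial>lborel)"
        by (intro nn_integral_cong) (simp add: \<rho>'_def indicator_def dist_norm)
      also have "\<dots> = (\<integral>\<^sup>+y\<in>ball x R. ennreal (\<rho> y) \<partial>lborel)"
        by (intro nn_integral_lborel_shift borel_measurable_times_ennreal borel_measurable_indicator borel_open open_ball) measurable
      finally show ?thesis .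
    qed
    ultimately have "Q n P X' \<rho>'" using opt x by (simp add: Q_def)
    then show ?thesis by blast
  qed
  then obtain P :: "nat \<Rightarrow> (nat \<Rightarrow> 'a) measure" and X :: "nat \<Rightarrow> nat \<Rightarrow> (nat \<Rightarrow> 'a) \<Rightarrow> 'a"
    and \<rho> :: "nat \<Rightarrow> 'a \<Rightarrow> real" where Q: "\<And>n. Q n (P n) (X n) (\<rho> n)"
    by metis
  have gc: "gc_state N (P n) (X n) (\<lambda>_. space (P n)) (\<rho> n)" and pm: "power_mass s (\<rho> n) = 1"
    and opt: "pair_cost s N (P n) (X n) (\<lambda>_. space (P n)) + ennreal (2 * l) \<le> D s (\<rho> n) + ennreal (e n)"
    and tight: "ennreal m \<le> (\<integral>\<^sup>+x\<in>ball 0 R. ennreal (\<rho> n x) \<partial>lborel)" for n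
    using Q[of n] by (simp_all add: Q_def)
  obtain r and \<Omega> :: "real measure" and Y where r: "strict_mono (r :: nat \<Rightarrow> nat)" and \<Omega>: "prob_space \<Omega>"
    and Ym: "\<And>n i. i < N \<Longrightarrow> Y n i \<in> borel_measurable \<Omega>"
    and law: "\<And>n f. f \<in> borel_measurable (config_space N) \<Longrightarrow>
      (\<integral>\<^sup>+\<omega>. f (\<lambda>i\<in>{..<N}. Y n i \<omega>) \<partial>\<Omega>) = (\<integral>\<^sup>+\<omega>. f (\<lambda>i\<in>{..<N}. X (r n) i \<omega>) \<partial>P (r n))"
    and conv: "AE \<omega> in \<Omega>. \<forall>i<N. convergent (\<lambda>n. Y n i \<omega>) \<or> filterlim (\<lambda>n. norm (Y n i \<omega>)) at_top sequentially"
    using skorohod_configurations[of P N X, OF gc_stateD(1)[OF gc] gc_stateD(2)[OF gc]] by blast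
  interpret \<Omega>: prob_space \<Omega> by fact
  \<comment> \<open>The densities and the costs depend only on the joint law of the particles, which
    \<open>law\<close> carries over to the common probability space.\<close>
  have gcY: "gc_state N \<Omega> (Y n) (\<lambda>_. space \<Omega>) (\<rho> (r n))" for n
    unfolding gc_state_def
  proof (intro conjI ballI allI impI)
    fix f :: "'a \<Rightarrow> ennreal" assume f[measurable]: "f \<in> borel_measurable borel"
    have "(\<integral>\<^sup>+x. ennreal (\<rho> (r n) x) * f x \<partial>lborel) = (\<Sum>i<N. \<integral>\<^sup>+\<omega>\<in>space (P (r n)). f (X (r n) i \<omega>) \<partial>P (r n))"
      by (rule gc_stateD(6)[OF gc f])
    also have "\<dots> = (\<Sum>i<N. \<integral>\<^sup>+\<omega>\<in>space \<Omega>. f (Y n i \<omega>) \<partial>\<Omega>)"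
    proof (rule sum.cong[OF refl])
      fix i assume i: "i \<in> {..<N}"
      have [measurable]: "(\<lambda>x. x i) \<in> borel_measurable (config_space N :: (nat \<Rightarrow> 'a) measure)"
        using i by (rule measurable_component_singleton)
      have "(\<integral>\<^sup>+\<omega>. f ((\<lambda>i\<in>{..<N}. Y n i \<omega>) i) \<partial>\<Omega>) = (\<integral>\<^sup>+\<omega>. f ((\<lambda>i\<in>{..<N}. X (r n) i \<omega>) i) \<partial>P (r n))"
        by (rule law[of "\<lambda>x. f (x i)"]) measurable
      then have "(\<integral>\<^sup>+\<omega>. f (Y n i \<omega>) \<partial>\<Omega>) = (\<integral>\<^sup>+\<omega>. f (X (r n) i \<omega>) \<partial>P (r n))" using i by simp
      moreover have "(\<integral>\<^sup>+\<omega>\<in>space \<Omega>. f (Y n i \<omega>) \<partial>\<Omega>) = (\<integral>\<^sup>+\<omega>. f (Y n i \<omega>) \<partial>\<Omega>)"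
        by (intro nn_integral_cong) simp
      moreover have "(\<integral>\<^sup>+\<omega>\<in>space (P (r n)). f (X (r n) i \<omega>) \<partial>P (r n)) = (\<integral>\<^sup>+\<omega>. f (X (r n) i \<omega>) \<partial>P (r n))"
        by (intro nn_integral_cong) simp
      ultimately show "(\<integral>\<^sup>+\<omega>\<in>space (P (r n)). f (X (r n) i \<omega>) \<partial>P (r n)) = (\<integral>\<^sup>+\<omega>\<in>space \<Omega>. f (Y n i \<omega>) \<partial>\<Omega>)" by simp
    qed
    finally show "(\<integral>\<^sup>+x. ennreal (\<rho> (r n) x) * f x \<partial>lborel) = (\<Sum>i<N. \<integral>\<^sup>+\<omega>\<in>space \<Omega>. f (Y n i \<omega>) \<partial>\<Omega>)" .
  qed (use \<Omega> Ym gc_stateD(4,5)[OF gc] in auto)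
  have pcY: "pair_cost s N \<Omega> (Y n) (\<lambda>_. space \<Omega>) = pair_cost s N (P (r n)) (X (r n)) (\<lambda>_. space (P (r n)))" for n
  proof -
    define F where "F x = (\<Sum>i<N. \<Sum>j<N. if i \<noteq> j then riesz_kernel s (x i) (x j) else 0)" for x :: "nat \<Rightarrow> 'a"
    have Fm: "F \<in> borel_measurable (config_space N)"
      unfolding F_def[abs_def]
      by (intro borel_measurable_sum measurable_If riesz_kernel_measurable measurable_component_singleton) auto
    have F1: "pair_cost s N M Z (\<lambda>_. space M) = (\<integral>\<^sup>+\<omega>. F (\<lambda>i\<in>{..<N}. Z i \<omega>) \<partial>M)" for M :: "(nat \<Rightarrow> 'a) measure" and Z
      unfolding pair_cost_def F_def by (intro nn_integral_cong sum.cong refl) auto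
    have F2: "pair_cost s N M Z (\<lambda>_. space M) = (\<integral>\<^sup>+\<omega>. F (\<lambda>i\<in>{..<N}. Z i \<omega>) \<partial>M)" for M :: "real measure" and Z
      unfolding pair_cost_def F_def by (intro nn_integral_cong sum.cong refl) auto
    show ?thesis unfolding F1 F2 by (rule law[OF Fm])
  qed
  have e0: "(\<lambda>n. e (r n)) \<longlonglongrightarrow> 0"
  proof -
    have "(\<lambda>n. l * (1 / real (Suc n))) \<longlonglongrightarrow> l * 0"
      by (intro tendsto_mult_left LIMSEQ_Suc[OF lim_1_over_n])
    then have "e \<longlonglongrightarrow> 0" by (simp add: e_def[abs_def] add.commute)
    then show ?thesis using LIMSEQ_subseq_LIMSEQ[OF _ r] by (simp add: comp_def)
  qed
  obtain Z S a where gcZ: "gc_state N \<Omega> Z S a" and apm: "power_mass s (a :: 'a \<Rightarrow> real) < \<infinity>"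
    and aopt: "pair_cost s N \<Omega> Z S + ennreal (2 * l) * power_mass s a \<le> D s a" and aD: "D s a < \<infinity>"
    and apos: "0 < (\<integral>\<^sup>+x. ennreal (a x) \<partial>lborel)"
  proof (rule limit_state[OF s N conv gcY pm _ _ _ e0 m tight])
    show "Lambda TYPE('a) s N \<le> ereal l" "0 \<le> l" using l by auto
    show "pair_cost s N \<Omega> (Y n) (\<lambda>_. space \<Omega>) + ennreal (2 * l) \<le> D s (\<rho> (r n)) + ennreal (e (r n))" for n
      unfolding pcY by (rule opt)
  qed
  define C where "C \<omega> = {i\<in>{..<N}. \<omega> \<in> S i}" for \<omega>
  have Sm[measurable]: "S i \<in> sets \<Omega>" if "i < N" for i using gc_stateD(3)[OF gcZ that] .
  have "(\<integral>\<^sup>+x. ennreal (a x) \<partial>lborel) < \<infinity>" using gc_state_mass_le[OF gcZ] by (simp add: le_less_trans)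
  then obtain \<mu> where \<mu>: "(\<integral>\<^sup>+x. ennreal (a x) \<partial>lborel) = ennreal \<mu>" "0 \<le> \<mu>"
    by (cases "\<integral>\<^sup>+x. ennreal (a x) \<partial>lborel") auto
  have \<mu>pos: "0 < \<mu>" using apos \<mu> by simp
  have meanC: "(\<integral>\<^sup>+\<omega>. ennreal (real (card (C \<omega>))) \<partial>\<Omega>) = ennreal \<mu>"
  proof -
    have "ennreal (real (card (C \<omega>))) = (\<Sum>i<N. indicator (S i) \<omega>)" for \<omega>
    proof -
      have "(\<Sum>i<N. indicator (S i) \<omega> :: ennreal) = (\<Sum>i\<in>C \<omega>. 1)"
        by (intro sum.mono_neutral_cong_right) (auto simp: C_def indicator_def)
      then show ?thesis by (simp add: ennreal_of_nat_eq_real_of_nat)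
    qed
    then have "(\<integral>\<^sup>+\<omega>. ennreal (real (card (C \<omega>))) \<partial>\<Omega>) = (\<integral>\<^sup>+\<omega>. (\<Sum>i<N. indicator (S i) \<omega>) \<partial>\<Omega>)" by simp
    also have "\<dots> = (\<Sum>i<N. emeasure \<Omega> (S i))"
      by (subst nn_integral_sum) (auto intro!: sum.cong)
    finally show ?thesis using gc_state_mass[OF gcZ] \<mu> by simp
  qed
  \<comment> \<open>Every set of present particles that occurs with positive probability has at
    least the mean number \<mu> of elements. The full set satisfies this trivially, any other has a
    free slot.\<close>
  have T_ge: "\<mu> \<le> real (card T)"
    if T: "T \<subseteq> {..<N}" and pos: "0 < measure \<Omega> {\<omega>\<in>space \<Omega>. \<forall>i<N. \<omega> \<in> S i \<longleftrightarrow> i \<in> T}" for T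
  proof (cases "T = {..<N}")
    case True
    then show ?thesis using gc_state_mass_le[OF gcZ] \<mu> by (simp add: ennreal_le_iff)
  next
    case False
    have "(\<integral>\<^sup>+x. ennreal (a x) \<partial>lborel) \<le> ennreal (real (card T))"
      by (rule optimal_gc_state_mass_le[OF s N gcZ apm _ _ aopt aD _ pos]) (use l T False in auto)
    then show ?thesis by (simp add: \<mu> ennreal_le_iff)
  qed
  have "AE \<omega> in \<Omega>. \<forall>T\<in>Pow {..<N}. C \<omega> = T \<longrightarrow> \<mu> \<le> real (card T)"
  proof (intro AE_finite_allI)
    fix T assume "T \<in> Pow {..<N}"
    then have T: "T \<subseteq> {..<N}" by simp
    define E where "E = {\<omega>\<in>space \<Omega>. \<forall>i<N. \<omega> \<in> S i \<longleftrightarrow> i \<in> T}"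
    have Em: "E \<in> sets \<Omega>"
    proof -
      have "E = {\<omega>\<in>space \<Omega>. \<forall>i\<in>{..<N}. \<omega> \<in> S i \<longleftrightarrow> i \<in> T}" by (auto simp: E_def)
      also have "\<dots> \<in> sets \<Omega>" by (intro sets.sets_Collect_finite_All) (auto simp: Sm intro!: predE)
      finally show ?thesis .
    qed
    show "AE \<omega> in \<Omega>. C \<omega> = T \<longrightarrow> \<mu> \<le> real (card T)"
    proof (cases "0 < measure \<Omega> E")
      case True
      then show ?thesis using T_ge[OF T] by (simp add: E_def)
    next
      case False
      then have "measure \<Omega> E = 0" using measure_nonneg[of \<Omega> E] by linarith
      then have "E \<in> null_sets \<Omega>" using Em by (simp add: null_sets_def \<Omega>.emeasure_eq_measure)
      then have "AE \<omega> in \<Omega>. \<omega> \<notin> E" by (rule AE_not_in)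
      then show ?thesis
        using AE_space by eventually_elim (use T in \<open>auto simp: E_def C_def\<close>)
    qed
  qed simp
  \<comment> \<open>A particle number that is almost surely at least its own mean is almost surely
    equal to it: the difference is nonnegative and has integral 0.\<close>
  then have ge: "AE \<omega> in \<Omega>. \<mu> \<le> real (card (C \<omega>))"
    by eventually_elim (auto simp: C_def)
  have Cm[measurable]: "(\<lambda>\<omega>. real (card (C \<omega>))) \<in> borel_measurable \<Omega>"
  proof -
    have "real (card (C \<omega>)) = (\<Sum>i<N. indicator (S i) \<omega>)" for \<omega>
    proof -
      have "(\<Sum>i<N. indicator (S i) \<omega> :: real) = (\<Sum>i\<in>C \<omega>. 1)"
        by (intro sum.mono_neutral_cong_right) (auto simp: C_def indicator_def)
      then show ?thesis by simp
    qed
    moreover have "(\<lambda>\<omega>. \<Sum>i<N. indicator (S i) \<omega> :: real) \<in> borel_measurable \<Omega>"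
      by (intro borel_measurable_sum borel_measurable_indicator) (auto simp: Sm)
    ultimately show ?thesis by simp
  qed
  have "(\<integral>\<^sup>+\<omega>. ennreal (real (card (C \<omega>)) - \<mu>) \<partial>\<Omega>) + ennreal \<mu> = ennreal \<mu>"
  proof -
    have "(\<integral>\<^sup>+\<omega>. ennreal (real (card (C \<omega>)) - \<mu>) \<partial>\<Omega>) + ennreal \<mu> = (\<integral>\<^sup>+\<omega>. ennreal (real (card (C \<omega>)) - \<mu>) + ennreal \<mu> \<partial>\<Omega>)"
      by (subst nn_integral_add) (auto simp: \<Omega>.emeasure_space_1)
    also have "\<dots> = (\<integral>\<^sup>+\<omega>. ennreal (real (card (C \<omega>))) \<partial>\<Omega>)"
      using ge by (intro nn_integral_cong_AE) (auto elim!: eventually_mono simp: \<mu>(2) simp flip: ennreal_plus)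
    finally show ?thesis by (simp add: meanC)
  qed
  then have "(\<integral>\<^sup>+\<omega>. ennreal (real (card (C \<omega>)) - \<mu>) \<partial>\<Omega>) = 0"
    using ennreal_add_left_cancel[of "ennreal \<mu>" "\<integral>\<^sup>+\<omega>. ennreal (real (card (C \<omega>)) - \<mu>) \<partial>\<Omega>" 0] by (simp add: add.commute)
  then have "AE \<omega> in \<Omega>. ennreal (real (card (C \<omega>)) - \<mu>) = 0"
    by (subst (asm) nn_integral_0_iff_AE) auto
  with ge have AEC: "AE \<omega> in \<Omega>. real (card (C \<omega>)) = \<mu>"
    by eventually_elim (auto simp: ennreal_eq_0_iff)
  then obtain \<omega>0 where \<omega>0: "real (card (C \<omega>0)) = \<mu>"
    using eventually_happens[OF AEC] \<Omega>.ae_filter_bot by blast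
  \<comment> \<open>The mean turns out to be an integer, positive because the limit has positive
    mass.\<close>
  define k where "k = card (C \<omega>0)"
  have k: "1 \<le> k" "k \<le> N"
  proof -
    show "1 \<le> k" using \<omega>0 \<mu>pos by (simp add: k_def Suc_le_eq del: of_nat_0_less_iff flip: of_nat_0_less_iff[where 'a=real])
    have "card (C \<omega>0) \<le> card {..<N}" by (intro card_mono) (auto simp: C_def)
    then show "k \<le> N" by (simp add: k_def)
  qed
  have "AE \<omega> in \<Omega>. card {i\<in>{..<N}. \<omega> \<in> S i} = k"
    using AEC by eventually_elim (use \<omega>0 in \<open>simp add: k_def C_def\<close>)
  then obtain X' where "gc_state k \<Omega> X' (\<lambda>_. space \<Omega>) a" "pair_cost s k \<Omega> X' (\<lambda>_. space \<Omega>) = pair_cost s N \<Omega> Z S"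
    using gc_state_relabel[OF gcZ] by blast
  with k apm aD aopt show thesis using that by simp
qed

theorem proposition5p1:
  fixes s :: real and N :: nat
  assumes "0 < s" and "s < real DIM('a::euclidean_space)"
    and "1 \<le> N"
    and "1 < N \<Longrightarrow> Lambda TYPE('a) s N > Max (Lambda TYPE('a) s ` {1..<N})"
  shows "\<exists>\<rho> \<in> (admissible s N :: ('a \<Rightarrow> real) set).
           G s N \<rho> / ereal (L s \<rho>) = Lambda TYPE('a) s N"
proof -
  note s = assms(1,2) and N = assms(3)
  obtain l where l: "0 < l" "Lambda TYPE('a) s N = ereal l"
    using Lambda_finite[OF s N] .
  obtain k and M :: "real measure" and X \<rho> where k: "1 \<le> k" "k \<le> N"
    and gc: "gc_state k M X (\<lambda>_. space M) (\<rho> :: 'a \<Rightarrow> real)" and pm: "power_mass s \<rho> < \<infinity>" and D: "D s \<rho> < \<infinity>"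
    and opt: "pair_cost s k M X (\<lambda>_. space M) + ennreal (2 * l) * power_mass s \<rho> \<le> D s \<rho>"
    using optimal_canonical_state[OF s N l] .
  interpret M: prob_space M using gc_stateD(1)[OF gc] .
  have "0 < (\<integral>\<^sup>+x. ennreal (\<rho> x) \<partial>lborel)"
    using gc_state_mass[OF gc] k by (simp add: M.emeasure_space_1)
  then have pmpos: "0 < power_mass s \<rho>"
    by (rule power_mass_pos[rotated 2]) (use gc_stateD(4,5)[OF gc] in auto)
  obtain m where m: "power_mass s \<rho> = ennreal m" "0 < m"
    using pm pmpos by (cases "power_mass s \<rho>") auto
  obtain \<delta> where \<delta>: "D s \<rho> = ennreal \<delta>" "0 \<le> \<delta>" using D by (cases "D s \<rho>") auto
  have "pair_cost s k M X (\<lambda>_. space M) < \<infinity>"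
    using opt D by (metis add_increasing2 le_less_trans order_refl order_trans zero_le infinity_ennreal_def add.commute le_iff_add)
  then obtain c where c: "pair_cost s k M X (\<lambda>_. space M) = ennreal c" "0 \<le> c"
    by (cases "pair_cost s k M X (\<lambda>_. space M)") auto
  have ineq: "c + 2 * l * m \<le> \<delta>"
    using opt c m \<delta> l by (simp flip: ennreal_mult ennreal_plus)
  \<comment> \<open>For k < N the same state would satisfy the bound with the strictly smaller
    \<open>Lambda\<close> at k, contradicting its optimality at level l, since its power mass is
    positive. For N = 1 there is no such k.\<close>
  have "k = N"
  proof (rule ccontr)
    assume "k \<noteq> N"
    with k have kN: "k < N" "1 < N" by auto
    obtain l' where l': "0 < l'" "Lambda TYPE('a) s k = ereal l'"
      using Lambda_finite[OF s k(1)] .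
    have "Lambda TYPE('a) s k \<le> Max (Lambda TYPE('a) s ` {1..<N})"
      using k kN by (intro Max_ge) auto
    also have "\<dots> < Lambda TYPE('a) s N" by (rule assms(4)[OF kN(2)])
    finally have "l' < l" using l l' by simp
    have "D s \<rho> \<le> pair_cost s k M X (\<lambda>_. space M) + ennreal (2 * l') * power_mass s \<rho>"
      using l' by (intro canonical_bound[OF k(1) gc pm]) auto
    then have "\<delta> \<le> c + 2 * l' * m"
      using c m \<delta> l' by (simp flip: ennreal_mult ennreal_plus)
    moreover have "2 * l' * m < 2 * l * m" using \<open>l' < l\<close> m by simp
    ultimately show False using ineq by linarith
  qed
  with gc c(1) have gc: "gc_state N M X (\<lambda>_. space M) \<rho>" and c1: "pair_cost s N M X (\<lambda>_. space M) = ennreal c"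
    by auto
  have adm: "\<rho> \<in> admissible s N" and Lm: "L s \<rho> = m"
    using gc_state_admissible[OF gc pm] m by auto
  \<comment> \<open>\<open>W\<close> is at most the cost of this realization, so the ratio is at
    least l; the definition of \<open>Lambda\<close> as a supremum gives the converse.\<close>
  have W2: "2 * W s N \<rho> \<le> ennreal c"
    using W_le_pair_cost[OF gc, of s] c1 by simp
  then have "W s N \<rho> \<noteq> \<infinity>" by (auto simp: ennreal_mult_top top_unique)
  then obtain w where w: "W s N \<rho> = ennreal w" "0 \<le> w" by (cases "W s N \<rho>") auto
  have wc: "2 * w \<le> c"
    using W2 w c by (simp add: ennreal_mult[symmetric] flip: ennreal_numeral)
  have "G s N \<rho> / ereal (L s \<rho>) = ereal ((\<delta> / 2 - w) / m)"
    using Lm m \<delta> w by (simp add: G_def enn2ereal_ennreal)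
  moreover have "l \<le> (\<delta> / 2 - w) / m"
    using ineq wc m by (simp add: pos_le_divide_eq)
  ultimately have "Lambda TYPE('a) s N \<le> G s N \<rho> / ereal (L s \<rho>)" by (simp add: l)
  moreover have "G s N \<rho> / ereal (L s \<rho>) \<le> Lambda TYPE('a) s N"
    unfolding Lambda_def by (rule SUP_upper[OF adm])
  ultimately show ?thesis using adm by (intro bexI[of _ \<rho>] antisym)
qed

end
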